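(* Let $(c_n)$ be a sequence with $c_n>0$ and $c_n\to 0$, and put $p_n=c_n/n$. Let $f:\mathbb N\to\mathbb N$ satisfy $f(n)\to\infty$ and $$f(n)\bigl(\log f(n)+\log(1/c_n)\bigr)=o(\log n)\qquad(n\to\infty).$$ Put $H_n=\mathrm{Prune}_{f(n)}(G(n,p_n))$. Then $(H_n)$ has an $\mathrm{MSO}_2$ zero--one law: for every $\mathrm{MSO}_2$ sentence $\varphi$ of graphs, $\lim_{n\to\infty}\mathbb P(H_n\models\varphi)$ exists and is $0$ or $1$. In particular, $(H_n)$ has an $\mathrm{MSO}_1$ zero--one law and a first-order zero--one law.
   Context: $G(n,p)$ is the random graph on vertex set $[n]=\{1,\dots,n\}$ in which each edge is present independently with probability $p$ (for finitely many small $n$ with $p_n>1$ the model may be defined arbitrarily). $\mathbb N$ denotes the positive integers. For a finite graph $G$ and an integer $m\ge 1$, $\mathrm{Prune}_m(G)$ is the subgraph of $G$ induced on $\{v\in V(G): |C_G(v)|\ge m\}$, where $C_G(v)$ is the connected component of $v$; that is, every component with fewer than $m$ vertices is deleted. First-order logic of graphs uses one binary symbol $E$ interpreted as symmetric irreflexive adjacency. $\mathrm{MSO}_2$ is monadic second-order logic over the two-sorted incidence structure of a graph (a vertex sort, an edge sort, and the incidence relation): one may quantify over vertices, edges, sets of vertices and sets of edges. $\mathrm{MSO}_1$ is the fragment in which set variables range only over sets of vertices. A sequence of random graphs has a zero--one law for a logic if for every sentence $\varphi$ of that logic the probability that the $n$th graph satisfies $\varphi$ converges to $0$ or to $1$.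 *)

theory Defs
  imports "HOL-Probability.Probability" "HOL-Library.Landau_Symbols"
begin

section \<open>Graphs and pruning\<close>

text \<open>A graph is a pair of a vertex set and an edge set. It is simple if each edge is a set
  of exactly two vertices; all graphs in the support of \<open>gnp\<close> below are of this kind.\<close>

type_synonym 'a ugraph = "'a set \<times> 'a set set"

abbreviation verts :: "'a ugraph \<Rightarrow> 'a set" where "verts \<equiv> fst"
abbreviation edges :: "'a ugraph \<Rightarrow> 'a set set" where "edges \<equiv> snd"

definition component :: "'a ugraph \<Rightarrow> 'a \<Rightarrow> 'a set" where
  "component G v = {w \<in> verts G. (v, w) \<in> {(x, y). {x, y} \<in> edges G}\<^sup>*}"

definition induced_subgraph :: "'a ugraph \<Rightarrow> 'a set \<Rightarrow> 'a ugraph" where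
  "induced_subgraph G S = (S, {e \<in> edges G. e \<subseteq> S})"

definition prune :: "nat \<Rightarrow> 'a ugraph \<Rightarrow> 'a ugraph" where
  "prune m G = induced_subgraph G {v \<in> verts G. m \<le> card (component G v)}"

section \<open>The random graph\<close>

definition vertex_pairs :: "nat \<Rightarrow> nat set set" where
  "vertex_pairs n = {e. e \<subseteq> {1..n} \<and> card e = 2}"

text \<open>The library clamps the parameter of \<open>bernoulli_pmf\<close> to the unit interval, so for
  \<open>p > 1\<close> this is the complete graph.\<close>

definition gnp :: "nat \<Rightarrow> real \<Rightarrow> nat ugraph pmf" where
  "gnp n p = map_pmf (\<lambda>\<omega>. ({1..n}, {e \<in> vertex_pairs n. \<omega> e}))
     (Pi_pmf (vertex_pairs n) False (\<lambda>_. bernoulli_pmf p))"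

section \<open>Monadic second-order logic over the incidence structure\<close>

text \<open>There are four kinds of variables (vertices, edges, vertex sets, edge sets), each
  indexed by its own copy of the natural numbers.\<close>

datatype mso2 =
    VEq nat nat
  | EEq nat nat
  | Inc nat nat   \<comment> \<open>vertex variable, edge variable\<close>
  | VMem nat nat  \<comment> \<open>vertex variable, vertex-set variable\<close>
  | EMem nat nat  \<comment> \<open>edge variable, edge-set variable\<close>
  | Neg mso2
  | Conj mso2 mso2
  | ExV nat mso2
  | ExE nat mso2
  | ExVS nat mso2
  | ExES nat mso2

datatype mso2_var = VVar nat | EVar nat | VSVar nat | ESVar nat

primrec mso2_fv :: "mso2 \<Rightarrow> mso2_var set" where
  "mso2_fv (VEq x y) = {VVar x, VVar y}"
| "mso2_fv (EEq x y) = {EVar x, EVar y}"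
| "mso2_fv (Inc x y) = {VVar x, EVar y}"
| "mso2_fv (VMem x X) = {VVar x, VSVar X}"
| "mso2_fv (EMem x X) = {EVar x, ESVar X}"
| "mso2_fv (Neg \<phi>) = mso2_fv \<phi>"
| "mso2_fv (Conj \<phi> \<psi>) = mso2_fv \<phi> \<union> mso2_fv \<psi>"
| "mso2_fv (ExV x \<phi>) = mso2_fv \<phi> - {VVar x}"
| "mso2_fv (ExE x \<phi>) = mso2_fv \<phi> - {EVar x}"
| "mso2_fv (ExVS X \<phi>) = mso2_fv \<phi> - {VSVar X}"
| "mso2_fv (ExES X \<phi>) = mso2_fv \<phi> - {ESVar X}"

primrec mso2_sat :: "'a ugraph \<Rightarrow> (nat \<Rightarrow> 'a) \<Rightarrow> (nat \<Rightarrow> 'a set) \<Rightarrow>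
    (nat \<Rightarrow> 'a set) \<Rightarrow> (nat \<Rightarrow> 'a set set) \<Rightarrow> mso2 \<Rightarrow> bool" where
  "mso2_sat G v e V E (VEq x y) \<longleftrightarrow> v x = v y"
| "mso2_sat G v e V E (EEq x y) \<longleftrightarrow> e x = e y"
| "mso2_sat G v e V E (Inc x y) \<longleftrightarrow> v x \<in> e y"
| "mso2_sat G v e V E (VMem x X) \<longleftrightarrow> v x \<in> V X"
| "mso2_sat G v e V E (EMem x X) \<longleftrightarrow> e x \<in> E X"
| "mso2_sat G v e V E (Neg \<phi>) \<longleftrightarrow> \<not> mso2_sat G v e V E \<phi>"
| "mso2_sat G v e V E (Conj \<phi> \<psi>) \<longleftrightarrow> mso2_sat G v e V E \<phi> \<and> mso2_sat G v e V E \<psi>"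
| "mso2_sat G v e V E (ExV x \<phi>) \<longleftrightarrow> (\<exists>a\<in>verts G. mso2_sat G (v(x := a)) e V E \<phi>)"
| "mso2_sat G v e V E (ExE x \<phi>) \<longleftrightarrow> (\<exists>a\<in>edges G. mso2_sat G v (e(x := a)) V E \<phi>)"
| "mso2_sat G v e V E (ExVS X \<phi>) \<longleftrightarrow> (\<exists>A. A \<subseteq> verts G \<and> mso2_sat G v e (V(X := A)) E \<phi>)"
| "mso2_sat G v e V E (ExES X \<phi>) \<longleftrightarrow> (\<exists>A. A \<subseteq> edges G \<and> mso2_sat G v e V (E(X := A)) \<phi>)"

definition mso2_sentences :: "mso2 set" where
  "mso2_sentences = {\<phi>. mso2_fv \<phi> = {}}"

text \<open>The assignments are irrelevant for sentences, also over the empty graph; see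
  \<open>mso2_models_iff_sat\<close>.\<close>

definition mso2_models :: "'a ugraph \<Rightarrow> mso2 \<Rightarrow> bool" where
  "mso2_models G \<phi> \<longleftrightarrow> mso2_sat G (\<lambda>_. undefined) (\<lambda>_. undefined) (\<lambda>_. {}) (\<lambda>_. {}) \<phi>"

lemma mso2_sat_cong:
  assumes "\<And>x. VVar x \<in> mso2_fv \<phi> \<Longrightarrow> v x = v' x"
    and "\<And>x. EVar x \<in> mso2_fv \<phi> \<Longrightarrow> e x = e' x"
    and "\<And>x. VSVar x \<in> mso2_fv \<phi> \<Longrightarrow> V x = V' x"
    and "\<And>x. ESVar x \<in> mso2_fv \<phi> \<Longrightarrow> E x = E' x"
  shows "mso2_sat G v e V E \<phi> \<longleftrightarrow> mso2_sat G v' e' V' E' \<phi>"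
  using assms
proof (induction \<phi> arbitrary: v v' e e' V V' E E')
  case (Conj \<phi> \<psi>)
  have "mso2_sat G v e V E \<phi> \<longleftrightarrow> mso2_sat G v' e' V' E' \<phi>"
    by (rule Conj.IH(1)) (use Conj.prems in auto)
  moreover have "mso2_sat G v e V E \<psi> \<longleftrightarrow> mso2_sat G v' e' V' E' \<psi>"
    by (rule Conj.IH(2)) (use Conj.prems in auto)
  ultimately show ?case by simp
next
  case (Neg \<phi>)
  have "mso2_sat G v e V E \<phi> \<longleftrightarrow> mso2_sat G v' e' V' E' \<phi>"
    by (rule Neg.IH) (use Neg.prems in auto)
  then show ?case by simp
next
  case (ExV x \<phi>)
  have "mso2_sat G (v(x := a)) e V E \<phi> \<longleftrightarrow> mso2_sat G (v'(x := a)) e' V' E' \<phi>" for a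
    by (rule ExV.IH) (use ExV.prems in auto)
  then show ?case by simp
next
  case (ExE x \<phi>)
  have "mso2_sat G v (e(x := a)) V E \<phi> \<longleftrightarrow> mso2_sat G v' (e'(x := a)) V' E' \<phi>" for a
    by (rule ExE.IH) (use ExE.prems in auto)
  then show ?case by simp
next
  case (ExVS x \<phi>)
  have "mso2_sat G v e (V(x := a)) E \<phi> \<longleftrightarrow> mso2_sat G v' e' (V'(x := a)) E' \<phi>" for a
    by (rule ExVS.IH) (use ExVS.prems in auto)
  then show ?case by simp
next
  case (ExES x \<phi>)
  have "mso2_sat G v e V (E(x := a)) \<phi> \<longleftrightarrow> mso2_sat G v' e' V' (E'(x := a)) \<phi>" for a
    by (rule ExES.IH) (use ExES.prems in auto)
  then show ?case by simp
qed simp_all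

lemma mso2_models_iff_sat:
  assumes "\<phi> \<in> mso2_sentences"
  shows "mso2_models G \<phi> \<longleftrightarrow> mso2_sat G v e V E \<phi>"
  unfolding mso2_models_def
  by (rule mso2_sat_cong) (use assms in \<open>auto simp: mso2_sentences_def\<close>)

text \<open>The fragment without edge-set variables; individual edge variables remain, so that
  the incidence relation can still be used.\<close>

primrec no_edge_sets :: "mso2 \<Rightarrow> bool" where
  "no_edge_sets (VEq x y) \<longleftrightarrow> True"
| "no_edge_sets (EEq x y) \<longleftrightarrow> True"
| "no_edge_sets (Inc x y) \<longleftrightarrow> True"
| "no_edge_sets (VMem x X) \<longleftrightarrow> True"
| "no_edge_sets (EMem x X) \<longleftrightarrow> False"
| "no_edge_sets (Neg \<phi>) \<longleftrightarrow> no_edge_sets \<phi>"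
| "no_edge_sets (Conj \<phi> \<psi>) \<longleftrightarrow> no_edge_sets \<phi> \<and> no_edge_sets \<psi>"
| "no_edge_sets (ExV x \<phi>) \<longleftrightarrow> no_edge_sets \<phi>"
| "no_edge_sets (ExE x \<phi>) \<longleftrightarrow> no_edge_sets \<phi>"
| "no_edge_sets (ExVS X \<phi>) \<longleftrightarrow> no_edge_sets \<phi>"
| "no_edge_sets (ExES X \<phi>) \<longleftrightarrow> False"

definition mso1_sentences :: "mso2 set" where
  "mso1_sentences = {\<phi> \<in> mso2_sentences. no_edge_sets \<phi>}"

section \<open>First-order logic over the adjacency relation\<close>

datatype fo =
    FEq nat nat
  | FAdj nat nat
  | FNeg fo
  | FConj fo fo
  | FEx nat fo

primrec fo_fv :: "fo \<Rightarrow> nat set" where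
  "fo_fv (FEq x y) = {x, y}"
| "fo_fv (FAdj x y) = {x, y}"
| "fo_fv (FNeg \<phi>) = fo_fv \<phi>"
| "fo_fv (FConj \<phi> \<psi>) = fo_fv \<phi> \<union> fo_fv \<psi>"
| "fo_fv (FEx x \<phi>) = fo_fv \<phi> - {x}"

primrec fo_sat :: "'a ugraph \<Rightarrow> (nat \<Rightarrow> 'a) \<Rightarrow> fo \<Rightarrow> bool" where
  "fo_sat G v (FEq x y) \<longleftrightarrow> v x = v y"
| "fo_sat G v (FAdj x y) \<longleftrightarrow> {v x, v y} \<in> edges G"
| "fo_sat G v (FNeg \<phi>) \<longleftrightarrow> \<not> fo_sat G v \<phi>"
| "fo_sat G v (FConj \<phi> \<psi>) \<longleftrightarrow> fo_sat G v \<phi> \<and> fo_sat G v \<psi>"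
| "fo_sat G v (FEx x \<phi>) \<longleftrightarrow> (\<exists>a\<in>verts G. fo_sat G (v(x := a)) \<phi>)"

definition fo_sentences :: "fo set" where
  "fo_sentences = {\<phi>. fo_fv \<phi> = {}}"

definition fo_models :: "'a ugraph \<Rightarrow> fo \<Rightarrow> bool" where
  "fo_models G \<phi> \<longleftrightarrow> fo_sat G (\<lambda>_. undefined) \<phi>"

lemma fo_sat_cong:
  assumes "\<And>x. x \<in> fo_fv \<phi> \<Longrightarrow> v x = v' x"
  shows "fo_sat G v \<phi> \<longleftrightarrow> fo_sat G v' \<phi>"
  using assms
proof (induction \<phi> arbitrary: v v')
  case (FConj \<phi> \<psi>)
  have "fo_sat G v \<phi> \<longleftrightarrow> fo_sat G v' \<phi>" by (rule FConj.IH(1)) (use FConj.prems in auto)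
  moreover have "fo_sat G v \<psi> \<longleftrightarrow> fo_sat G v' \<psi>"
    by (rule FConj.IH(2)) (use FConj.prems in auto)
  ultimately show ?case by simp
next
  case (FNeg \<phi>)
  have "fo_sat G v \<phi> \<longleftrightarrow> fo_sat G v' \<phi>" by (rule FNeg.IH) (use FNeg.prems in auto)
  then show ?case by simp
next
  case (FEx x \<phi>)
  have "fo_sat G (v(x := a)) \<phi> \<longleftrightarrow> fo_sat G (v'(x := a)) \<phi>" for a
    by (rule FEx.IH) (use FEx.prems in auto)
  then show ?case by simp
qed simp_all

lemma fo_models_iff_sat:
  assumes "\<phi> \<in> fo_sentences"
  shows "fo_models G \<phi> \<longleftrightarrow> fo_sat G v \<phi>"
  unfolding fo_models_def
  by (rule fo_sat_cong) (use assms in \<open>auto simp: fo_sentences_def\<close>)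

section \<open>Zero-one laws\<close>

definition zero_one_law :: "'f set \<Rightarrow> ('g \<Rightarrow> 'f \<Rightarrow> bool) \<Rightarrow> (nat \<Rightarrow> 'g pmf) \<Rightarrow> bool" where
  "zero_one_law sentences models H \<longleftrightarrow>
     (\<forall>\<phi>\<in>sentences.
        (\<lambda>n. measure_pmf.prob (H n) {G. models G \<phi>}) \<longlonglongrightarrow> 0 \<or>
        (\<lambda>n. measure_pmf.prob (H n) {G. models G \<phi>}) \<longlonglongrightarrow> 1)"

end

theory Submission
  imports Defs "HOL-Real_Asymp.Real_Asymp"
begin

text \<open>With probability tending to one the random graph is a forest, since the expected number of
cycles is at most the sum of the powers \<open>c n ^ l\<close> with \<open>l \<ge> 3\<close>. The rest of the argument compares
forests by the components that survive the pruning.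

Fix a quantifier depth \<open>k\<close>. Two graphs agree on all sentences of depth \<open>k\<close> when they have the
same Ehrenfeucht-Fraisse type \<open>mso_type k\<close>, and there are only finitely many such types. The type
of a disjoint union depends only on the types of the parts, and monadic second-order logic cannot
count beyond a threshold: there is a \<open>K\<close> such that adding one more component of a type that
occurs at least \<open>K\<close> times does not change the type of the union (\<open>mso_type_absorb\<close>). So if \<open>F\<close> and
\<open>F'\<close> are two graphs whose components realise exactly the same set of types, each at least \<open>K\<close>
times, then \<open>F\<close>, the disjoint union of \<open>F\<close> and \<open>F'\<close>, and \<open>F'\<close> all have the same type
(\<open>saturated_types_agree\<close>). It remains to find one set of types that works for all large \<open>n\<close>.

That set consists of the types of arbitrarily large trees (\<open>unbounded_types\<close>). Any other type
occurs only for trees of bounded size, and these are deleted because \<open>f n\<close> tends to infinity. For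
a type in the set, a pumping argument shows that the sizes of its trees have bounded gaps
(\<open>unbounded_type_dense\<close>): the type of a rooted tree is compatible with hanging one tree below the
root of another, so a large tree contains two nested subtrees of equal type, and the part between
them can be repeated at will. Hence the type is realised by a tree with \<open>m\<close> vertices, where \<open>m\<close>
exceeds \<open>f n\<close> by at most a constant. The expected number of components of the random graph that
are copies of this tree is at least
\<open>exp (ln n - m * ln m - (m - 1) * ln (1 / c n) - 2 * m)\<close> (\<open>expected_copies_ge\<close>), and the
growth condition on \<open>f\<close> makes this at least the square root of \<open>n\<close>. Different copies are almost
independent, so by the second moment method at least \<open>K\<close> of them are present with probability
tending to one (\<open>few_copies_tendsto_0\<close>).

First-order sentences are translated into \<open>MSO\<^sub>2\<close> sentences.\<close>

section \<open>Types of parameter sets\<close>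

text \<open>Vertices and edges live in one universe, a vertex \<open>v\<close> being represented by \<open>{v}\<close>. Incidence is then
an inclusion, and all four kinds of variables become sets of elements of the universe.\<close>

definition incident :: "'a set \<Rightarrow> 'a set \<Rightarrow> bool" where
  "incident x y \<longleftrightarrow> card x = 1 \<and> card y = 2 \<and> x \<subseteq> y"

datatype atom = SubAt nat nat | IncAt nat nat | VertAt nat | EdgeAt nat | SingAt nat | RootAt nat

instance atom :: countable by countable_datatype

text \<open>The atomic facts about a list of parameter sets in the structure with universe \<open>U\<close>. A parameter
set counts only through its intersection with \<open>U\<close>, so the same list can be read in each part of a
union. The roots \<open>R\<close> mark the elements at which structures will be glued.\<close>

primrec holds :: "'a set set \<Rightarrow> 'a set set \<Rightarrow> 'a set set list \<Rightarrow> atom \<Rightarrow> bool" where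
  "holds U R Ps (SubAt i j) \<longleftrightarrow> i < length Ps \<and> j < length Ps \<and> Ps ! i \<inter> U \<subseteq> Ps ! j \<inter> U"
| "holds U R Ps (IncAt i j) \<longleftrightarrow> i < length Ps \<and> j < length Ps \<and>
     (\<exists>x \<in> Ps ! i \<inter> U. \<exists>y \<in> Ps ! j \<inter> U. incident x y)"
| "holds U R Ps (VertAt i) \<longleftrightarrow> i < length Ps \<and> (\<exists>x \<in> Ps ! i \<inter> U. card x = 1)"
| "holds U R Ps (EdgeAt i) \<longleftrightarrow> i < length Ps \<and> (\<exists>x \<in> Ps ! i \<inter> U. card x \<noteq> 1)"
| "holds U R Ps (SingAt i) \<longleftrightarrow> i < length Ps \<and> (\<exists>x. Ps ! i \<inter> U = {x})"
| "holds U R Ps (RootAt i) \<longleftrightarrow> i < length Ps \<and> (\<exists>x \<in> Ps ! i \<inter> U. x \<in> R)"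

text \<open>The type of rank \<open>k\<close> describes what can be said about the parameters with \<open>k\<close> further set
quantifiers: rank zero records the atomic facts, and rank \<open>k + 1\<close> records the types of rank \<open>k\<close> that
appear when one more set is chosen. Since everything is coded by natural numbers, equality of types
is equivalence in the Ehrenfeucht-Fraisse game.\<close>

primrec mso_type :: "nat \<Rightarrow> 'a set set \<Rightarrow> 'a set set \<Rightarrow> 'a set set list \<Rightarrow> nat" where
  "mso_type 0 U R Ps = set_encode (to_nat ` {a. holds U R Ps a})"
| "mso_type (Suc k) U R Ps = set_encode (range (\<lambda>A. mso_type k U R (A # Ps)))"

declare mso_type.simps [simp del]

lemma finite_atoms_bounded: "finite {a. \<exists>U R (Ps :: 'a set set list). length Ps = l \<and> holds U R Ps a}"
proof (rule finite_subset)
  show "{a. \<exists>U R (Ps :: 'a set set list). length Ps = l \<and> holds U R Ps a} \<subseteq>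
      (\<lambda>(i, j). SubAt i j) ` ({..<l} \<times> {..<l}) \<union> (\<lambda>(i, j). IncAt i j) ` ({..<l} \<times> {..<l}) \<union>
      VertAt ` {..<l} \<union> EdgeAt ` {..<l} \<union> SingAt ` {..<l} \<union> RootAt ` {..<l}"
  proof
    fix a assume "a \<in> {a. \<exists>U R (Ps :: 'a set set list). length Ps = l \<and> holds U R Ps a}"
    then obtain U R and Ps :: "'a set set list" where *: "length Ps = l" "holds U R Ps a"
      by auto
    then show "a \<in> (\<lambda>(i, j). SubAt i j) ` ({..<l} \<times> {..<l}) \<union> (\<lambda>(i, j). IncAt i j) ` ({..<l} \<times> {..<l}) \<union>
      VertAt ` {..<l} \<union> EdgeAt ` {..<l} \<union> SingAt ` {..<l} \<union> RootAt ` {..<l}"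
      by (cases a) auto
  qed
qed auto

lemma finite_holds: "finite {a. holds U R Ps a}"
  by (rule finite_subset[OF _ finite_atoms_bounded[of "length Ps"]]) auto

definition mso_types :: "'a itself \<Rightarrow> nat \<Rightarrow> nat \<Rightarrow> nat set" where
  "mso_types _ k l = {mso_type k U R Ps | U R (Ps :: 'a set set list). length Ps = l}"

lemma mso_type_in_types:
  "mso_type k U R (Ps :: 'a set set list) \<in> mso_types TYPE('a) k (length Ps)"
  unfolding mso_types_def by blast

text \<open>By induction on the rank, a type is a subset of a finite set.\<close>

lemma finite_mso_types: "finite (mso_types TYPE('a) k l)"
proof (induction k arbitrary: l)
  case 0
  have "mso_types TYPE('a) 0 l \<subseteq> (\<lambda>S. set_encode (to_nat ` S)) `
     Pow {a. \<exists>U R (Ps :: 'a set set list). length Ps = l \<and> holds U R Ps a}"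
  proof
    fix x assume "x \<in> mso_types TYPE('a) 0 l"
    then obtain U R and Ps :: "'a set set list" where "length Ps = l"
        "x = set_encode (to_nat ` {a. holds U R Ps a})"
      by (auto simp: mso_types_def mso_type.simps)
    then show "x \<in> (\<lambda>S. set_encode (to_nat ` S)) `
       Pow {a. \<exists>U R (Ps :: 'a set set list). length Ps = l \<and> holds U R Ps a}"
      by (intro image_eqI[where x = "{a. holds U R Ps a}"]) auto
  qed
  then show ?case
    by (rule finite_subset) (intro finite_imageI, simp add: finite_atoms_bounded)
next
  case (Suc k)
  have "mso_types TYPE('a) (Suc k) l \<subseteq> set_encode ` Pow (mso_types TYPE('a) k (Suc l))"
  proof
    fix x assume "x \<in> mso_types TYPE('a) (Suc k) l"
    then obtain U R and Ps :: "'a set set list" where l: "length Ps = l"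
        and x: "x = set_encode (range (\<lambda>A. mso_type k U R (A # Ps)))"
      by (auto simp: mso_types_def mso_type.simps)
    have "range (\<lambda>A. mso_type k U R (A # Ps)) \<subseteq> mso_types TYPE('a) k (Suc l)"
      using l mso_type_in_types[of k U R "_ # Ps"] by auto
    then show "x \<in> set_encode ` Pow (mso_types TYPE('a) k (Suc l))"
      using x by blast
  qed
  then show ?case
    by (rule finite_subset) (simp add: Suc.IH)
qed

lemma mso_type_0_eq_iff:
  "mso_type 0 U R Ps = mso_type 0 U' R' Ps' \<longleftrightarrow> (\<forall>a. holds U R Ps a \<longleftrightarrow> holds U' R' Ps' a)"
proof -
  have "mso_type 0 U R Ps = mso_type 0 U' R' Ps' \<longleftrightarrow>
      to_nat ` {a. holds U R Ps a} = to_nat ` {a. holds U' R' Ps' a}"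
    by (simp add: mso_type.simps set_encode_eq finite_holds)
  also have "\<dots> \<longleftrightarrow> {a. holds U R Ps a} = {a. holds U' R' Ps' a}"
    by (rule inj_image_eq_iff) simp
  finally show ?thesis by auto
qed

lemma finite_range_mso_type: "finite (range (\<lambda>A. mso_type k U R ((A :: 'a set set) # Ps)))"
proof (rule finite_subset)
  show "range (\<lambda>A. mso_type k U R (A # Ps)) \<subseteq> mso_types TYPE('a) k (Suc (length Ps))"
    using mso_type_in_types[of k U R "_ # Ps"] by auto
qed (rule finite_mso_types)

text \<open>This lemma and the next one turn equality of types into moves of the game: whatever set is chosen
on one side can be answered on the other side.\<close>

lemma mso_type_SucI:
  assumes "\<And>A. \<exists>A'. mso_type k U R (A # Ps) = mso_type k U' R' (A' # Ps')"
    and "\<And>A'. \<exists>A. mso_type k U' R' (A' # Ps') = mso_type k U R (A # Ps)"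
  shows "mso_type (Suc k) U R Ps = mso_type (Suc k) U' R' Ps'"
proof -
  have "range (\<lambda>A. mso_type k U R (A # Ps)) = range (\<lambda>A. mso_type k U' R' (A # Ps'))"
    using assms by (auto simp: image_iff)
  then show ?thesis by (simp add: mso_type.simps)
qed

lemma mso_type_SucD:
  assumes "mso_type (Suc k) U R Ps = mso_type (Suc k) U' R' Ps'"
  obtains A' where "mso_type k U R (A # Ps) = mso_type k U' R' (A' # Ps')"
proof -
  have eq: "range (\<lambda>A. mso_type k U R (A # Ps)) = range (\<lambda>A. mso_type k U' R' (A # Ps'))"
    using assms by (simp add: mso_type.simps set_encode_eq finite_range_mso_type)
  have "mso_type k U R (A # Ps) \<in> range (\<lambda>A. mso_type k U' R' (A # Ps'))"
    unfolding eq[symmetric] by (rule rangeI)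
  then show ?thesis using that by (elim rangeE)
qed

primrec shift_atom :: "atom \<Rightarrow> atom" where
  "shift_atom (SubAt i j) = SubAt (Suc i) (Suc j)"
| "shift_atom (IncAt i j) = IncAt (Suc i) (Suc j)"
| "shift_atom (VertAt i) = VertAt (Suc i)"
| "shift_atom (EdgeAt i) = EdgeAt (Suc i)"
| "shift_atom (SingAt i) = SingAt (Suc i)"
| "shift_atom (RootAt i) = RootAt (Suc i)"

lemma holds_shift: "holds U R (A # Ps) (shift_atom a) \<longleftrightarrow> holds U R Ps a"
  by (cases a) auto

text \<open>Choosing the empty set in all remaining rounds leads back to the atomic facts.\<close>

lemma mso_type_eq_imp_holds:
  assumes "mso_type k U R Ps = mso_type k U' R' Ps'"
  shows "holds U R Ps a \<longleftrightarrow> holds U' R' Ps' a"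
  using assms
proof (induction k arbitrary: Ps Ps' a)
  case 0
  then show ?case using mso_type_0_eq_iff by blast
next
  case (Suc k)
  obtain A' where "mso_type k U R ({} # Ps) = mso_type k U' R' (A' # Ps')"
    using mso_type_SucD[OF Suc.prems] .
  from Suc.IH[OF this, of "shift_atom a"] show ?case
    by (simp only: holds_shift)
qed

text \<open>Only the traces of the parameters on the universes are compared, so the case of the identity says
that parameters may be altered outside of the universe.\<close>

lemma mso_type_iso:
  fixes U U' :: "'a set set"
  assumes "bij_betw g U U'"
    and "\<And>x. x \<in> U \<Longrightarrow> card (g x) = card x"
    and "\<And>x y. x \<in> U \<Longrightarrow> y \<in> U \<Longrightarrow> incident (g x) (g y) \<longleftrightarrow> incident x y"
    and "\<And>x. x \<in> U \<Longrightarrow> g x \<in> R' \<longleftrightarrow> x \<in> R"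
    and "list_all2 (\<lambda>A B. B \<inter> U' = g ` (A \<inter> U)) Ps Ps'"
  shows "mso_type k U R Ps = mso_type k U' R' Ps'"
  using assms(5)
proof (induction k arbitrary: Ps Ps')
  case 0
  have inj: "inj_on g U" and im: "g ` U = U'"
    using assms(1) by (auto simp: bij_betw_def)
  have len: "length Ps' = length Ps"
    using 0 by (simp add: list_all2_lengthD)
  have nth: "Ps' ! i \<inter> U' = g ` (Ps ! i \<inter> U)" if "i < length Ps" for i
    using list_all2_nthD[OF 0 that] .
  have ex: "(\<exists>y \<in> Ps' ! i \<inter> U'. P y) \<longleftrightarrow> (\<exists>x \<in> Ps ! i \<inter> U. P (g x))" if "i < length Ps" for i P
    unfolding nth[OF that] by blast
  have "holds U R Ps a \<longleftrightarrow> holds U' R' Ps' a" for a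
  proof (cases a)
    case (SubAt i j)
    have "g ` (Ps ! i \<inter> U) \<subseteq> g ` (Ps ! j \<inter> U) \<longleftrightarrow> Ps ! i \<inter> U \<subseteq> Ps ! j \<inter> U"
      by (rule inj_on_image_subset_iff[OF inj]) auto
    then show ?thesis
      unfolding SubAt holds.simps len by (intro conj_cong refl) (simp only: nth)
  next
    case (SingAt i)
    have "(\<exists>x. g ` (Ps ! i \<inter> U) = {x}) \<longleftrightarrow> (\<exists>x. Ps ! i \<inter> U = {x})"
    proof -
      have "card (g ` (Ps ! i \<inter> U)) = card (Ps ! i \<inter> U)"
        by (rule card_image) (use inj in \<open>auto intro: inj_on_subset\<close>)
      then show ?thesis by (metis One_nat_def card_1_singleton_iff)
    qed
    then show ?thesis
      unfolding SingAt holds.simps len by (intro conj_cong refl) (simp only: nth)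
  next
    case (IncAt i j)
    have "(\<exists>x \<in> Ps ! i \<inter> U. \<exists>y \<in> Ps ! j \<inter> U. incident (g x) (g y)) \<longleftrightarrow>
        (\<exists>x \<in> Ps ! i \<inter> U. \<exists>y \<in> Ps ! j \<inter> U. incident x y)"
      using assms(3) by auto
    then show ?thesis
      unfolding IncAt holds.simps len by (intro conj_cong refl) (simp only: ex)
  next
    case (VertAt i)
    show ?thesis
      unfolding VertAt holds.simps len
      by (intro conj_cong refl, simp only: ex, rule bex_cong) (use assms(2) in auto)
  next
    case (EdgeAt i)
    show ?thesis
      unfolding EdgeAt holds.simps len
      by (intro conj_cong refl, simp only: ex, rule bex_cong) (use assms(2) in auto)
  next
    case (RootAt i)
    show ?thesis
      unfolding RootAt holds.simps len
      by (intro conj_cong refl, simp only: ex, rule bex_cong) (use assms(4) in auto)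
  qed
  then show ?case by (simp only: mso_type_0_eq_iff) blast
next
  case (Suc k)
  have im: "g ` U = U'" using assms(1) by (auto simp: bij_betw_def)
  show ?case
  proof (rule mso_type_SucI)
    fix A
    have "mso_type k U R (A # Ps) = mso_type k U' R' (g ` (A \<inter> U) # Ps')"
      by (rule Suc.IH) (use Suc.prems im in auto)
    then show "\<exists>A'. mso_type k U R (A # Ps) = mso_type k U' R' (A' # Ps')" by blast
  next
    fix A'
    have "mso_type k U R ((g -` A') # Ps) = mso_type k U' R' (A' # Ps')"
      by (rule Suc.IH) (use Suc.prems im in auto)
    then show "\<exists>A. mso_type k U' R' (A' # Ps') = mso_type k U R (A # Ps)" by metis
  qed
qed

lemma mso_type_restrict_cong:
  assumes "list_all2 (\<lambda>A B. A \<inter> U = B \<inter> U) Ps Ps'"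
  shows "mso_type k U R Ps = mso_type k U R Ps'"
  by (rule mso_type_iso[where g = "\<lambda>x. x"]) (use assms in \<open>auto simp: bij_betw_def elim: list_all2_mono\<close>)

text \<open>The only incidences between the two parts go from a root of the first part to a root of the second.
Without roots this is a disjoint union; with one root each it attaches an edge to an end vertex.\<close>

definition glued :: "'a set set \<Rightarrow> 'a set set \<Rightarrow> 'a set set \<Rightarrow> 'a set set \<Rightarrow> bool" where
  "glued U1 R1 U2 R2 \<longleftrightarrow> U1 \<inter> U2 = {} \<and> R1 \<subseteq> U1 \<and> R2 \<subseteq> U2 \<and>
     (\<forall>x\<in>U1. \<forall>y\<in>U2. (incident x y \<longleftrightarrow> x \<in> R1 \<and> y \<in> R2) \<and> \<not> incident y x)"

text \<open>A rooted tree keeps its own root when another one is joined to it, and a component of a forest keeps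
none.\<close>

definition select_roots :: "bool \<Rightarrow> bool \<Rightarrow> 'a set \<Rightarrow> 'a set \<Rightarrow> 'a set" where
  "select_roots keep_l keep_r R1 R2 = {x. keep_l \<and> x \<in> R1 \<or> keep_r \<and> x \<in> R2}"

text \<open>Roots are recorded among the atoms just so that incidences across the two parts can be recovered.\<close>

lemma holds_glued:
  assumes "glued U1 R1 U2 R2"
  shows
   "holds (U1 \<union> U2) (select_roots keep_l keep_r R1 R2) Ps (SubAt i j) \<longleftrightarrow>
      holds U1 R1 Ps (SubAt i j) \<and> holds U2 R2 Ps (SubAt i j)"
   "holds (U1 \<union> U2) (select_roots keep_l keep_r R1 R2) Ps (IncAt i j) \<longleftrightarrow>
      holds U1 R1 Ps (IncAt i j) \<or> holds U2 R2 Ps (IncAt i j) \<or>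
      holds U1 R1 Ps (RootAt i) \<and> holds U2 R2 Ps (RootAt j)"
   "holds (U1 \<union> U2) (select_roots keep_l keep_r R1 R2) Ps (VertAt i) \<longleftrightarrow>
      holds U1 R1 Ps (VertAt i) \<or> holds U2 R2 Ps (VertAt i)"
   "holds (U1 \<union> U2) (select_roots keep_l keep_r R1 R2) Ps (EdgeAt i) \<longleftrightarrow>
      holds U1 R1 Ps (EdgeAt i) \<or> holds U2 R2 Ps (EdgeAt i)"
   "holds (U1 \<union> U2) (select_roots keep_l keep_r R1 R2) Ps (SingAt i) \<longleftrightarrow>
      holds U1 R1 Ps (SingAt i) \<and> \<not> holds U2 R2 Ps (VertAt i) \<and> \<not> holds U2 R2 Ps (EdgeAt i) \<or>
      holds U2 R2 Ps (SingAt i) \<and> \<not> holds U1 R1 Ps (VertAt i) \<and> \<not> holds U1 R1 Ps (EdgeAt i)"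
   "holds (U1 \<union> U2) (select_roots keep_l keep_r R1 R2) Ps (RootAt i) \<longleftrightarrow>
      keep_l \<and> holds U1 R1 Ps (RootAt i) \<or> keep_r \<and> holds U2 R2 Ps (RootAt i)"
proof -
  have disj: "U1 \<inter> U2 = {}" and R: "R1 \<subseteq> U1" "R2 \<subseteq> U2"
    and c: "\<And>x y. x \<in> U1 \<Longrightarrow> y \<in> U2 \<Longrightarrow> incident x y \<longleftrightarrow> x \<in> R1 \<and> y \<in> R2"
    and c': "\<And>x y. x \<in> U1 \<Longrightarrow> y \<in> U2 \<Longrightarrow> \<not> incident y x"
    using assms by (auto simp: glued_def)
  show "holds (U1 \<union> U2) (select_roots keep_l keep_r R1 R2) Ps (SubAt i j) \<longleftrightarrow>
      holds U1 R1 Ps (SubAt i j) \<and> holds U2 R2 Ps (SubAt i j)"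
    using disj by auto
  show "holds (U1 \<union> U2) (select_roots keep_l keep_r R1 R2) Ps (IncAt i j) \<longleftrightarrow>
      holds U1 R1 Ps (IncAt i j) \<or> holds U2 R2 Ps (IncAt i j) \<or>
      holds U1 R1 Ps (RootAt i) \<and> holds U2 R2 Ps (RootAt j)"
    using c c' R by simp blast
  show "holds (U1 \<union> U2) (select_roots keep_l keep_r R1 R2) Ps (VertAt i) \<longleftrightarrow>
      holds U1 R1 Ps (VertAt i) \<or> holds U2 R2 Ps (VertAt i)"
   "holds (U1 \<union> U2) (select_roots keep_l keep_r R1 R2) Ps (EdgeAt i) \<longleftrightarrow>
      holds U1 R1 Ps (EdgeAt i) \<or> holds U2 R2 Ps (EdgeAt i)"
    by auto
  have "(\<exists>x. Ps ! i \<inter> (U1 \<union> U2) = {x}) \<longleftrightarrow>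
     (\<exists>x. Ps ! i \<inter> U1 = {x}) \<and> Ps ! i \<inter> U2 = {} \<or> (\<exists>x. Ps ! i \<inter> U2 = {x}) \<and> Ps ! i \<inter> U1 = {}"
    using disj by (auto simp: Int_Un_distrib Un_singleton_iff)
  moreover have "\<not> (\<exists>x \<in> Ps ! i \<inter> U. card x = 1) \<and> \<not> (\<exists>x \<in> Ps ! i \<inter> U. card x \<noteq> 1) \<longleftrightarrow> Ps ! i \<inter> U = {}" for U
    by blast
  ultimately show "holds (U1 \<union> U2) (select_roots keep_l keep_r R1 R2) Ps (SingAt i) \<longleftrightarrow>
      holds U1 R1 Ps (SingAt i) \<and> \<not> holds U2 R2 Ps (VertAt i) \<and> \<not> holds U2 R2 Ps (EdgeAt i) \<or>
      holds U2 R2 Ps (SingAt i) \<and> \<not> holds U1 R1 Ps (VertAt i) \<and> \<not> holds U1 R1 Ps (EdgeAt i)"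
    unfolding holds.simps by (cases "i < length Ps") simp_all
  show "holds (U1 \<union> U2) (select_roots keep_l keep_r R1 R2) Ps (RootAt i) \<longleftrightarrow>
      keep_l \<and> holds U1 R1 Ps (RootAt i) \<or> keep_r \<and> holds U2 R2 Ps (RootAt i)"
    using R disj by (auto simp: select_roots_def)
qed

text \<open>A set chosen in the union is answered in both parts separately, and the two answers are merged.\<close>

lemma mso_type_glued:
  fixes U1 U1' :: "'a set set"
  assumes "glued U1 R1 U2 R2" "glued U1' R1' U2' R2'"
    and "mso_type k U1 R1 Ps = mso_type k U1' R1' Ps'"
    and "mso_type k U2 R2 Ps = mso_type k U2' R2' Ps'"
    and "length Ps = length Ps'"
  shows "mso_type k (U1 \<union> U2) (select_roots keep_l keep_r R1 R2) Ps =
    mso_type k (U1' \<union> U2') (select_roots keep_l keep_r R1' R2') Ps'"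
  using assms
proof (induction k arbitrary: U1 R1 U2 R2 U1' R1' U2' R2' Ps Ps')
  case 0
  note h = 0(3,4)[unfolded mso_type_0_eq_iff]
  have "holds (U1 \<union> U2) (select_roots keep_l keep_r R1 R2) Ps a \<longleftrightarrow>
      holds (U1' \<union> U2') (select_roots keep_l keep_r R1' R2') Ps' a" for a
    by (cases a) (simp_all only: holds_glued[OF 0(1)] holds_glued[OF 0(2)] h)
  then show ?case by (simp only: mso_type_0_eq_iff) blast
next
  case (Suc k)
  have forth: "\<exists>A'. mso_type k (U1 \<union> U2) (select_roots keep_l keep_r R1 R2) (A # Ps) =
      mso_type k (U1' \<union> U2') (select_roots keep_l keep_r R1' R2') (A' # Ps')"
    if g: "glued U1 R1 U2 R2" "glued U1' R1' U2' R2'"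
      and t1: "mso_type (Suc k) U1 R1 Ps = mso_type (Suc k) U1' R1' Ps'"
      and t2: "mso_type (Suc k) U2 R2 Ps = mso_type (Suc k) U2' R2' Ps'"
      and len: "length Ps = length Ps'"
    for A U1 R1 U2 R2 U1' R1' U2' R2' and Ps Ps' :: "'a set set list"
  proof -
    obtain A1 where A1: "mso_type k U1 R1 (A # Ps) = mso_type k U1' R1' (A1 # Ps')"
      using mso_type_SucD[OF t1] .
    obtain A2 where A2: "mso_type k U2 R2 (A # Ps) = mso_type k U2' R2' (A2 # Ps')"
      using mso_type_SucD[OF t2] .
    define A' where "A' = (A1 \<inter> U1') \<union> (A2 \<inter> U2')"
    have disj: "U1' \<inter> U2' = {}" using g by (simp add: glued_def)
    have "mso_type k U1' R1' (A1 # Ps') = mso_type k U1' R1' (A' # Ps')"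
      by (rule mso_type_restrict_cong) (use disj in \<open>auto simp: A'_def list_all2_refl\<close>)
    moreover have "mso_type k U2' R2' (A2 # Ps') = mso_type k U2' R2' (A' # Ps')"
      by (rule mso_type_restrict_cong) (use disj in \<open>auto simp: A'_def list_all2_refl\<close>)
    ultimately have "mso_type k (U1 \<union> U2) (select_roots keep_l keep_r R1 R2) (A # Ps) =
      mso_type k (U1' \<union> U2') (select_roots keep_l keep_r R1' R2') (A' # Ps')"
      by (intro Suc.IH g) (use A1 A2 len in auto)
    then show ?thesis by blast
  qed
  show ?case
    by (rule mso_type_SucI; rule forth) (use Suc.prems in \<open>simp_all only:\<close>)
qed

text \<open>Forgetting roots is gluing with an empty structure while keeping no root.\<close>

lemma mso_type_forget_roots:
  fixes U U' :: "'a set set"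
  assumes "mso_type k U R Ps = mso_type k U' R' Ps'" "length Ps = length Ps'"
    and "R \<subseteq> U" "R' \<subseteq> U'"
  shows "mso_type k U {} Ps = mso_type k U' {} Ps'"
proof -
  have "mso_type k {} {} Ps = mso_type k {} {} Ps'"
    by (rule mso_type_iso[where g = "\<lambda>x. x"])
      (use assms(2) in \<open>auto simp: list_all2_conv_all_nth bij_betw_def\<close>)
  moreover have "glued U R {} {}" "glued U' R' {} {}" using assms(3,4) by (auto simp: glued_def)
  ultimately have "mso_type k (U \<union> {}) (select_roots False False R {}) Ps =
      mso_type k (U' \<union> {}) (select_roots False False R' {}) Ps'"
    using assms(1,2) by (intro mso_type_glued)
  then show ?thesis by (simp add: select_roots_def)
qed

text \<open>The members of \<open>\<B>\<close> are the parts of a disjoint union; in the application they are the components of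
a graph.\<close>

definition separated :: "'a set set set \<Rightarrow> bool" where
  "separated \<B> \<longleftrightarrow> (\<forall>B\<in>\<B>. \<forall>C\<in>\<B>. B \<noteq> C \<longrightarrow> B \<inter> C = {} \<and> (\<forall>x\<in>B. \<forall>y\<in>C. \<not> incident x y))"

lemma separatedD:
  assumes "separated \<B>" "B \<in> \<B>" "C \<in> \<B>" "B \<noteq> C"
  shows "B \<inter> C = {}" "x \<in> B \<Longrightarrow> y \<in> C \<Longrightarrow> \<not> incident x y"
  using assms(2-) assms(1)[unfolded separated_def, rule_format, OF assms(2,3,4)] by blast+

lemma separated_subset:
  assumes "separated \<B>" "\<B>' \<subseteq> \<B>"
  shows "separated \<B>'"
  unfolding separated_def
proof (intro ballI impI)
  fix B C assume "B \<in> \<B>'" "C \<in> \<B>'" "B \<noteq> C"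
  note sep = separatedD[OF assms(1) subsetD[OF assms(2) this(1)] subsetD[OF assms(2) this(2)] this(3)]
  show "B \<inter> C = {} \<and> (\<forall>x\<in>B. \<forall>y\<in>C. \<not> incident x y)"
    by (intro conjI ballI sep)
qed

lemma glued_separated:
  assumes "separated (insert C \<B>)" "C \<notin> \<B>"
  shows "glued (\<Union>\<B>) {} C {}"
proof -
  have *: "B \<inter> C = {}" "\<And>x y. x \<in> B \<Longrightarrow> y \<in> C \<Longrightarrow> \<not> incident x y \<and> \<not> incident y x" if "B \<in> \<B>" for B
  proof -
    have "B \<noteq> C" "B \<in> insert C \<B>" "C \<in> insert C \<B>" using assms(2) that by auto
    note sep = separatedD[OF assms(1) this(2,3,1)] separatedD[OF assms(1) this(3,2) this(1)[symmetric]]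
    show "B \<inter> C = {}" by (rule sep(1))
    show "\<not> incident x y \<and> \<not> incident y x" if "x \<in> B" "y \<in> C" for x y
      using sep(2)[of x y] sep(4)[of y x] that by blast
  qed
  show ?thesis unfolding glued_def
  proof (intro conjI ballI)
    show "\<Union>\<B> \<inter> C = {}" using *(1) by auto
      show "(incident x y \<longleftrightarrow> x \<in> {} \<and> y \<in> {})" "\<not> incident y x" if "x \<in> \<Union>\<B>" "y \<in> C" for x y
      using *(2) that by blast+
  qed auto
qed

lemma pigeonhole_fiber:
  assumes "finite T" "h ` S \<subseteq> T" "card T * K < card S"
  shows "\<exists>x\<in>S. K < card {y \<in> S. h y = h x}"
proof (rule ccontr)
  assume not: "\<not> ?thesis"
  have *: "card {y \<in> S. h y = h x} \<le> K" if "x \<in> S" for x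
  proof (rule ccontr)
    assume "\<not> card {y \<in> S. h y = h x} \<le> K"
    then have "K < card {y \<in> S. h y = h x}" by (simp only: not_le)
    with that have "\<exists>x\<in>S. K < card {y \<in> S. h y = h x}" by (rule bexI[rotated])
    with not show False by (rule notE)
  qed
  have "S = (\<Union>t\<in>T. {y \<in> S. h y = t})" using assms(2) by auto
  then have "card S \<le> (\<Sum>t\<in>T. card {y \<in> S. h y = t})"
    using card_UN_le[OF assms(1), of "\<lambda>t. {y \<in> S. h y = t}"] by simp
  also have "\<dots> \<le> (\<Sum>t\<in>T. K)"
  proof (rule sum_mono)
    fix t assume "t \<in> T"
    show "card {y \<in> S. h y = t} \<le> K"
    proof (cases "\<exists>x\<in>S. h x = t")
      case True then show ?thesis using * by auto
    next
      case False
      then have "{y \<in> S. h y = t} = {}" by blast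
      then show ?thesis by (simp only: card.empty le0)
    qed
  qed
  finally show False using assms(3) by simp
qed

text \<open>The threshold two is dictated by the atom for singletons: if \<open>C\<close> meets a parameter set, then so do two
further parts, and the parameter set is not a singleton with or without \<open>C\<close>.\<close>

lemma mso_type_0_absorb:
  fixes \<B> :: "'a set set set"
  assumes fin: "finite \<B>" and sep: "separated (insert C \<B>)" and new: "C \<notin> \<B>"
    and card: "2 \<le> card {B \<in> \<B>. mso_type 0 B {} Ps = mso_type 0 C {} Ps}"
  shows "mso_type 0 (\<Union>(insert C \<B>)) {} Ps = mso_type 0 (\<Union>\<B>) {} Ps"
proof -
  define F where "F = {B \<in> \<B>. mso_type 0 B {} Ps = mso_type 0 C {} Ps}"
  have "finite F" "\<not> card F \<le> Suc 0" using fin card by (simp_all add: F_def)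
  then have "\<not> (\<forall>B1\<in>F. \<forall>B2\<in>F. B1 = B2)" by (simp only: card_le_Suc0_iff_eq) simp
  then obtain B1 B2 where F: "B1 \<in> F" "B2 \<in> F" and B12: "B1 \<noteq> B2" by blast
  have B: "B1 \<in> \<B>" "B2 \<in> \<B>" "B1 \<noteq> B2" using F B12 by (simp_all add: F_def)
  have t: "mso_type 0 B1 {} Ps = mso_type 0 C {} Ps" "mso_type 0 B2 {} Ps = mso_type 0 C {} Ps"
    using F by (simp_all add: F_def)
  have h: "holds B1 {} Ps a \<longleftrightarrow> holds C {} Ps a" "holds B2 {} Ps a \<longleftrightarrow> holds C {} Ps a" for a
    using t[unfolded mso_type_0_eq_iff] by (simp_all only:)
  have disj: "B1 \<inter> B2 = {}" using separatedD(1)[OF sep, of B1 B2] B by auto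
  have sr: "select_roots False False {} {} = {}" by (simp add: select_roots_def)
  have BU: "B1 \<subseteq> \<Union>\<B>" by (rule Union_upper[OF B(1)])
  have gl: "glued (\<Union>\<B>) {} C {}" by (rule glued_separated[OF sep new])
  note g = holds_glued[where keep_l = False and keep_r = False and ?R1.0 = "{}" and ?R2.0 = "{}", unfolded sr, OF gl]
  have sub: "holds (\<Union>\<B>) {} Ps (SubAt i j) \<Longrightarrow> holds C {} Ps (SubAt i j)" for i j
    using BU unfolding h(1)[symmetric] unfolding holds.simps by blast
  have inc: "holds C {} Ps (IncAt i j) \<Longrightarrow> holds (\<Union>\<B>) {} Ps (IncAt i j)" for i j
    using BU unfolding h(1)[symmetric] unfolding holds.simps by blast
  have vert: "holds C {} Ps (VertAt i) \<Longrightarrow> holds (\<Union>\<B>) {} Ps (VertAt i)" for i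
    using BU unfolding h(1)[symmetric] unfolding holds.simps by blast
  have edge: "holds C {} Ps (EdgeAt i) \<Longrightarrow> holds (\<Union>\<B>) {} Ps (EdgeAt i)" for i
    using BU unfolding h(1)[symmetric] unfolding holds.simps by blast
  have two: "\<not> holds (\<Union>\<B>) {} Ps (SingAt i)"
    if C: "holds C {} Ps (VertAt i) \<or> holds C {} Ps (EdgeAt i)" for i
  proof
    assume s: "holds (\<Union>\<B>) {} Ps (SingAt i)"
    have "\<exists>x. x \<in> Ps ! i \<inter> B1" using C unfolding h(1)[symmetric] unfolding holds.simps by blast
    then obtain x1 where x1: "x1 \<in> Ps ! i \<inter> B1" ..
    have "\<exists>x. x \<in> Ps ! i \<inter> B2" using C unfolding h(2)[symmetric] unfolding holds.simps by blast
    then obtain x2 where x2: "x2 \<in> Ps ! i \<inter> B2" ..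
    have U: "x1 \<in> Ps ! i \<inter> \<Union>\<B>" "x2 \<in> Ps ! i \<inter> \<Union>\<B>" using B x1 x2 by simp_all blast+
    obtain x where x: "Ps ! i \<inter> \<Union>\<B> = {x}" using s unfolding holds.simps by (elim conjE exE)
    have "x1 = x" "x2 = x" using U unfolding x by simp_all
    moreover have "x1 \<noteq> x2" using disj x1 x2 by blast
    ultimately show False by simp
  qed
  have sing: "holds C {} Ps (SingAt i) \<Longrightarrow> holds C {} Ps (VertAt i) \<or> holds C {} Ps (EdgeAt i)" for i
    unfolding holds.simps by blast
  have root: "\<not> holds W {} Ps (RootAt i)" for W :: "'a set set" and i
    unfolding holds.simps by blast
  have eq: "\<Union>(insert C \<B>) = \<Union>\<B> \<union> C" by blast
  have "holds (\<Union>\<B> \<union> C) {} Ps a \<longleftrightarrow> holds (\<Union>\<B>) {} Ps a" for a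
  proof (cases a)
    case (SubAt i j)
    then show ?thesis using g(1)[of Ps i j] sub[of i j] by blast
  next
    case (IncAt i j)
    then show ?thesis using g(2)[of Ps i j] inc[of i j] root by blast
  next
    case (VertAt i)
    then show ?thesis using g(3)[of Ps i] vert[of i] by blast
  next
    case (EdgeAt i)
    then show ?thesis using g(4)[of Ps i] edge[of i] by blast
  next
    case (SingAt i)
    then show ?thesis using g(5)[of Ps i] two[of i] sing[of i] vert[of i] edge[of i] by blast
  next
    case (RootAt i)
    then show ?thesis using root by blast
  qed
  then show ?thesis unfolding eq mso_type_0_eq_iff by blast
qed


text \<open>If a set is chosen in the union with \<open>C\<close>, then by the pigeonhole principle more than \<open>K\<close> of the parts
that looked like \<open>C\<close>, including \<open>C\<close>, still look alike. One of them, \<open>D\<close>, can be removed by the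
hypothesis on rank \<open>k\<close>. As \<open>C\<close> and \<open>D\<close> had the same type before the choice, removing \<open>D\<close> gives the same
type of rank \<open>k + 1\<close> as removing \<open>C\<close>. If a set is chosen in the union without \<open>C\<close>, then \<open>C\<close> is equipped
with a set that imitates one of more than \<open>K\<close> parts that look alike, and is absorbed by them.\<close>

lemma mso_type_Suc_absorb:
  fixes \<B> :: "'a set set set" and Ps :: "'a set set list" and k :: nat
  defines "T \<equiv> mso_types TYPE('a) k (Suc (length Ps))"
  assumes K: "\<And>\<B> C (Ps' :: 'a set set list). finite \<B> \<Longrightarrow> length Ps' = Suc (length Ps) \<Longrightarrow>
      separated (insert C \<B>) \<Longrightarrow> C \<notin> \<B> \<Longrightarrow>
      K \<le> card {B \<in> \<B>. mso_type k B {} Ps' = mso_type k C {} Ps'} \<Longrightarrow>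
      mso_type k (\<Union>(insert C \<B>)) {} Ps' = mso_type k (\<Union>\<B>) {} Ps'"
  assumes fin: "finite \<B>" and sep: "separated (insert C \<B>)" and new: "C \<notin> \<B>"
    and card: "card T * K + 1 \<le> card {B \<in> \<B>. mso_type (Suc k) B {} Ps = mso_type (Suc k) C {} Ps}"
  shows "mso_type (Suc k) (\<Union>(insert C \<B>)) {} Ps = mso_type (Suc k) (\<Union>\<B>) {} Ps"
proof -
  have finT: "finite T" unfolding T_def by (rule finite_mso_types)
  define S where "S = {B \<in> \<B>. mso_type (Suc k) B {} Ps = mso_type (Suc k) C {} Ps}"
  have finS: "finite S" and SB: "S \<subseteq> \<B>" using fin by (auto simp: S_def)
  have inT: "(\<lambda>B. mso_type k B {} (A # Ps)) ` W \<subseteq> T" for A W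
    using mso_type_in_types[of k _ "{}" "A # Ps"] by (auto simp: T_def)
  show ?thesis
  proof (rule mso_type_SucI)
    fix A
    have "card T * K < card (insert C S)"
      using card finS by (simp add: S_def[symmetric] card_insert_if)
    with pigeonhole_fiber[OF finT inT[of A]] obtain D where D: "D \<in> insert C S"
      and fib: "K < card {B \<in> insert C S. mso_type k B {} (A # Ps) = mso_type k D {} (A # Ps)}" by blast
    \<comment> \<open>the union with \<open>C\<close>, but without \<open>D\<close>\<close>
    define \<B>1 where "\<B>1 = insert C \<B> - {D}"
    have ins: "insert D \<B>1 = insert C \<B>" using D SB by (auto simp: \<B>1_def)
    have "mso_type k (\<Union>(insert D \<B>1)) {} (A # Ps) = mso_type k (\<Union>\<B>1) {} (A # Ps)"
    proof (rule K)
      show "finite \<B>1" using fin by (simp add: \<B>1_def)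
      show "separated (insert D \<B>1)" using sep ins by simp
      show "D \<notin> \<B>1" by (simp add: \<B>1_def)
      let ?F = "{B \<in> insert C S. mso_type k B {} (A # Ps) = mso_type k D {} (A # Ps)}"
      have "K \<le> card (?F - {D})" using fib D finS by (simp add: card_Diff_singleton)
      also have "\<dots> \<le> card {B \<in> \<B>1. mso_type k B {} (A # Ps) = mso_type k D {} (A # Ps)}"
        by (rule card_mono) (use fin SB in \<open>auto simp: \<B>1_def\<close>)
      finally show "K \<le> card {B \<in> \<B>1. mso_type k B {} (A # Ps) = mso_type k D {} (A # Ps)}" by blast
    qed simp
    moreover have "mso_type (Suc k) (\<Union>\<B>1) {} Ps = mso_type (Suc k) (\<Union>\<B>) {} Ps"
    proof (cases "D = C")
      case True
      then have "\<B>1 = \<B>" using new by (auto simp: \<B>1_def)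
      then show ?thesis by simp
    next
      case False
      then have DS: "D \<in> S" using D by simp
      then have DB: "D \<in> \<B>" using SB by auto
      have e1: "\<Union>\<B>1 = \<Union>(\<B> - {D}) \<union> C" using False new DB by (auto simp: \<B>1_def)
      have e2: "\<Union>\<B> = \<Union>(\<B> - {D}) \<union> D" using DB by auto
      have g1: "glued (\<Union>(\<B> - {D})) {} C {}"
        by (rule glued_separated) (use new in \<open>auto intro!: separated_subset[OF sep]\<close>)
      have g2: "glued (\<Union>(\<B> - {D})) {} D {}"
        by (rule glued_separated) (use DB in \<open>auto intro: separated_subset[OF sep]\<close>)
      have "mso_type (Suc k) D {} Ps = mso_type (Suc k) C {} Ps"
        using DS by (simp only: S_def mem_Collect_eq)
      from mso_type_glued[OF g1 g2 refl this[symmetric] refl, of False False]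
      show ?thesis unfolding e1 unfolding e2[symmetric] by (simp only: select_roots_def) simp
    qed
    ultimately show "\<exists>A'. mso_type k (\<Union>(insert C \<B>)) {} (A # Ps) = mso_type k (\<Union>\<B>) {} (A' # Ps)"
      using ins mso_type_SucD by metis
  next
    fix A
    have "card T * K < card S" using card by (simp add: S_def[symmetric])
    with pigeonhole_fiber[OF finT inT[of A]] obtain D where D: "D \<in> S"
      and fib: "K < card {B \<in> S. mso_type k B {} (A # Ps) = mso_type k D {} (A # Ps)}" by blast
    have "mso_type (Suc k) D {} Ps = mso_type (Suc k) C {} Ps"
      using D by (simp only: S_def mem_Collect_eq)
    then obtain AC where AC: "mso_type k D {} (A # Ps) = mso_type k C {} (AC # Ps)"
      using mso_type_SucD by blast
    define A' where "A' = (A \<inter> \<Union>\<B>) \<union> (AC \<inter> C)"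
    have disj: "B \<inter> C = {}" if "B \<in> \<B>" for B using that sep new by (auto simp: separated_def)
    have tC: "mso_type k C {} (A' # Ps) = mso_type k C {} (AC # Ps)"
      by (rule mso_type_restrict_cong) (use disj in \<open>auto simp: A'_def list_all2_refl\<close>)
    have tB: "mso_type k B {} (A' # Ps) = mso_type k B {} (A # Ps)" if "B \<in> \<B>" for B
      by (rule mso_type_restrict_cong) (use disj that in \<open>auto simp: A'_def list_all2_refl\<close>)
    have tU: "mso_type k (\<Union>\<B>) {} (A' # Ps) = mso_type k (\<Union>\<B>) {} (A # Ps)"
      by (rule mso_type_restrict_cong) (use disj in \<open>auto simp: A'_def list_all2_refl\<close>)
    have "mso_type k (\<Union>(insert C \<B>)) {} (A' # Ps) = mso_type k (\<Union>\<B>) {} (A' # Ps)"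
    proof (rule K[OF fin _ sep new])
      have "card {B \<in> S. mso_type k B {} (A # Ps) = mso_type k D {} (A # Ps)} \<le>
          card {B \<in> \<B>. mso_type k B {} (A' # Ps) = mso_type k C {} (A' # Ps)}"
        by (rule card_mono) (use fin SB tB tC AC in auto)
      then show "K \<le> card {B \<in> \<B>. mso_type k B {} (A' # Ps) = mso_type k C {} (A' # Ps)}"
        using fib by simp
    qed simp
    then show "\<exists>A'. mso_type k (\<Union>\<B>) {} (A # Ps) = mso_type k (\<Union>(insert C \<B>)) {} (A' # Ps)"
      using tU by metis
  qed
qed

text \<open>Monadic second-order logic of rank \<open>k\<close> counts parts of a given type only up to a threshold. In every
round the threshold is multiplied by the number of types, which is finite.\<close>

lemma mso_type_absorb:
  "\<exists>K. \<forall>\<B> C (Ps :: 'a set set list). finite \<B> \<longrightarrow> length Ps = l \<longrightarrow> separated (insert C \<B>) \<longrightarrow> C \<notin> \<B> \<longrightarrow>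
      K \<le> card {B \<in> \<B>. mso_type k B {} Ps = mso_type k C {} Ps} \<longrightarrow>
      mso_type k (\<Union>(insert C \<B>)) {} Ps = mso_type k (\<Union>\<B>) {} Ps"
proof (induction k arbitrary: l)
  case 0
  show ?case by (intro exI[of _ 2] allI impI mso_type_0_absorb)
next
  case (Suc k)
  obtain K where K: "\<And>\<B> C (Ps :: 'a set set list). finite \<B> \<Longrightarrow> length Ps = Suc l \<Longrightarrow>
      separated (insert C \<B>) \<Longrightarrow> C \<notin> \<B> \<Longrightarrow>
      K \<le> card {B \<in> \<B>. mso_type k B {} Ps = mso_type k C {} Ps} \<Longrightarrow>
      mso_type k (\<Union>(insert C \<B>)) {} Ps = mso_type k (\<Union>\<B>) {} Ps"
    using Suc.IH[of "Suc l"] by blast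
  have "mso_type (Suc k) (\<Union>(insert C \<B>)) {} Ps = mso_type (Suc k) (\<Union>\<B>) {} Ps"
    if "finite \<B>" "length Ps = l" "separated (insert C \<B>)" "C \<notin> \<B>"
      "card (mso_types TYPE('a) k (Suc l)) * K + 1 \<le>
        card {B \<in> \<B>. mso_type (Suc k) B {} Ps = mso_type (Suc k) C {} Ps}"
    for \<B> C and Ps :: "'a set set list"
  proof -
    note K' = K[folded that(2)] and card = that(5)[folded that(2)]
    show ?thesis
      by (rule mso_type_Suc_absorb[where K = K], rule K', assumption+) (fact that card)+
  qed
  then show ?case by blast
qed

section \<open>Sentences and types\<close>

definition incidence_universe :: "'a ugraph \<Rightarrow> 'a set set" where
  "incidence_universe G = (\<lambda>v. {v}) ` verts G \<union> edges G"

definition simple :: "'a ugraph \<Rightarrow> bool" where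
  "simple G \<longleftrightarrow> (\<forall>e\<in>edges G. e \<subseteq> verts G \<and> card e = 2)"

primrec quantifier_depth :: "mso2 \<Rightarrow> nat" where
  "quantifier_depth (VEq x y) = 0"
| "quantifier_depth (EEq x y) = 0"
| "quantifier_depth (mso2.Inc x y) = 0"
| "quantifier_depth (VMem x X) = 0"
| "quantifier_depth (EMem x X) = 0"
| "quantifier_depth (Neg \<phi>) = quantifier_depth \<phi>"
| "quantifier_depth (Conj \<phi> \<psi>) = max (quantifier_depth \<phi>) (quantifier_depth \<psi>)"
| "quantifier_depth (ExV x \<phi>) = Suc (quantifier_depth \<phi>)"
| "quantifier_depth (ExE x \<phi>) = Suc (quantifier_depth \<phi>)"
| "quantifier_depth (ExVS X \<phi>) = Suc (quantifier_depth \<phi>)"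
| "quantifier_depth (ExES X \<phi>) = Suc (quantifier_depth \<phi>)"

text \<open>A vertex or an edge becomes a one-element set, so that only sets have to be chosen in the game.\<close>

fun encodes :: "'a ugraph \<Rightarrow> (nat \<Rightarrow> 'a) \<Rightarrow> (nat \<Rightarrow> 'a set) \<Rightarrow> (nat \<Rightarrow> 'a set) \<Rightarrow> (nat \<Rightarrow> 'a set set) \<Rightarrow>
    mso2_var \<Rightarrow> 'a set set \<Rightarrow> bool" where
  "encodes G v e V E (VVar x) P \<longleftrightarrow> v x \<in> verts G \<and> P = {{v x}}"
| "encodes G v e V E (EVar x) P \<longleftrightarrow> e x \<in> edges G \<and> P = {e x}"
| "encodes G v e V E (VSVar X) P \<longleftrightarrow> V X \<subseteq> verts G \<and> P = (\<lambda>a. {a}) ` V X"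
| "encodes G v e V E (ESVar X) P \<longleftrightarrow> E X \<subseteq> edges G \<and> P = E X"

text \<open>The variables in \<open>Z\<close> have their values encoded by the list of parameters, where \<open>i\<close> gives the
position of each variable in that list.\<close>

definition represents :: "'a ugraph \<Rightarrow> (mso2_var \<Rightarrow> nat) \<Rightarrow> 'a set set list \<Rightarrow>
    (nat \<Rightarrow> 'a) \<Rightarrow> (nat \<Rightarrow> 'a set) \<Rightarrow> (nat \<Rightarrow> 'a set) \<Rightarrow> (nat \<Rightarrow> 'a set set) \<Rightarrow> mso2_var set \<Rightarrow> bool" where
  "represents G i Ps v e V E Z \<longleftrightarrow>
     (\<forall>z\<in>Z. i z < length Ps \<and> encodes G v e V E z (Ps ! i z \<inter> incidence_universe G))"

lemma representsD:
  assumes "represents G i Ps v e V E Z" "z \<in> Z"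
  shows "i z < length Ps" "encodes G v e V E z (Ps ! i z \<inter> incidence_universe G)"
  using assms unfolding represents_def by auto

lemma represents_mono: "represents G i Ps v e V E Z \<Longrightarrow> Z' \<subseteq> Z \<Longrightarrow> represents G i Ps v e V E Z'"
  unfolding represents_def by blast

text \<open>Quantified sets are put in front of the list of parameters, which moves all earlier ones.\<close>

definition push_index :: "mso2_var \<Rightarrow> (mso2_var \<Rightarrow> nat) \<Rightarrow> mso2_var \<Rightarrow> nat" where
  "push_index x i = (\<lambda>z. if z = x then 0 else Suc (i z))"

lemma represents_push:
  assumes "represents G i Ps v e V E (Z - {x})"
    and "encodes G v' e' V' E' x (A \<inter> incidence_universe G)"
    and "\<And>z P. z \<noteq> x \<Longrightarrow> encodes G v' e' V' E' z P \<longleftrightarrow> encodes G v e V E z P"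
  shows "represents G (push_index x i) (A # Ps) v' e' V' E' Z"
  unfolding represents_def
proof
  fix z assume "z \<in> Z"
  show "push_index x i z < length (A # Ps) \<and>
      encodes G v' e' V' E' z ((A # Ps) ! push_index x i z \<inter> incidence_universe G)"
  proof (cases "z = x")
    case True
    then show ?thesis using assms(2) by (simp add: push_index_def)
  next
    case False
    then show ?thesis
      using representsD[OF assms(1), of z] \<open>z \<in> Z\<close> assms(3)[OF False] by (simp add: push_index_def)
  qed
qed

lemma simple_card_universe:
  assumes "simple G" "P \<subseteq> incidence_universe G" "x \<in> P"
  shows "card x = 1 \<longleftrightarrow> (\<exists>a\<in>verts G. x = {a})" "card x \<noteq> 1 \<longleftrightarrow> x \<in> edges G"
  using assms by (auto simp: incidence_universe_def simple_def)

lemma mso2_sat_atomic_iff: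
  assumes "simple G" "represents G i Ps v e V E (mso2_fv \<phi>)"
  shows "\<phi> = VEq x y \<Longrightarrow> mso2_sat G v e V E \<phi> \<longleftrightarrow>
      holds (incidence_universe G) {} Ps (SubAt (i (VVar x)) (i (VVar y)))"
    and "\<phi> = EEq x y \<Longrightarrow> mso2_sat G v e V E \<phi> \<longleftrightarrow>
      holds (incidence_universe G) {} Ps (SubAt (i (EVar x)) (i (EVar y)))"
    and "\<phi> = mso2.Inc x y \<Longrightarrow> mso2_sat G v e V E \<phi> \<longleftrightarrow>
      holds (incidence_universe G) {} Ps (IncAt (i (VVar x)) (i (EVar y)))"
    and "\<phi> = VMem x y \<Longrightarrow> mso2_sat G v e V E \<phi> \<longleftrightarrow>
      holds (incidence_universe G) {} Ps (SubAt (i (VVar x)) (i (VSVar y)))"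
    and "\<phi> = EMem x y \<Longrightarrow> mso2_sat G v e V E \<phi> \<longleftrightarrow>
      holds (incidence_universe G) {} Ps (SubAt (i (EVar x)) (i (ESVar y)))"
proof -
  note r = representsD[OF assms(2)]
  show "\<phi> = VEq x y \<Longrightarrow> mso2_sat G v e V E \<phi> \<longleftrightarrow>
      holds (incidence_universe G) {} Ps (SubAt (i (VVar x)) (i (VVar y)))"
    using r[of "VVar x"] r[of "VVar y"] by (simp del: Int_subset_iff le_inf_iff)
  show "\<phi> = EEq x y \<Longrightarrow> mso2_sat G v e V E \<phi> \<longleftrightarrow>
      holds (incidence_universe G) {} Ps (SubAt (i (EVar x)) (i (EVar y)))"
    using r[of "EVar x"] r[of "EVar y"] by (simp del: Int_subset_iff le_inf_iff)
  show "\<phi> = mso2.Inc x y \<Longrightarrow> mso2_sat G v e V E \<phi> \<longleftrightarrow>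
      holds (incidence_universe G) {} Ps (IncAt (i (VVar x)) (i (EVar y)))"
    using r[of "VVar x"] r[of "EVar y"] assms(1) by (simp add: incident_def simple_def)
  show "\<phi> = VMem x y \<Longrightarrow> mso2_sat G v e V E \<phi> \<longleftrightarrow>
      holds (incidence_universe G) {} Ps (SubAt (i (VVar x)) (i (VSVar y)))"
    using r[of "VVar x"] r[of "VSVar y"] by (auto simp del: Int_subset_iff le_inf_iff)
  show "\<phi> = EMem x y \<Longrightarrow> mso2_sat G v e V E \<phi> \<longleftrightarrow>
      holds (incidence_universe G) {} Ps (SubAt (i (EVar x)) (i (ESVar y)))"
    using r[of "EVar x"] r[of "ESVar y"] by (simp del: Int_subset_iff le_inf_iff)
qed

text \<open>Whether a set encodes a vertex, an edge, a set of vertices or a set of edges can be read off from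
atomic facts. Hence the answer to the choice of a value is a value of the same sort.\<close>

lemma atoms_determine_sort:
  assumes "simple G"
  shows "(\<exists>a\<in>verts G. A \<inter> incidence_universe G = {{a}}) \<longleftrightarrow>
      holds (incidence_universe G) {} (A # Ps) (SingAt 0) \<and> holds (incidence_universe G) {} (A # Ps) (VertAt 0)"
    and "(\<exists>a\<in>edges G. A \<inter> incidence_universe G = {a}) \<longleftrightarrow>
      holds (incidence_universe G) {} (A # Ps) (SingAt 0) \<and> holds (incidence_universe G) {} (A # Ps) (EdgeAt 0)"
    and "(\<exists>B\<subseteq>verts G. A \<inter> incidence_universe G = (\<lambda>a. {a}) ` B) \<longleftrightarrow>
      \<not> holds (incidence_universe G) {} (A # Ps) (EdgeAt 0)"
    and "(\<exists>B\<subseteq>edges G. A \<inter> incidence_universe G = B) \<longleftrightarrow>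
      \<not> holds (incidence_universe G) {} (A # Ps) (VertAt 0)"
proof -
  define P where "P = A \<inter> incidence_universe G"
  have PU: "P \<subseteq> incidence_universe G" by (simp add: P_def)
  have v: "card x = 1 \<longleftrightarrow> (\<exists>a\<in>verts G. x = {a})" and e: "card x \<noteq> 1 \<longleftrightarrow> x \<in> edges G" if "x \<in> P" for x
    using simple_card_universe[OF assms PU that] by auto
  show "(\<exists>a\<in>verts G. A \<inter> incidence_universe G = {{a}}) \<longleftrightarrow>
      holds (incidence_universe G) {} (A # Ps) (SingAt 0) \<and> holds (incidence_universe G) {} (A # Ps) (VertAt 0)"
    using v by (auto simp: P_def[symmetric])
  show "(\<exists>a\<in>edges G. A \<inter> incidence_universe G = {a}) \<longleftrightarrow>
      holds (incidence_universe G) {} (A # Ps) (SingAt 0) \<and> holds (incidence_universe G) {} (A # Ps) (EdgeAt 0)"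
    using e by (auto simp: P_def[symmetric])
  have "(\<exists>B\<subseteq>verts G. P = (\<lambda>a. {a}) ` B) \<longleftrightarrow> \<not> (\<exists>x\<in>P. card x \<noteq> 1)"
  proof
    assume "\<not> (\<exists>x\<in>P. card x \<noteq> 1)"
    then have "P \<subseteq> (\<lambda>a. {a}) ` verts G" using v by blast
    then show "\<exists>B\<subseteq>verts G. P = (\<lambda>a. {a}) ` B" by (simp only: subset_image_iff)
  qed auto
  then show "(\<exists>B\<subseteq>verts G. A \<inter> incidence_universe G = (\<lambda>a. {a}) ` B) \<longleftrightarrow>
      \<not> holds (incidence_universe G) {} (A # Ps) (EdgeAt 0)"
    by (simp add: P_def[symmetric])
  show "(\<exists>B\<subseteq>edges G. A \<inter> incidence_universe G = B) \<longleftrightarrow>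
      \<not> holds (incidence_universe G) {} (A # Ps) (VertAt 0)"
    using v e by (auto simp: P_def[symmetric])
qed

lemma encodes_unchanged:
  "z \<noteq> VVar x \<Longrightarrow> encodes G (v(x := a)) e V E z P \<longleftrightarrow> encodes G v e V E z P"
  "z \<noteq> EVar x \<Longrightarrow> encodes G v (e(x := b)) V E z P \<longleftrightarrow> encodes G v e V E z P"
  "z \<noteq> VSVar x \<Longrightarrow> encodes G v e (V(x := A)) E z P \<longleftrightarrow> encodes G v e V E z P"
  "z \<noteq> ESVar x \<Longrightarrow> encodes G v e V (E(x := B)) z P \<longleftrightarrow> encodes G v e V E z P"
  by (cases z; simp)+

text \<open>Each quantifier of the formula is played as one round of the game.\<close>

lemma mso2_sat_determined_by_type:
  fixes G G' :: "'a ugraph"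
  assumes "simple G" "simple G'"
    and "mso_type k (incidence_universe G) {} Ps = mso_type k (incidence_universe G') {} Ps'"
    and "quantifier_depth \<phi> \<le> k"
    and "represents G i Ps v e V E (mso2_fv \<phi>)" "represents G' i Ps' v' e' V' E' (mso2_fv \<phi>)"
  shows "mso2_sat G v e V E \<phi> \<longleftrightarrow> mso2_sat G' v' e' V' E' \<phi>"
  using assms
proof (induction \<phi> arbitrary: G G' k Ps Ps' i v e V E v' e' V' E')
  case (VEq x y)
  note r = VEq(5,6)
  show ?case
    unfolding mso2_sat_atomic_iff(1)[OF VEq(1) r(1) refl] mso2_sat_atomic_iff(1)[OF VEq(2) r(2) refl]
    by (rule mso_type_eq_imp_holds) (rule VEq(3))
next
  case (EEq x y)
  note r = EEq(5,6)
  show ?case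
    unfolding mso2_sat_atomic_iff(2)[OF EEq(1) r(1) refl] mso2_sat_atomic_iff(2)[OF EEq(2) r(2) refl]
    by (rule mso_type_eq_imp_holds) (rule EEq(3))
next
  case (Inc x y)
  note r = Inc(5,6)
  show ?case
    unfolding mso2_sat_atomic_iff(3)[OF Inc(1) r(1) refl] mso2_sat_atomic_iff(3)[OF Inc(2) r(2) refl]
    by (rule mso_type_eq_imp_holds) (rule Inc(3))
next
  case (VMem x y)
  note r = VMem(5,6)
  show ?case
    unfolding mso2_sat_atomic_iff(4)[OF VMem(1) r(1) refl] mso2_sat_atomic_iff(4)[OF VMem(2) r(2) refl]
    by (rule mso_type_eq_imp_holds) (rule VMem(3))
next
  case (EMem x y)
  note r = EMem(5,6)
  show ?case
    unfolding mso2_sat_atomic_iff(5)[OF EMem(1) r(1) refl] mso2_sat_atomic_iff(5)[OF EMem(2) r(2) refl]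
    by (rule mso_type_eq_imp_holds) (rule EMem(3))
next
  case (Neg \<phi>)
  have "mso2_sat G v e V E \<phi> \<longleftrightarrow> mso2_sat G' v' e' V' E' \<phi>"
    by (rule Neg.IH[OF Neg.prems(1-3)]) (use Neg.prems in simp_all)
  then show ?case by simp
next
  case (Conj \<phi> \<psi>)
  have "mso2_sat G v e V E \<phi> \<longleftrightarrow> mso2_sat G' v' e' V' E' \<phi>"
    by (rule Conj.IH(1)[OF Conj.prems(1-3)])
      (use Conj.prems in \<open>auto intro: represents_mono\<close>)
  moreover have "mso2_sat G v e V E \<psi> \<longleftrightarrow> mso2_sat G' v' e' V' E' \<psi>"
    by (rule Conj.IH(2)[OF Conj.prems(1-3)])
      (use Conj.prems in \<open>auto intro: represents_mono\<close>)
  ultimately show ?case by simp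
next
  case (ExV x \<phi>)
  obtain j where k: "k = Suc j" using ExV.prems(4) by (cases k) auto
  have forth: "mso2_sat G' v' e' V' E' (ExV x \<phi>)"
    if sat: "mso2_sat G v e V E (ExV x \<phi>)" and s: "simple G" "simple G'"
      and t: "mso_type (Suc j) (incidence_universe G) {} Ps = mso_type (Suc j) (incidence_universe G') {} Ps'"
      and r: "represents G i Ps v e V E (mso2_fv \<phi> - {VVar x})"
        "represents G' i Ps' v' e' V' E' (mso2_fv \<phi> - {VVar x})"
    for G G' :: "'a ugraph" and Ps Ps' v e V E v' e' V' E'
  proof -
    obtain a where a: "a \<in> verts G" "mso2_sat G (v(x := a)) e V E \<phi>" using sat by auto
    obtain A' where A': "mso_type j (incidence_universe G) {} ({{a}} # Ps) =
        mso_type j (incidence_universe G') {} (A' # Ps')"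
      using mso_type_SucD[OF t] .
    have enc: "{{a}} \<inter> incidence_universe G = {{a}}" using a(1) by (auto simp: incidence_universe_def)
    have "\<exists>b\<in>verts G. {{a}} \<inter> incidence_universe G = {{b}}" using a(1) enc by blast
    then have "\<exists>b\<in>verts G'. A' \<inter> incidence_universe G' = {{b}}"
      unfolding atoms_determine_sort(1)[OF s(2), of A' Ps'] atoms_determine_sort(1)[OF s(1), of "{{a}}" Ps]
        mso_type_eq_imp_holds[OF A'] .
    then obtain a' where a': "a' \<in> verts G'" "A' \<inter> incidence_universe G' = {{a'}}" by blast
    have "mso2_sat G (v(x := a)) e V E \<phi> \<longleftrightarrow> mso2_sat G' (v'(x := a')) e' V' E' \<phi>"
    proof (rule ExV.IH[OF s A'])
      show "represents G (push_index (VVar x) i) ({{a}} # Ps) (v(x := a)) e V E (mso2_fv \<phi>)"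
        by (rule represents_push[OF r(1)]) (simp_all add: enc a encodes_unchanged)
      show "represents G' (push_index (VVar x) i) (A' # Ps') (v'(x := a')) e' V' E' (mso2_fv \<phi>)"
        by (rule represents_push[OF r(2)]) (simp_all add: a' encodes_unchanged)
    qed (use ExV.prems(4) k in simp)
    then show ?thesis using a a' by auto
  qed
  note t = ExV.prems(3)[unfolded k] and r = ExV.prems(5,6)[unfolded mso2_fv.simps]
  show ?case
  proof
    assume "mso2_sat G v e V E (ExV x \<phi>)"
    then show "mso2_sat G' v' e' V' E' (ExV x \<phi>)"
      by (rule forth[OF _ ExV.prems(1,2) t r])
  next
    assume "mso2_sat G' v' e' V' E' (ExV x \<phi>)"
    then show "mso2_sat G v e V E (ExV x \<phi>)"
      by (rule forth[OF _ ExV.prems(2,1) t[symmetric] r(2,1)])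
  qed
next
  case (ExE x \<phi>)
  obtain j where k: "k = Suc j" using ExE.prems(4) by (cases k) auto
  have forth: "mso2_sat G' v' e' V' E' (ExE x \<phi>)"
    if sat: "mso2_sat G v e V E (ExE x \<phi>)" and s: "simple G" "simple G'"
      and t: "mso_type (Suc j) (incidence_universe G) {} Ps = mso_type (Suc j) (incidence_universe G') {} Ps'"
      and r: "represents G i Ps v e V E (mso2_fv \<phi> - {EVar x})"
        "represents G' i Ps' v' e' V' E' (mso2_fv \<phi> - {EVar x})"
    for G G' :: "'a ugraph" and Ps Ps' v e V E v' e' V' E'
  proof -
    obtain a where a: "a \<in> edges G" "mso2_sat G v (e(x := a)) V E \<phi>" using sat by auto
    obtain A' where A': "mso_type j (incidence_universe G) {} ({a} # Ps) =
        mso_type j (incidence_universe G') {} (A' # Ps')"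
      using mso_type_SucD[OF t] .
    have enc: "{a} \<inter> incidence_universe G = {a}" using a(1) by (auto simp: incidence_universe_def)
    have "\<exists>b\<in>edges G. {a} \<inter> incidence_universe G = {b}" using a(1) enc by blast
    then have "\<exists>b\<in>edges G'. A' \<inter> incidence_universe G' = {b}"
      unfolding atoms_determine_sort(2)[OF s(2), of A' Ps'] atoms_determine_sort(2)[OF s(1), of "{a}" Ps]
        mso_type_eq_imp_holds[OF A'] .
    then obtain a' where a': "a' \<in> edges G'" "A' \<inter> incidence_universe G' = {a'}" by blast
    have "mso2_sat G v (e(x := a)) V E \<phi> \<longleftrightarrow> mso2_sat G' v' (e'(x := a')) V' E' \<phi>"
    proof (rule ExE.IH[OF s A'])
      show "represents G (push_index (EVar x) i) ({a} # Ps) v (e(x := a)) V E (mso2_fv \<phi>)"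
        by (rule represents_push[OF r(1)]) (simp_all add: enc a encodes_unchanged)
      show "represents G' (push_index (EVar x) i) (A' # Ps') v' (e'(x := a')) V' E' (mso2_fv \<phi>)"
        by (rule represents_push[OF r(2)]) (simp_all add: a' encodes_unchanged)
    qed (use ExE.prems(4) k in simp)
    then show ?thesis using a a' by auto
  qed
  note t = ExE.prems(3)[unfolded k] and r = ExE.prems(5,6)[unfolded mso2_fv.simps]
  show ?case
  proof
    assume "mso2_sat G v e V E (ExE x \<phi>)"
    then show "mso2_sat G' v' e' V' E' (ExE x \<phi>)"
      by (rule forth[OF _ ExE.prems(1,2) t r])
  next
    assume "mso2_sat G' v' e' V' E' (ExE x \<phi>)"
    then show "mso2_sat G v e V E (ExE x \<phi>)"
      by (rule forth[OF _ ExE.prems(2,1) t[symmetric] r(2,1)])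
  qed
next
  case (ExVS x \<phi>)
  obtain j where k: "k = Suc j" using ExVS.prems(4) by (cases k) auto
  have forth: "mso2_sat G' v' e' V' E' (ExVS x \<phi>)"
    if sat: "mso2_sat G v e V E (ExVS x \<phi>)" and s: "simple G" "simple G'"
      and t: "mso_type (Suc j) (incidence_universe G) {} Ps = mso_type (Suc j) (incidence_universe G') {} Ps'"
      and r: "represents G i Ps v e V E (mso2_fv \<phi> - {VSVar x})"
        "represents G' i Ps' v' e' V' E' (mso2_fv \<phi> - {VSVar x})"
    for G G' :: "'a ugraph" and Ps Ps' v e V E v' e' V' E'
  proof -
    obtain a where a: "a \<subseteq> verts G" "mso2_sat G v e (V(x := a)) E \<phi>" using sat by auto
    obtain A' where A': "mso_type j (incidence_universe G) {} ((\<lambda>a. {a}) ` a # Ps) =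
        mso_type j (incidence_universe G') {} (A' # Ps')"
      using mso_type_SucD[OF t] .
    have enc: "(\<lambda>a. {a}) ` a \<inter> incidence_universe G = (\<lambda>a. {a}) ` a"
      using a(1) by (auto simp: incidence_universe_def)
    have "\<not> holds (incidence_universe G) {} ((\<lambda>a. {a}) ` a # Ps) (EdgeAt 0)" by auto
    then have "\<exists>B\<subseteq>verts G'. A' \<inter> incidence_universe G' = (\<lambda>a. {a}) ` B"
      unfolding atoms_determine_sort(3)[OF s(2), of A' Ps'] mso_type_eq_imp_holds[OF A'] .
    then obtain a' where a': "a' \<subseteq> verts G'" "A' \<inter> incidence_universe G' = (\<lambda>a. {a}) ` a'" by blast
    have "mso2_sat G v e (V(x := a)) E \<phi> \<longleftrightarrow> mso2_sat G' v' e' (V'(x := a')) E' \<phi>"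
    proof (rule ExVS.IH[OF s A'])
      show "represents G (push_index (VSVar x) i) ((\<lambda>a. {a}) ` a # Ps) v e (V(x := a)) E (mso2_fv \<phi>)"
        by (rule represents_push[OF r(1)]) (simp_all add: enc a encodes_unchanged)
      show "represents G' (push_index (VSVar x) i) (A' # Ps') v' e' (V'(x := a')) E' (mso2_fv \<phi>)"
        by (rule represents_push[OF r(2)]) (simp_all add: a' encodes_unchanged)
    qed (use ExVS.prems(4) k in simp)
    then show ?thesis using a a' by auto
  qed
  note t = ExVS.prems(3)[unfolded k] and r = ExVS.prems(5,6)[unfolded mso2_fv.simps]
  show ?case
  proof
    assume "mso2_sat G v e V E (ExVS x \<phi>)"
    then show "mso2_sat G' v' e' V' E' (ExVS x \<phi>)"
      by (rule forth[OF _ ExVS.prems(1,2) t r])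
  next
    assume "mso2_sat G' v' e' V' E' (ExVS x \<phi>)"
    then show "mso2_sat G v e V E (ExVS x \<phi>)"
      by (rule forth[OF _ ExVS.prems(2,1) t[symmetric] r(2,1)])
  qed
next
  case (ExES x \<phi>)
  obtain j where k: "k = Suc j" using ExES.prems(4) by (cases k) auto
  have forth: "mso2_sat G' v' e' V' E' (ExES x \<phi>)"
    if sat: "mso2_sat G v e V E (ExES x \<phi>)" and s: "simple G" "simple G'"
      and t: "mso_type (Suc j) (incidence_universe G) {} Ps = mso_type (Suc j) (incidence_universe G') {} Ps'"
      and r: "represents G i Ps v e V E (mso2_fv \<phi> - {ESVar x})"
        "represents G' i Ps' v' e' V' E' (mso2_fv \<phi> - {ESVar x})"
    for G G' :: "'a ugraph" and Ps Ps' v e V E v' e' V' E'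
  proof -
    obtain a where a: "a \<subseteq> edges G" "mso2_sat G v e V (E(x := a)) \<phi>" using sat by auto
    obtain A' where A': "mso_type j (incidence_universe G) {} (a # Ps) =
        mso_type j (incidence_universe G') {} (A' # Ps')"
      using mso_type_SucD[OF t] .
    have enc: "a \<inter> incidence_universe G = a"
      using a(1) by (auto simp: incidence_universe_def)
    have "\<exists>B\<subseteq>edges G. a \<inter> incidence_universe G = B" using a(1) enc by blast
    then have "\<exists>B\<subseteq>edges G'. A' \<inter> incidence_universe G' = B"
      unfolding atoms_determine_sort(4)[OF s(2), of A' Ps'] atoms_determine_sort(4)[OF s(1), of a Ps]
        mso_type_eq_imp_holds[OF A'] .
    then obtain a' where a': "a' \<subseteq> edges G'" "A' \<inter> incidence_universe G' = a'" by blast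
    have "mso2_sat G v e V (E(x := a)) \<phi> \<longleftrightarrow> mso2_sat G' v' e' V' (E'(x := a')) \<phi>"
    proof (rule ExES.IH[OF s A'])
      show "represents G (push_index (ESVar x) i) (a # Ps) v e V (E(x := a)) (mso2_fv \<phi>)"
        by (rule represents_push[OF r(1)]) (simp_all add: enc a encodes_unchanged)
      show "represents G' (push_index (ESVar x) i) (A' # Ps') v' e' V' (E'(x := a')) (mso2_fv \<phi>)"
        by (rule represents_push[OF r(2)]) (simp_all add: a' encodes_unchanged)
    qed (use ExES.prems(4) k in simp)
    then show ?thesis using a a' by auto
  qed
  note t = ExES.prems(3)[unfolded k] and r = ExES.prems(5,6)[unfolded mso2_fv.simps]
  show ?case
  proof
    assume "mso2_sat G v e V E (ExES x \<phi>)"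
    then show "mso2_sat G' v' e' V' E' (ExES x \<phi>)"
      by (rule forth[OF _ ExES.prems(1,2) t r])
  next
    assume "mso2_sat G' v' e' V' E' (ExES x \<phi>)"
    then show "mso2_sat G v e V E (ExES x \<phi>)"
      by (rule forth[OF _ ExES.prems(2,1) t[symmetric] r(2,1)])
  qed
qed

lemma mso2_models_determined_by_type:
  fixes G G' :: "'a ugraph"
  assumes "\<phi> \<in> mso2_sentences" "simple G" "simple G'"
    and "mso_type (quantifier_depth \<phi>) (incidence_universe G) {} [] =
      mso_type (quantifier_depth \<phi>) (incidence_universe G') {} []"
  shows "mso2_models G \<phi> \<longleftrightarrow> mso2_models G' \<phi>"
  unfolding mso2_models_def
  by (rule mso2_sat_determined_by_type[OF assms(2,3,4) order_refl])
    (use assms(1) in \<open>simp_all add: represents_def mso2_sentences_def\<close>)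

primrec mso2_of_fo :: "fo \<Rightarrow> mso2" where
  "mso2_of_fo (FEq x y) = VEq x y"
| "mso2_of_fo (FAdj x y) = Conj (Neg (VEq x y)) (ExE 0 (Conj (mso2.Inc x 0) (mso2.Inc y 0)))"
| "mso2_of_fo (FNeg \<phi>) = Neg (mso2_of_fo \<phi>)"
| "mso2_of_fo (FConj \<phi> \<psi>) = Conj (mso2_of_fo \<phi>) (mso2_of_fo \<psi>)"
| "mso2_of_fo (FEx x \<phi>) = ExV x (mso2_of_fo \<phi>)"

lemma mso2_of_fo_sentences: "\<phi> \<in> fo_sentences \<Longrightarrow> mso2_of_fo \<phi> \<in> mso2_sentences"
proof -
  have "mso2_fv (mso2_of_fo \<phi>) = VVar ` fo_fv \<phi>" by (induction \<phi>) auto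
  then show "\<phi> \<in> fo_sentences \<Longrightarrow> mso2_of_fo \<phi> \<in> mso2_sentences"
    by (simp add: fo_sentences_def mso2_sentences_def)
qed

text \<open>In a simple graph two vertices are adjacent if and only if they are distinct and lie on a common
edge.\<close>

lemma fo_sat_mso2_of_fo:
  assumes "simple G"
  shows "mso2_sat G v e V E (mso2_of_fo \<phi>) \<longleftrightarrow> fo_sat G v \<phi>"
proof (induction \<phi> arbitrary: v e)
  case (FAdj x y)
  have "{v x, v y} \<in> edges G \<longleftrightarrow> v x \<noteq> v y \<and> (\<exists>a\<in>edges G. v x \<in> a \<and> v y \<in> a)"
  proof
    assume "{v x, v y} \<in> edges G"
    moreover from this have "card {v x, v y} = 2" using assms by (simp only: simple_def)
    then have "v x \<noteq> v y" by auto
    ultimately show "v x \<noteq> v y \<and> (\<exists>a\<in>edges G. v x \<in> a \<and> v y \<in> a)" by blast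
  next
    assume *: "v x \<noteq> v y \<and> (\<exists>a\<in>edges G. v x \<in> a \<and> v y \<in> a)"
    then obtain a where a: "a \<in> edges G" "v x \<in> a" "v y \<in> a" by blast
    have "card a = 2" using a(1) assms by (simp only: simple_def)
    then obtain s t where "a = {s, t}" by (auto simp: card_2_iff)
    then have "a = {v x, v y}" using a * by auto
    then show "{v x, v y} \<in> edges G" using a by simp
  qed
  then show ?case by simp
qed simp_all

lemma fo_models_iff_mso2_models:
  "simple G \<Longrightarrow> fo_models G \<phi> \<longleftrightarrow> mso2_models G (mso2_of_fo \<phi>)"
  by (simp add: fo_models_def mso2_models_def fo_sat_mso2_of_fo)

section \<open>Rooted trees and their types\<close>

text \<open>Every finite rooted tree can be built from single vertices by hanging the root of a tree \<open>b\<close> as a new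
child below the root of a tree \<open>a\<close>, which is \<open>Join a b\<close>. With this single binary operation a type of
rooted trees that is compatible with it is a homomorphism into a finite algebra, and pumping becomes
the usual argument for terms.\<close>

datatype tree_term = Leaf | Join tree_term tree_term

primrec nodes :: "tree_term \<Rightarrow> nat" where
  "nodes Leaf = 1"
| "nodes (Join a b) = nodes a + nodes b"

lemma nodes_pos: "0 < nodes t"
  by (induction t) auto

inductive rooted_tree :: "'a set \<Rightarrow> 'a set set \<Rightarrow> 'a \<Rightarrow> tree_term \<Rightarrow> bool" where
  rooted_tree_Leaf: "rooted_tree {r} {} r Leaf"
| rooted_tree_Join: "rooted_tree V1 E1 r1 a \<Longrightarrow> rooted_tree V2 E2 r2 b \<Longrightarrow> V1 \<inter> V2 = {} \<Longrightarrow>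
    rooted_tree (V1 \<union> V2) (insert {r1, r2} (E1 \<union> E2)) r1 (Join a b)"

lemma rooted_tree_root: "rooted_tree V E r t \<Longrightarrow> r \<in> V"
  by (induction rule: rooted_tree.induct) auto

lemma rooted_tree_simple: "rooted_tree V E r t \<Longrightarrow> simple (V, E)"
proof (induction rule: rooted_tree.induct)
  case (rooted_tree_Join V1 E1 r1 a V2 E2 r2 b)
  have "r1 \<in> V1" "r2 \<in> V2" using rooted_tree_Join.hyps by (auto dest: rooted_tree_root)
  moreover from this have "r1 \<noteq> r2" using rooted_tree_Join.hyps by auto
  ultimately show ?case using rooted_tree_Join.IH by (auto simp: simple_def)
qed (simp add: simple_def)

lemma rooted_tree_card:
  "rooted_tree V E r t \<Longrightarrow> finite V \<and> card V = nodes t \<and> finite E \<and> Suc (card E) = nodes t"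
proof (induction rule: rooted_tree.induct)
  case (rooted_tree_Join V1 E1 r1 a V2 E2 r2 b)
  note IH = rooted_tree_Join.IH
  have r: "r1 \<in> V1" "r2 \<in> V2" and s: "simple (V1, E1)" "simple (V2, E2)"
    using rooted_tree_Join.hyps by (auto dest: rooted_tree_root rooted_tree_simple)
  have E: "e \<subseteq> V1" "e \<noteq> {}" if "e \<in> E1" for e using s(1) that by (auto simp: simple_def)
  have E': "e \<subseteq> V2" if "e \<in> E2" for e using s(2) that by (auto simp: simple_def)
  have "E1 \<inter> E2 = {}" using E E' rooted_tree_Join.hyps(3) by blast
  moreover have "{r1, r2} \<notin> E1 \<union> E2" using E E' r rooted_tree_Join.hyps(3) by blast
  ultimately show ?case
    using IH rooted_tree_Join.hyps(3) by (simp add: card_Un_disjoint)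
qed simp

lemma rooted_tree_connected:
  "rooted_tree V E r t \<Longrightarrow> v \<in> V \<Longrightarrow> (r, v) \<in> {(x, y). {x, y} \<in> E}\<^sup>*"
proof (induction arbitrary: v rule: rooted_tree.induct)
  case (rooted_tree_Join V1 E1 r1 a V2 E2 r2 b)
  let ?A = "{(x, y). {x, y} \<in> insert {r1, r2} (E1 \<union> E2)}"
  have m: "{(x, y). {x, y} \<in> E1}\<^sup>* \<subseteq> ?A\<^sup>*" "{(x, y). {x, y} \<in> E2}\<^sup>* \<subseteq> ?A\<^sup>*"
    by (rule rtrancl_mono, force)+
  show ?case
  proof (cases "v \<in> V1")
    case True
    then show ?thesis using rooted_tree_Join.IH(1) m(1) by blast
  next
    case False
    then have "(r2, v) \<in> ?A\<^sup>*" using rooted_tree_Join.IH(2) rooted_tree_Join.prems m(2) by blast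
    moreover have "(r1, r2) \<in> ?A" by simp
    ultimately show ?thesis by (meson converse_rtrancl_into_rtrancl)
  qed
qed simp

lemma rooted_tree_exists:
  assumes "finite S" "card S = nodes t"
  shows "\<exists>E r. rooted_tree S E r t"
  using assms
proof (induction t arbitrary: S)
  case Leaf
  then obtain r where "S = {r}" by (auto simp: card_1_singleton_iff)
  then show ?case using rooted_tree_Leaf[of r] by blast
next
  case (Join a b)
  obtain V1 where V1: "V1 \<subseteq> S" "card V1 = nodes a"
    using Join.prems obtain_subset_with_card_n[of "nodes a" S] by auto
  define V2 where "V2 = S - V1"
  have "finite V1" using V1(1) Join.prems(1) finite_subset by blast
  moreover have "finite V2" using Join.prems(1) by (simp add: V2_def)
  moreover have "card V2 = nodes b"
    using V1 Join.prems \<open>finite V1\<close> by (simp add: V2_def card_Diff_subset)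
  ultimately obtain E1 r1 E2 r2 where "rooted_tree V1 E1 r1 a" "rooted_tree V2 E2 r2 b"
    using Join.IH(1)[of V1] Join.IH(2)[of V2] V1(2) by blast
  then have "rooted_tree (V1 \<union> V2) (insert {r1, r2} (E1 \<union> E2)) r1 (Join a b)"
    by (rule rooted_tree_Join) (auto simp: V2_def)
  moreover have "V1 \<union> V2 = S" using V1(1) by (auto simp: V2_def)
  ultimately show ?case by blast
qed

lemma simple_universe_cases:
  assumes "simple (V, E)" "x \<in> incidence_universe (V, E)"
  obtains (vertex) a where "a \<in> V" "x = {a}" | (edge) "x \<in> E" "x \<subseteq> V" "card x = 2"
  using assms by (auto simp: incidence_universe_def simple_def)

lemma not_incident_outside:
  assumes "simple (V1, E1)" "simple (V2, E2)" "V1 \<inter> V2 = {}"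
    and "x \<in> incidence_universe (V1, E1)" "y \<in> incidence_universe (V2, E2)"
  shows "\<not> incident x y" "x \<noteq> y"
proof -
  have x: "x \<subseteq> V1" "x \<noteq> {}" using assms(1,4) by (auto elim!: simple_universe_cases)
  have y: "y \<subseteq> V2" using assms(2,5) by (auto elim!: simple_universe_cases)
  show "\<not> incident x y" "x \<noteq> y"
    using x y assms(3) by (auto simp: incident_def)
qed

text \<open>An edge is attached to a rooted tree in two steps. In the first one the new edge is added to the lower
tree and becomes its root; \<open>glued_join\<close> then adds the upper tree.\<close>

lemma glued_plant:
  assumes "simple (V2, E2)" "r1 \<notin> V2" "r2 \<in> V2"
  shows "glued (incidence_universe (V2, E2)) {{r2}} {{r1, r2}} {{r1, r2}}"
proof -
  have ne: "r1 \<noteq> r2" using assms by auto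
  have c: "incident x {r1, r2} \<longleftrightarrow> x = {r2}" and c': "\<not> incident {r1, r2} x" and c'': "x \<noteq> {r1, r2}"
    if "x \<in> incidence_universe (V2, E2)" for x
    using assms(1) that
    by (cases rule: simple_universe_cases; use ne assms(2) in \<open>auto simp: incident_def card_2_iff\<close>)+
  show ?thesis
    unfolding glued_def using c c' c'' assms(3) by (auto simp: incidence_universe_def)
qed

lemma glued_join:
  assumes "simple (V1, E1)" "simple (V2, E2)" "V1 \<inter> V2 = {}" "r1 \<in> V1" "r2 \<in> V2"
  shows "glued (incidence_universe (V1, E1)) {{r1}}
    (incidence_universe (V2, E2) \<union> {{r1, r2}}) {{r1, r2}}"
proof -
  have ne: "r1 \<noteq> r2" using assms by auto
  have c: "incident x {r1, r2} \<longleftrightarrow> x = {r1}" and c': "\<not> incident {r1, r2} x" and c'': "x \<noteq> {r1, r2}"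
    if "x \<in> incidence_universe (V1, E1)" for x
    using assms(1) that
    by (cases rule: simple_universe_cases; use ne assms(3-5) in \<open>auto simp: incident_def card_2_iff\<close>)+
  have e: "{r1, r2} \<notin> incidence_universe (V2, E2)"
  proof
    assume "{r1, r2} \<in> incidence_universe (V2, E2)"
    with assms(2) have "{r1, r2} \<subseteq> V2"
      by (rule simple_universe_cases) auto
    then show False using assms(3,4) by auto
  qed
  have d: "V2 \<inter> V1 = {}" using assms(3) by auto
  note o = not_incident_outside[OF assms(1-3)] not_incident_outside[OF assms(2,1) d]
  show ?thesis
    unfolding glued_def
  proof (intro conjI ballI)
    fix x y assume x: "x \<in> incidence_universe (V1, E1)"
      and y: "y \<in> incidence_universe (V2, E2) \<union> {{r1, r2}}"
    show "incident x y \<longleftrightarrow> x \<in> {{r1}} \<and> y \<in> {{r1, r2}}"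
      using y c[OF x] o(1)[OF x, of y] e by auto
    show "\<not> incident y x"
      using y c'[OF x] o(3)[OF _ x, of y] by auto
  next
    show "incidence_universe (V1, E1) \<inter> (incidence_universe (V2, E2) \<union> {{r1, r2}}) = {}"
      using o(2) c'' by auto
    show "{{r1}} \<subseteq> incidence_universe (V1, E1)"
      using assms(4) by (auto simp: incidence_universe_def)
  qed auto
qed

lemma mso_type_single_edge:
  fixes r1 r2 r1' r2' :: 'a
  assumes "r1 \<noteq> r2" "r1' \<noteq> r2'"
  shows "mso_type k {{r1, r2}} {{r1, r2}} [] = mso_type k {{r1', r2'}} {{r1', r2'}} []"
  by (rule mso_type_iso[where g = "\<lambda>_. {r1', r2'}"]) (use assms in \<open>auto simp: bij_betw_def incident_def\<close>)

text \<open>The type is a congruence for the joining of rooted trees, by two applications of \<open>mso_type_glued\<close>.\<close>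

lemma mso_type_join:
  fixes V1 V1' :: "'a set"
  assumes "simple (V1, E1)" "simple (V2, E2)" "V1 \<inter> V2 = {}" "r1 \<in> V1" "r2 \<in> V2"
    and "simple (V1', E1')" "simple (V2', E2')" "V1' \<inter> V2' = {}" "r1' \<in> V1'" "r2' \<in> V2'"
    and "mso_type k (incidence_universe (V1, E1)) {{r1}} [] =
      mso_type k (incidence_universe (V1', E1')) {{r1'}} []"
    and "mso_type k (incidence_universe (V2, E2)) {{r2}} [] =
      mso_type k (incidence_universe (V2', E2')) {{r2'}} []"
  shows "mso_type k (incidence_universe (V1 \<union> V2, insert {r1, r2} (E1 \<union> E2))) {{r1}} [] =
    mso_type k (incidence_universe (V1' \<union> V2', insert {r1', r2'} (E1' \<union> E2'))) {{r1'}} []"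
proof -
  have "mso_type k {{r1, r2}} {{r1, r2}} [] = mso_type k {{r1', r2'}} {{r1', r2'}} []"
    using assms by (intro mso_type_single_edge) auto
  moreover have "glued (incidence_universe (V2, E2)) {{r2}} {{r1, r2}} {{r1, r2}}"
    by (rule glued_plant) (use assms in auto)
  moreover have "glued (incidence_universe (V2', E2')) {{r2'}} {{r1', r2'}} {{r1', r2'}}"
    by (rule glued_plant) (use assms in auto)
  ultimately have "mso_type k (incidence_universe (V2, E2) \<union> {{r1, r2}})
        (select_roots False True {{r2}} {{r1, r2}}) [] =
      mso_type k (incidence_universe (V2', E2') \<union> {{r1', r2'}})
        (select_roots False True {{r2'}} {{r1', r2'}}) []"
    using assms(12) by (intro mso_type_glued) auto
  then have plant: "mso_type k (incidence_universe (V2, E2) \<union> {{r1, r2}}) {{r1, r2}} [] =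
      mso_type k (incidence_universe (V2', E2') \<union> {{r1', r2'}}) {{r1', r2'}} []"
    by (simp add: select_roots_def)
  from mso_type_glued[OF glued_join[OF assms(1-5)] glued_join[OF assms(6-10)] assms(11) this refl,
      of True False]
  show ?thesis by (simp add: select_roots_def incidence_universe_def Un_ac image_Un)
qed

text \<open>The isomorphism type of the tree is determined by its term; the induction on the term uses that the
type is a congruence.\<close>

lemma rooted_tree_type_unique:
  fixes V V' :: "'a set"
  assumes "rooted_tree V E r t" "rooted_tree V' E' r' t"
  shows "mso_type k (incidence_universe (V, E)) {{r}} [] = mso_type k (incidence_universe (V', E')) {{r'}} []"
  using assms
proof (induction t arbitrary: V E r V' E' r' rule: tree_term.induct)
  case Leaf
  from Leaf.prems have "V = {r}" "E = {}" "V' = {r'}" "E' = {}"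
    by (auto elim: rooted_tree.cases)
  then show ?case
    by (intro mso_type_iso[where g = "\<lambda>_. {r'}"])
      (auto simp: bij_betw_def incident_def incidence_universe_def)
next
  case (Join a b)
  from Join.prems(1) obtain V1 E1 V2 E2 r2 where t: "rooted_tree V1 E1 r a" "rooted_tree V2 E2 r2 b"
      "V1 \<inter> V2 = {}" and V: "V = V1 \<union> V2" "E = insert {r, r2} (E1 \<union> E2)"
    by (cases rule: rooted_tree.cases) auto
  from Join.prems(2) obtain V1' E1' V2' E2' r2' where t': "rooted_tree V1' E1' r' a" "rooted_tree V2' E2' r2' b"
      "V1' \<inter> V2' = {}" and V': "V' = V1' \<union> V2'" "E' = insert {r', r2'} (E1' \<union> E2')"
    by (cases rule: rooted_tree.cases) auto
  show ?case
    unfolding V V'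
    by (rule mso_type_join)
      (fact t(3) t'(3) t(1,2)[THEN rooted_tree_simple] t'(1,2)[THEN rooted_tree_simple]
        t(1,2)[THEN rooted_tree_root] t'(1,2)[THEN rooted_tree_root]
        Join.IH(1)[OF t(1) t'(1)] Join.IH(2)[OF t(2) t'(2)])+
qed

text \<open>All rooted trees with a given term have the same type by \<open>rooted_tree_type_unique\<close>, so the choice does
not matter.\<close>

definition rooted_type :: "nat \<Rightarrow> tree_term \<Rightarrow> nat" where
  "rooted_type k t = (SOME x. \<exists>(V :: nat set) E r. rooted_tree V E r t \<and>
     x = mso_type k (incidence_universe (V, E)) {{r}} [])"

definition tree_type :: "nat \<Rightarrow> tree_term \<Rightarrow> nat" where
  "tree_type k t = (SOME x. \<exists>(V :: nat set) E r. rooted_tree V E r t \<and>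
     x = mso_type k (incidence_universe (V, E)) {} [])"

lemma rooted_tree_type_forget:
  fixes V V' :: "'a set"
  assumes "rooted_tree V E r t" "rooted_tree V' E' r' t'"
    and "mso_type k (incidence_universe (V, E)) {{r}} [] = mso_type k (incidence_universe (V', E')) {{r'}} []"
  shows "mso_type k (incidence_universe (V, E)) {} [] = mso_type k (incidence_universe (V', E')) {} []"
  by (rule mso_type_forget_roots[OF assms(3)])
    (use assms(1,2)[THEN rooted_tree_root] in \<open>auto simp: incidence_universe_def\<close>)

lemma rooted_type_eq:
  fixes V :: "nat set"
  assumes "rooted_tree V E r t"
  shows "mso_type k (incidence_universe (V, E)) {{r}} [] = rooted_type k t"
proof -
  have "\<exists>x. \<exists>(V :: nat set) E r. rooted_tree V E r t \<and> x = mso_type k (incidence_universe (V, E)) {{r}} []"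
    using assms by blast
  from someI_ex[OF this] obtain V' :: "nat set" and E' r' where "rooted_tree V' E' r' t"
      "rooted_type k t = mso_type k (incidence_universe (V', E')) {{r'}} []"
    unfolding rooted_type_def by blast
  then show ?thesis using rooted_tree_type_unique[OF assms] by simp
qed

lemma tree_type_eq:
  fixes V :: "nat set"
  assumes "rooted_tree V E r t"
  shows "mso_type k (incidence_universe (V, E)) {} [] = tree_type k t"
proof -
  have "\<exists>x. \<exists>(V :: nat set) E r. rooted_tree V E r t \<and> x = mso_type k (incidence_universe (V, E)) {} []"
    using assms by blast
  from someI_ex[OF this] obtain V' :: "nat set" and E' r' where t: "rooted_tree V' E' r' t"
      "tree_type k t = mso_type k (incidence_universe (V', E')) {} []"
    unfolding tree_type_def by blast
  show ?thesis
    using rooted_tree_type_forget[OF assms t(1) rooted_tree_type_unique[OF assms t(1)]] t(2) by simp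
qed

lemma tree_term_realizable: "\<exists>(V :: nat set) E r. rooted_tree V E r t"
  using rooted_tree_exists[of "{..<nodes t}" t] by auto

lemma rooted_type_imp_tree_type:
  assumes "rooted_type k s = rooted_type k t"
  shows "tree_type k s = tree_type k t"
proof -
  obtain V :: "nat set" and E r where s: "rooted_tree V E r s" using tree_term_realizable by blast
  obtain V' :: "nat set" and E' r' where t: "rooted_tree V' E' r' t" using tree_term_realizable by blast
  show ?thesis
    using rooted_tree_type_forget[OF s t, of k] assms
    by (simp add: rooted_type_eq[OF s] rooted_type_eq[OF t] tree_type_eq[OF s] tree_type_eq[OF t])
qed

lemma rooted_type_cong:
  assumes "rooted_type k a = rooted_type k a'" "rooted_type k b = rooted_type k b'"
  shows "rooted_type k (Join a b) = rooted_type k (Join a' b')"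
proof -
  have ex: "\<exists>(V1 :: nat set) E1 r1 V2 E2 r2. rooted_tree V1 E1 r1 a \<and> rooted_tree V2 E2 r2 b \<and> V1 \<inter> V2 = {}" for a b
  proof -
    have "\<exists>E1 r1. rooted_tree {..<nodes a} E1 r1 a" by (rule rooted_tree_exists) auto
    moreover have "\<exists>E2 r2. rooted_tree {nodes a..<nodes a + nodes b} E2 r2 b"
      by (rule rooted_tree_exists) auto
    moreover have "{..<nodes a} \<inter> {nodes a..<nodes a + nodes b} = {}" by auto
    ultimately show ?thesis by blast
  qed
  obtain V1 V2 :: "nat set" and E1 r1 E2 r2 where
    t: "rooted_tree V1 E1 r1 a" "rooted_tree V2 E2 r2 b" and d: "V1 \<inter> V2 = {}" using ex by blast
  obtain V1' V2' :: "nat set" and E1' r1' E2' r2' where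
    t': "rooted_tree V1' E1' r1' a'" "rooted_tree V2' E2' r2' b'" and d': "V1' \<inter> V2' = {}" using ex by blast
  note e = t[THEN rooted_type_eq, of k] t'[THEN rooted_type_eq, of k]
  show ?thesis
    unfolding rooted_type_eq[OF rooted_tree_Join[OF t d], symmetric]
      rooted_type_eq[OF rooted_tree_Join[OF t' d'], symmetric]
    by (rule mso_type_join) (use t[THEN rooted_tree_simple] t'[THEN rooted_tree_simple]
      t[THEN rooted_tree_root] t'[THEN rooted_tree_root] d d' assms e in simp_all)
qed

lemma finite_range_rooted_type: "finite (range (rooted_type k))"
proof (rule finite_subset[OF _ finite_mso_types[of k 0]])
  show "range (rooted_type k) \<subseteq> mso_types TYPE(nat) k 0"
  proof
    fix x assume "x \<in> range (rooted_type k)"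
    then obtain t where x: "x = rooted_type k t" by blast
    obtain V :: "nat set" and E r where "rooted_tree V E r t" using tree_term_realizable by blast
    then show "x \<in> mso_types TYPE(nat) k 0"
      using mso_type_in_types[of k "incidence_universe (V, E)" "{{r}}" "[]"]
      by (simp add: x rooted_type_eq)
  qed
qed

lemma finite_range_tree_type: "finite (range (tree_type k))"
proof (rule finite_subset[OF _ finite_mso_types[of k 0]])
  show "range (tree_type k) \<subseteq> mso_types TYPE(nat) k 0"
  proof
    fix x assume "x \<in> range (tree_type k)"
    then obtain t where x: "x = tree_type k t" by blast
    obtain V :: "nat set" and E r where "rooted_tree V E r t" using tree_term_realizable by blast
    then show "x \<in> mso_types TYPE(nat) k 0"
      using mso_type_in_types[of k "incidence_universe (V, E)" "{}" "[]"]
      by (simp add: x tree_type_eq)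
  qed
qed

section \<open>Pumping trees\<close>
text \<open>A term with one hole, together with the number of nodes that it contributes.\<close>

inductive tree_context :: "(tree_term \<Rightarrow> tree_term) \<Rightarrow> nat \<Rightarrow> bool" where
  hole: "tree_context (\<lambda>x. x) 0"
| left: "tree_context C d \<Longrightarrow> tree_context (\<lambda>x. Join (C x) b) (d + nodes b)"
| right: "tree_context C d \<Longrightarrow> tree_context (\<lambda>x. Join b (C x)) (d + nodes b)"

lemma nodes_context: "tree_context C d \<Longrightarrow> nodes (C t) = nodes t + d"
  by (induction rule: tree_context.induct) auto

lemma context_compose: "tree_context C d \<Longrightarrow> tree_context D e \<Longrightarrow> tree_context (\<lambda>x. C (D x)) (d + e)"
proof (induction rule: tree_context.induct)
  case hole then show ?case by simp
next
  case (left C d b) then show ?case using tree_context.left[of "\<lambda>x. C (D x)" "d + e" b] by (simp add: ac_simps)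
next
  case (right C d b) then show ?case using tree_context.right[of "\<lambda>x. C (D x)" "d + e" b] by (simp add: ac_simps)
qed

lemma context_cong:
  assumes "\<And>a a' b b'. h a = h a' \<Longrightarrow> h b = h b' \<Longrightarrow> h (Join a b) = h (Join a' b')"
  shows "tree_context C d \<Longrightarrow> h s = h t \<Longrightarrow> h (C s) = h (C t)"
  by (induction rule: tree_context.induct) (auto intro: assms)

definition subtrees :: "tree_term \<Rightarrow> tree_term set" where
  "subtrees t = {s. \<exists>C d. tree_context C d \<and> t = C s}"

text \<open>The subterm \<open>D s\<close> and its proper subterm \<open>s\<close> have the same value, so the layer \<open>D\<close> between them can be
repeated.\<close>

definition pumpable :: "(tree_term \<Rightarrow> 'b) \<Rightarrow> tree_term \<Rightarrow> bool" where
  "pumpable h t \<longleftrightarrow> (\<exists>C c D d s. tree_context C c \<and> tree_context D d \<and> 0 < d \<and> t = C (D s) \<and> h (D s) = h s)"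

text \<open>Passing to the larger argument of \<open>Join\<close> loses at most half of the nodes, so a term with \<open>2 ^ n\<close> nodes
has a branch of length \<open>n\<close>. If no value is repeated along it, then \<open>n + 1\<close> values occur.\<close>

lemma pumpable_or_many_values:
  assumes "finite (range h)" "2 ^ n \<le> nodes t"
  shows "pumpable h t \<or> Suc n \<le> card (h ` subtrees t)"
  using assms(2)
proof (induction n arbitrary: t)
  case 0
  have "t \<in> subtrees t" using tree_context.hole by (auto simp: subtrees_def)
  moreover have "finite (h ` subtrees t)" by (rule finite_subset[OF _ assms(1)]) auto
  ultimately have "0 < card (h ` subtrees t)" by (auto simp: card_gt_0_iff)
  then show ?case by simp
next
  case (Suc n)
  have "1 < (2 :: nat) ^ Suc n" by (rule one_less_power) auto
  then have "1 < nodes t" using Suc.prems by linarith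
  then obtain a b where t: "t = Join a b" by (cases t) auto
  obtain u C where C: "tree_context C (nodes t - nodes u)" "t = C u" "nodes u < nodes t" "2 ^ n \<le> nodes u"
  proof (cases "2 ^ n \<le> nodes a")
    case True
    show ?thesis
      by (rule that[of "\<lambda>x. Join x b" a]) (use True t tree_context.left[OF hole, of b] nodes_pos in auto)
  next
    case False
    then have "2 ^ n \<le> nodes b" using Suc.prems t by auto
    then show ?thesis
      by (intro that[of "\<lambda>x. Join a x" b]) (use t tree_context.right[OF hole, of a] nodes_pos in auto)
  qed
  have sub: "subtrees u \<subseteq> subtrees t"
  proof
    fix s assume "s \<in> subtrees u"
    then obtain D d where "tree_context D d" "u = D s" by (auto simp: subtrees_def)
    then show "s \<in> subtrees t"
      using context_compose[OF C(1)] C(2) unfolding subtrees_def by blast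
  qed
  have tt: "t \<in> subtrees t" using tree_context.hole by (auto simp: subtrees_def)
  have fin: "finite (h ` subtrees t)" "finite (h ` subtrees u)"
    by (rule finite_subset[OF _ assms(1)], blast)+
  consider "pumpable h u" | "Suc n \<le> card (h ` subtrees u)" using Suc.IH[OF C(4)] by blast
  then show ?case
  proof cases
    case 1
    then obtain C' c D d s where D: "tree_context C' c" "tree_context D d" "0 < d" "u = C' (D s)" "h (D s) = h s"
      unfolding pumpable_def by blast
    have "t = (\<lambda>x. C (C' x)) (D s)" using C(2) D(4) by simp
    with context_compose[OF C(1) D(1)] D show ?thesis unfolding pumpable_def by blast
  next
    case 2
    show ?thesis
    proof (cases "h t \<in> h ` subtrees u")
      case True
      then obtain s D d where s: "tree_context D d" "u = D s" "h t = h s" by (auto simp: subtrees_def)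
      have "tree_context (\<lambda>x. C (D x)) (nodes t - nodes u + d)" by (rule context_compose[OF C(1) s(1)])
      moreover have "0 < nodes t - nodes u + d" using C(3) by simp
      moreover have "t = (\<lambda>x. x) ((\<lambda>x. C (D x)) s)" "h ((\<lambda>x. C (D x)) s) = h s" using C(2) s by simp_all
      ultimately show ?thesis unfolding pumpable_def using tree_context.hole by blast
    next
      case False
      have "Suc (card (h ` subtrees u)) = card (insert (h t) (h ` subtrees u))"
        using False fin by simp
      also have "\<dots> \<le> card (h ` subtrees t)"
        by (rule card_mono) (use fin sub tt in auto)
      finally show ?thesis using 2 by simp
    qed
  qed
qed

text \<open>Repeating the layer between two subterms of equal value leaves the value unchanged and increases the
number of nodes by a constant step.\<close>

lemma pumping:
  assumes fin: "finite (range h)"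
    and cong: "\<And>a a' b b'. h a = h a' \<Longrightarrow> h b = h b' \<Longrightarrow> h (Join a b) = h (Join a' b')"
    and large: "2 ^ card (range h) \<le> nodes t"
  shows "\<exists>b. \<forall>m. \<exists>s. h s = h t \<and> m \<le> nodes s \<and> nodes s \<le> m + b"
proof -
  have "card (h ` subtrees t) \<le> card (range h)" by (rule card_mono[OF fin]) auto
  then have "pumpable h t" using pumpable_or_many_values[OF fin large] by auto
  then obtain C c D d s where D: "tree_context C c" "tree_context D d" "0 < d" "t = C (D s)" "h (D s) = h s"
    unfolding pumpable_def by blast
  have pow: "h ((D ^^ i) s) = h s \<and> nodes ((D ^^ i) s) = nodes s + i * d" for i
  proof (induction i)
    case (Suc i)
    have "h (D ((D ^^ i) s)) = h (D s)" by (rule context_cong[where h = h, OF _ D(2)], rule cong, assumption+) (use Suc in simp)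
    then show ?case using Suc D(5) by (simp add: nodes_context[OF D(2)])
  qed simp
  have C: "h (C ((D ^^ i) s)) = h t \<and> nodes (C ((D ^^ i) s)) = nodes s + i * d + c" for i
  proof -
    have "h (C ((D ^^ i) s)) = h (C (D s))"
      by (rule context_cong[where h = h, OF _ D(1)], rule cong, assumption+) (use pow[of i] D(5) in simp)
    then show ?thesis using D(4) pow[of i] by (simp add: nodes_context[OF D(1)])
  qed
  have "\<exists>s'. h s' = h t \<and> m \<le> nodes s' \<and> nodes s' \<le> m + (nodes s + d + c)" for m
  proof (intro exI conjI)
    \<comment> \<open>so many repetitions that the layer alone contributes between \<open>m\<close> and \<open>m + d\<close> nodes\<close>
    let ?i = "Suc (m div d)"
    show "h (C ((D ^^ ?i) s)) = h t" using C by blast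
    have "m div d * d \<le> m" by simp
    moreover have "m \<le> Suc (m div d) * d"
    proof -
      have "m mod d < d" using D(3) by simp
      then show ?thesis using div_mult_mod_eq[of m d] unfolding mult_Suc by linarith
    qed
    moreover have "nodes (C ((D ^^ ?i) s)) = nodes s + Suc (m div d) * d + c" using C by blast
    ultimately show "m \<le> nodes (C ((D ^^ ?i) s))"
      "nodes (C ((D ^^ ?i) s)) \<le> m + (nodes s + d + c)" by simp_all
  qed
  then show ?thesis by blast
qed

text \<open>The types of arbitrarily large trees. With probability tending to one they are the types of the
components that survive the pruning.\<close>

definition unbounded_types :: "nat \<Rightarrow> nat set" where
  "unbounded_types k = {\<tau>. \<forall>m. \<exists>t. m \<le> nodes t \<and> tree_type k t = \<tau>}"

lemma finite_unbounded_types: "finite (unbounded_types k)"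
  by (rule finite_subset[OF _ finite_range_tree_type[of k]]) (auto simp: unbounded_types_def)

text \<open>Pumping applies to types of rooted trees, because these are a congruence. The type of a tree without
its root is a function of the rooted one, and it is enough to pump one large tree.\<close>

lemma unbounded_type_dense:
  assumes "\<tau> \<in> unbounded_types k"
  shows "\<exists>b. \<forall>m. \<exists>t. tree_type k t = \<tau> \<and> m \<le> nodes t \<and> nodes t \<le> m + b"
proof -
  obtain t where t: "2 ^ card (range (rooted_type k)) \<le> nodes t" "tree_type k t = \<tau>"
    using assms by (auto simp: unbounded_types_def)
  obtain b where "\<forall>m. \<exists>s. rooted_type k s = rooted_type k t \<and> m \<le> nodes s \<and> nodes s \<le> m + b"
    using pumping[of "rooted_type k", OF finite_range_rooted_type rooted_type_cong t(1)] by blast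
  then show ?thesis using rooted_type_imp_tree_type t(2) by metis
qed

text \<open>There are only finitely many types, so the size bounds for the remaining types have a maximum.\<close>

lemma bounded_types_bound:
  "\<exists>M. \<forall>t. M \<le> nodes t \<longrightarrow> tree_type k t \<in> unbounded_types k"
proof -
  have "\<forall>\<tau>\<in>range (tree_type k) - unbounded_types k. \<exists>m. \<forall>t. m \<le> nodes t \<longrightarrow> tree_type k t \<noteq> \<tau>"
    by (auto simp: unbounded_types_def)
  then obtain m where m: "\<And>\<tau> t. \<tau> \<in> range (tree_type k) - unbounded_types k \<Longrightarrow> m \<tau> \<le> nodes t \<Longrightarrow> tree_type k t \<noteq> \<tau>"
    by metis
  have "tree_type k t \<in> unbounded_types k" if "Max (insert 0 (m ` range (tree_type k))) \<le> nodes t" for t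
  proof (rule ccontr)
    assume "tree_type k t \<notin> unbounded_types k"
    moreover have "m (tree_type k t) \<le> Max (insert 0 (m ` range (tree_type k)))"
      by (rule Max_ge) (auto simp: finite_range_tree_type)
    ultimately show False using m[of "tree_type k t" t] that by auto
  qed
  then show ?thesis by blast
qed

section \<open>Components of a forest\<close>

abbreviation adjacency :: "'a set set \<Rightarrow> ('a \<times> 'a) set" where
  "adjacency E \<equiv> {(x, y). {x, y} \<in> E}"

abbreviation walk :: "'a set set \<Rightarrow> 'a list \<Rightarrow> bool" where
  "walk E \<equiv> successively (\<lambda>x y. {x, y} \<in> E)"

definition cycle :: "'a set set \<Rightarrow> 'a list \<Rightarrow> bool" where
  "cycle E xs \<longleftrightarrow> 3 \<le> length xs \<and> distinct xs \<and> walk E xs \<and> {hd xs, last xs} \<in> E"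

lemma reachable_imp_path:
  assumes "(u, v) \<in> (adjacency E)\<^sup>*"
  shows "\<exists>xs. xs \<noteq> [] \<and> hd xs = u \<and> last xs = v \<and> distinct xs \<and> walk E xs"
  using assms
proof (induction rule: rtrancl_induct)
  case base
  show ?case by (rule exI[of _ "[u]"]) simp
next
  case (step y z)
  then obtain xs where xs: "xs \<noteq> []" "hd xs = u" "last xs = y" "distinct xs" "walk E xs" by blast
  show ?case
  proof (cases "z \<in> set xs")
    case True
    then obtain ys zs where "xs = (ys @ [z]) @ zs" by (auto dest: split_list)
    then show ?thesis
      using xs by (intro exI[of _ "ys @ [z]"]) (auto simp: successively_append_iff hd_append split: if_splits)
  next
    case False
    then show ?thesis
      using xs step.hyps(2) by (intro exI[of _ "xs @ [z]"]) (auto simp: successively_append_iff)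
  qed
qed

lemma adjacency_sym: "sym ((adjacency E)\<^sup>*)"
  by (rule sym_rtrancl) (auto simp: sym_def insert_commute)

lemma adjacency_mono: "E' \<subseteq> E \<Longrightarrow> (adjacency E')\<^sup>* \<subseteq> (adjacency E)\<^sup>*"
  by (rule rtrancl_mono) auto

lemma walk_mono: "E' \<subseteq> E \<Longrightarrow> walk E' xs \<Longrightarrow> walk E xs"
  by (erule successively_mono) auto

lemma reachable_in_verts:
  assumes "simple G" "(u, v) \<in> (adjacency (edges G))\<^sup>*" "u \<in> verts G"
  shows "v \<in> verts G"
  using assms(2,3)
proof (induction rule: rtrancl_induct)
  case (step y z)
  then show ?case using assms(1) by (auto simp: simple_def)
qed

text \<open>Induction on the number of edges. If the edge \<open>{r, s}\<close> at the root is removed, then \<open>r\<close> and \<open>s\<close> lie in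
different components, because a path between them would form a cycle together with that edge. These
two components are trees, and the component of \<open>r\<close> is their join.\<close>

lemma forest_component_is_tree:
  assumes "finite E" "simple (V, E)" "\<And>xs. \<not> cycle E xs" "r \<in> V"
  shows "\<exists>t. rooted_tree (component (V, E) r) {e \<in> E. e \<subseteq> component (V, E) r} r t"
  using assms
proof (induction "card E" arbitrary: E r rule: less_induct)
  case less
  note simple = less.prems(2) and nocyc = less.prems(3)
  show ?case
  proof (cases "\<exists>s. {r, s} \<in> E")
    case False
    have "(r, w) \<in> (adjacency E)\<^sup>* \<Longrightarrow> w = r" for w
      by (induction rule: rtrancl_induct) (use False in auto)
    then have C: "component (V, E) r = {r}" using less.prems(4) by (auto simp: component_def)
    have "\<not> e \<subseteq> {r}" if "e \<in> E" for e
      using simple that by (auto simp: simple_def subset_singleton_iff)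
    then have E: "{e \<in> E. e \<subseteq> {r}} = {}" by blast
    show ?thesis unfolding C E using rooted_tree_Leaf[of r] by blast
  next
    case True
    then obtain s where e: "{r, s} \<in> E" by blast
    have s: "s \<in> V" "r \<noteq> s" using e simple by (auto simp: simple_def)
    define E' where "E' = E - {{r, s}}"
    have E'E: "E' \<subseteq> E" by (auto simp: E'_def)
    have fin': "finite E'" using less.prems(1) by (simp add: E'_def)
    have smaller: "card E' < card E" unfolding E'_def by (rule card_Diff1_less[OF less.prems(1) e])
    have simple': "simple (V, E')" using simple E'E by (auto simp: simple_def)
    have nocyc': "\<not> cycle E' xs" for xs
      using nocyc[of xs] walk_mono[OF E'E] E'E by (auto simp: cycle_def)
    define C1 where "C1 = component (V, E') r"
    define C2 where "C2 = component (V, E') s"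
    obtain t1 where t1: "rooted_tree C1 {e \<in> E'. e \<subseteq> C1} r t1"
      using less.hyps[OF smaller fin' simple' nocyc' less.prems(4)] by (auto simp: C1_def)
    obtain t2 where t2: "rooted_tree C2 {e \<in> E'. e \<subseteq> C2} s t2"
      using less.hyps[OF smaller fin' simple' nocyc' s(1)] by (auto simp: C2_def)
    have in1: "w \<in> C1 \<longleftrightarrow> (r, w) \<in> (adjacency E')\<^sup>*" for w
      using reachable_in_verts[OF simple', of r w] less.prems(4) by (auto simp: C1_def component_def)
    have in2: "w \<in> C2 \<longleftrightarrow> (s, w) \<in> (adjacency E')\<^sup>*" for w
      using reachable_in_verts[OF simple', of s w] s(1) by (auto simp: C2_def component_def)
    have inC: "w \<in> component (V, E) r \<longleftrightarrow> (r, w) \<in> (adjacency E)\<^sup>*" for w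
      using reachable_in_verts[OF simple, of r w] less.prems(4) by (auto simp: component_def)
    have "(r, s) \<notin> (adjacency E')\<^sup>*"
    proof
      assume "(r, s) \<in> (adjacency E')\<^sup>*"
      then obtain xs where xs: "xs \<noteq> []" "hd xs = r" "last xs = s" "distinct xs" "walk E' xs"
        using reachable_imp_path by metis
      have "3 \<le> length xs"
      proof (rule ccontr)
        assume "\<not> 3 \<le> length xs"
        moreover have "length xs \<noteq> 0" using xs(1) by simp
        ultimately consider "length xs = 1" | "length xs = 2" by linarith
        then show False
        proof cases
          case 1
          then show False using xs s(2) by (auto simp: length_Suc_conv)
        next
          case 2
          then obtain x y where "xs = [x, y]" by (auto simp: numeral_2_eq_2 length_Suc_conv)
          then show False using xs by (auto simp: E'_def)
        qed
      qed
      then have "cycle E xs" using xs e walk_mono[OF E'E xs(5)] by (simp add: cycle_def)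
      then show False using nocyc by blast
    qed
    then have disj: "C1 \<inter> C2 = {}"
      using in1 in2 symD[OF adjacency_sym[of E'], of s] rtrancl_trans[of r _ "adjacency E'" s] by blast
    have C: "component (V, E) r = C1 \<union> C2"
    proof
      show "C1 \<union> C2 \<subseteq> component (V, E) r"
      proof
        fix w assume "w \<in> C1 \<union> C2"
        then have "(r, w) \<in> (adjacency E)\<^sup>* \<or> (s, w) \<in> (adjacency E)\<^sup>*"
          using in1 in2 adjacency_mono[OF E'E] by blast
        moreover have "(r, s) \<in> (adjacency E)\<^sup>*" using e by auto
        ultimately show "w \<in> component (V, E) r" using inC rtrancl_trans[of r s _ w] by blast
      qed
      show "component (V, E) r \<subseteq> C1 \<union> C2"
      proof
        fix w assume "w \<in> component (V, E) r"
        then have "(r, w) \<in> (adjacency E)\<^sup>*" using inC by blast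
        then show "w \<in> C1 \<union> C2"
        proof (induction rule: rtrancl_induct)
          case base
          show ?case using in1 by auto
        next
          case (step y z)
          show ?case
          proof (cases "{y, z} = {r, s}")
            case True
            then have "z = r \<or> z = s" by (auto simp: doubleton_eq_iff)
            then show ?thesis using in1[of r] in2[of s] by auto
          next
            case False
            then have "(y, z) \<in> adjacency E'" using step.hyps(2) by (simp add: E'_def)
            then have "(x, y) \<in> (adjacency E')\<^sup>* \<Longrightarrow> (x, z) \<in> (adjacency E')\<^sup>*" for x
              by (rule rtrancl.rtrancl_into_rtrancl[rotated])
            then show ?thesis using step.IH in1[of y] in1[of z] in2[of y] in2[of z] by blast
          qed
        qed
      qed
    qed
    have closed: "b \<in> C1 \<longleftrightarrow> a \<in> C1" "b \<in> C2 \<longleftrightarrow> a \<in> C2" if "{a, b} \<in> E'" for a b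
    proof -
      have "(a, b) \<in> adjacency E'" "(b, a) \<in> adjacency E'" using that by (auto simp: insert_commute)
      then have "(x, a) \<in> (adjacency E')\<^sup>* \<longleftrightarrow> (x, b) \<in> (adjacency E')\<^sup>*" for x
        using rtrancl.rtrancl_into_rtrancl[of x a "adjacency E'" b]
          rtrancl.rtrancl_into_rtrancl[of x b "adjacency E'" a] by blast
      then show "b \<in> C1 \<longleftrightarrow> a \<in> C1" "b \<in> C2 \<longleftrightarrow> a \<in> C2"
        unfolding in1 in2 by simp_all
    qed
    have "{e \<in> E. e \<subseteq> C1 \<union> C2} = insert {r, s} ({e \<in> E'. e \<subseteq> C1} \<union> {e \<in> E'. e \<subseteq> C2})"
    proof (intro equalityI subsetI)
      fix x assume x: "x \<in> {e \<in> E. e \<subseteq> C1 \<union> C2}"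
      show "x \<in> insert {r, s} ({e \<in> E'. e \<subseteq> C1} \<union> {e \<in> E'. e \<subseteq> C2})"
      proof (cases "x = {r, s}")
        case False
        then have x': "x \<in> E'" using x by (simp add: E'_def)
        then have "card x = 2" using simple' by (simp add: simple_def)
        then obtain a b where ab: "x = {a, b}" by (auto simp: card_2_iff)
        then show ?thesis using closed[of a b] x x' by auto
      qed simp
    next
      fix x assume "x \<in> insert {r, s} ({e \<in> E'. e \<subseteq> C1} \<union> {e \<in> E'. e \<subseteq> C2})"
      then show "x \<in> {e \<in> E. e \<subseteq> C1 \<union> C2}"
        using e E'E in1[of r] in2[of s] by auto
    qed
    then show ?thesis
      unfolding C using rooted_tree_Join[OF t1 t2 disj] by auto
  qed
qed

section \<open>Graphs with the same types of components\<close>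

definition large_components :: "nat \<Rightarrow> 'a ugraph \<Rightarrow> 'a set set" where
  "large_components m G = {C. \<exists>v\<in>verts G. C = component G v \<and> m \<le> card C}"

text \<open>The part of the incidence universe that belongs to a component.\<close>

definition block :: "'a ugraph \<Rightarrow> 'a set \<Rightarrow> 'a set set" where
  "block G C = incidence_universe (induced_subgraph G C)"

lemma component_eq:
  assumes "w \<in> component G v"
  shows "component G w = component G v"
proof -
  have vw: "(v, w) \<in> (adjacency (edges G))\<^sup>*" using assms by (simp add: component_def)
  have wv: "(w, v) \<in> (adjacency (edges G))\<^sup>*" by (rule symD[OF adjacency_sym vw])
  have "(w, u) \<in> (adjacency (edges G))\<^sup>* \<longleftrightarrow> (v, u) \<in> (adjacency (edges G))\<^sup>*" for u
    using rtrancl_trans[OF vw, of u] rtrancl_trans[OF wv, of u] by blast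
  then show ?thesis by (simp add: component_def)
qed

lemma component_refl: "v \<in> verts G \<Longrightarrow> v \<in> component G v"
  by (simp add: component_def)

lemma component_subset: "component G v \<subseteq> verts G"
  by (auto simp: component_def)

lemma edge_within_component:
  assumes "simple G" "e \<in> edges G" "a \<in> e"
  shows "e \<subseteq> component G a"
proof
  fix b assume b: "b \<in> e"
  have e: "e \<subseteq> verts G" "card e = 2" using assms by (auto simp: simple_def)
  show "b \<in> component G a"
  proof (cases "a = b")
    case True
    then show ?thesis using e b component_refl[of b G] by blast
  next
    case False
    then have "e = {a, b}" using e(2) assms(3) b False by (auto simp: card_2_iff)
    then have "(a, b) \<in> adjacency (edges G)" using assms(2) by simp
    then show ?thesis using e b by (auto simp: component_def)
  qed
qed

lemma large_component_eq:
  assumes "C \<in> large_components m G" "w \<in> C"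
  shows "component G w = C"
proof -
  obtain v where "C = component G v" using assms(1) by (auto simp: large_components_def)
  then show ?thesis using component_eq[of w G v] assms(2) by simp
qed

lemma large_components_disjoint:
  assumes "C \<in> large_components m G" "C' \<in> large_components m G" "C \<noteq> C'"
  shows "C \<inter> C' = {}"
proof (rule ccontr)
  assume "C \<inter> C' \<noteq> {}"
  then obtain w where "w \<in> C" "w \<in> C'" by blast
  with large_component_eq[OF assms(1), of w] large_component_eq[OF assms(2), of w] assms(3)
  show False by simp
qed

lemma simple_induced: "simple G \<Longrightarrow> simple (induced_subgraph G S)"
  by (auto simp: simple_def induced_subgraph_def)

lemma simple_prune: "simple G \<Longrightarrow> simple (prune m G)"
  unfolding prune_def by (rule simple_induced)

text \<open>An edge never leaves a component, so it survives the pruning together with its component.\<close>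

lemma universe_prune:
  assumes "simple G"
  shows "incidence_universe (prune m G) = \<Union>(block G ` large_components m G)"
proof -
  define W where "W = {v \<in> verts G. m \<le> card (component G v)}"
  have prune: "prune m G = (W, {e \<in> edges G. e \<subseteq> W})"
    by (simp add: prune_def induced_subgraph_def W_def)
  have C: "C \<subseteq> W" if "C \<in> large_components m G" for C
    using that component_subset[of G] by (auto simp: large_components_def W_def component_eq)
  have W: "component G v \<in> large_components m G" if "v \<in> W" for v
    using that by (auto simp: large_components_def W_def)
  show ?thesis
  proof (intro equalityI subsetI)
    fix x assume "x \<in> incidence_universe (prune m G)"
    then consider a where "a \<in> W" "x = {a}" | "x \<in> edges G" "x \<subseteq> W"
      unfolding prune incidence_universe_def by auto
    then show "x \<in> \<Union>(block G ` large_components m G)"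
    proof cases
      case 1
      then have "a \<in> component G a" using component_refl[of a G] by (simp add: W_def)
      then show ?thesis
        using W[OF 1(1)] 1 by (auto simp: block_def incidence_universe_def induced_subgraph_def)
    next
      case 2
      then have "card x = 2" using assms by (simp add: simple_def)
      then obtain a where a: "a \<in> x" by (auto simp: card_2_iff)
      then have "x \<in> block G (component G a)"
        using edge_within_component[OF assms 2(1) a] 2
        by (auto simp: block_def incidence_universe_def induced_subgraph_def)
      then show ?thesis using W[of a] a 2 by blast
    qed
  next
    fix x assume "x \<in> \<Union>(block G ` large_components m G)"
    then obtain C where "C \<in> large_components m G" "x \<in> block G C" by blast
    then show "x \<in> incidence_universe (prune m G)"
      using C[of C] unfolding prune
      by (auto simp: block_def incidence_universe_def induced_subgraph_def)
  qed
qed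

lemma large_component_nonempty:
  assumes "C \<in> large_components m G"
  shows "C \<noteq> {}" "C \<subseteq> verts G"
proof -
  obtain v where "v \<in> verts G" "C = component G v" using assms by (auto simp: large_components_def)
  then show "C \<noteq> {}" "C \<subseteq> verts G" using component_refl[of v G] component_subset[of G v] by (simp_all only:) blast
qed

lemma block_nonempty: "C \<noteq> {} \<Longrightarrow> block G C \<noteq> {}"
  by (auto simp: block_def incidence_universe_def induced_subgraph_def)

lemma block_not_incident:
  assumes "simple G" "C \<inter> C' = {}" "x \<in> block G C" "y \<in> block G C'"
  shows "\<not> incident x y" "x \<noteq> y"
proof -
  note simple = simple_induced[OF assms(1), unfolded induced_subgraph_def]
  note xy = assms(3,4)[unfolded block_def induced_subgraph_def]
  show "\<not> incident x y" by (rule not_incident_outside(1)[OF simple simple assms(2) xy])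
  show "x \<noteq> y" by (rule not_incident_outside(2)[OF simple simple assms(2) xy])
qed

lemma blocks_separated:
  assumes "simple G"
  shows "separated (block G ` large_components m G)"
  unfolding separated_def
proof (intro ballI impI)
  fix B B' assume "B \<in> block G ` large_components m G" "B' \<in> block G ` large_components m G" "B \<noteq> B'"
  then obtain C C' where C: "C \<in> large_components m G" "C' \<in> large_components m G" "C \<noteq> C'"
      "B = block G C" "B' = block G C'" by blast
  note ni = block_not_incident[OF assms large_components_disjoint[OF C(1-3)]]
  show "B \<inter> B' = {} \<and> (\<forall>x\<in>B. \<forall>y\<in>B'. \<not> incident x y)"
    using ni unfolding C(4,5) by blast
qed

lemma inj_on_block:
  assumes "simple G"
  shows "inj_on (block G) (large_components m G)"
proof (rule inj_onI, rule ccontr)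
  fix C C' assume C: "C \<in> large_components m G" "C' \<in> large_components m G" "block G C = block G C'" "C \<noteq> C'"
  have "block G C \<noteq> {}" by (rule block_nonempty[OF large_component_nonempty(1)[OF C(1)]])
  then obtain x where "x \<in> block G C" by blast
  then show False
    using block_not_incident(2)[OF assms large_components_disjoint[OF C(1,2,4)], of x x] C(3) by simp
qed

lemma finite_large_components: "finite (verts G) \<Longrightarrow> finite (large_components m G)"
  by (rule finite_subset[of _ "Pow (verts G)"]) (auto dest: large_component_nonempty(2))

definition saturated :: "nat \<Rightarrow> nat set \<Rightarrow> nat \<Rightarrow> 'a set set set \<Rightarrow> bool" where
  "saturated k T K \<B> \<longleftrightarrow> (\<forall>B\<in>\<B>. mso_type k B {} [] \<in> T) \<and>
     (\<forall>\<tau>\<in>T. K \<le> card {B \<in> \<B>. mso_type k B {} [] = \<tau>})"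

text \<open>The threshold property of \<open>mso_type_absorb\<close> for structures without parameters.\<close>

definition absorbing :: "'a itself \<Rightarrow> nat \<Rightarrow> nat \<Rightarrow> bool" where
  "absorbing _ k K \<longleftrightarrow> (\<forall>\<B> (C :: 'a set set). finite \<B> \<longrightarrow> separated (insert C \<B>) \<longrightarrow> C \<notin> \<B> \<longrightarrow>
     K \<le> card {B \<in> \<B>. mso_type k B {} [] = mso_type k C {} []} \<longrightarrow>
     mso_type k (\<Union>(insert C \<B>)) {} [] = mso_type k (\<Union>\<B>) {} [])"

lemma absorbing_exists: "\<exists>K. absorbing TYPE('a) k K"
proof -
  obtain K where "\<forall>\<B> C (Ps :: 'a set set list). finite \<B> \<longrightarrow> length Ps = 0 \<longrightarrow> separated (insert C \<B>) \<longrightarrow> C \<notin> \<B> \<longrightarrow>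
      K \<le> card {B \<in> \<B>. mso_type k B {} Ps = mso_type k C {} Ps} \<longrightarrow>
      mso_type k (\<Union>(insert C \<B>)) {} Ps = mso_type k (\<Union>\<B>) {} Ps"
    using mso_type_absorb[of 0 k] by blast
  then have "absorbing TYPE('a) k K" unfolding absorbing_def by simp
  then show ?thesis by blast
qed

lemma saturated_absorbs:
  fixes \<B> :: "'a set set set"
  assumes K: "absorbing TYPE('a) k K" and fin: "finite \<B>" and sat: "saturated k T K \<B>"
    and "finite \<C>" "separated (\<B> \<union> \<C>)" "\<B> \<inter> \<C> = {}" "\<And>C. C \<in> \<C> \<Longrightarrow> mso_type k C {} [] \<in> T"
  shows "mso_type k (\<Union>(\<B> \<union> \<C>)) {} [] = mso_type k (\<Union>\<B>) {} []"
  using assms(4-7)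
proof (induction \<C> rule: finite_induct)
  case (insert C \<C>)
  have "mso_type k (\<Union>(insert C (\<B> \<union> \<C>))) {} [] = mso_type k (\<Union>(\<B> \<union> \<C>)) {} []"
  proof (rule K[unfolded absorbing_def, rule_format])
    show "finite (\<B> \<union> \<C>)" using fin insert.hyps by simp
    show "separated (insert C (\<B> \<union> \<C>))" using insert.prems(1) by simp
    show "C \<notin> \<B> \<union> \<C>" using insert.hyps insert.prems(2) by auto
    have "K \<le> card {B \<in> \<B>. mso_type k B {} [] = mso_type k C {} []}"
      using sat insert.prems(3) by (simp add: saturated_def)
    also have "\<dots> \<le> card {B \<in> \<B> \<union> \<C>. mso_type k B {} [] = mso_type k C {} []}"
      by (rule card_mono) (use fin insert.hyps in auto)
    finally show "K \<le> card {B \<in> \<B> \<union> \<C>. mso_type k B {} [] = mso_type k C {} []}" .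
  qed
  moreover have "mso_type k (\<Union>(\<B> \<union> \<C>)) {} [] = mso_type k (\<Union>\<B>) {} []"
    by (rule insert.IH) (use insert.prems separated_subset in auto)
  ultimately show ?case by simp
qed simp

lemma incident_image:
  assumes "inj h"
  shows "incident (h ` x) (h ` y) \<longleftrightarrow> incident x y"
  using assms by (simp add: incident_def card_image inj_on_subset inj_image_subset_iff)

lemma mso_type_image:
  assumes "inj (h :: 'a \<Rightarrow> 'a)"
  shows "mso_type k ((`) h ` B) {} [] = mso_type k B {} []"
proof (rule mso_type_iso[symmetric, where g = "(`) h"])
  show "bij_betw ((`) h) B ((`) h ` B)"
    using assms by (auto simp: bij_betw_def inj_on_def inj_image_eq_iff)
qed (use assms in \<open>simp_all add: incident_image card_image inj_on_subset\<close>)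

text \<open>After moving the second structure away from the first, both absorb each other: each is equivalent to
the disjoint union of the two.\<close>

lemma saturated_types_agree:
  fixes \<B> \<B>' :: "nat set set set"
  assumes K: "absorbing TYPE(nat) k K"
    and B: "finite \<B>" "separated \<B>" "saturated k T K \<B>" "\<And>x. x \<in> \<Union>\<B> \<Longrightarrow> x \<noteq> {} \<and> x \<subseteq> {..<N}" "{} \<notin> \<B>"
    and B': "finite \<B>'" "separated \<B>'" "saturated k T K \<B>'" "\<And>x. x \<in> \<Union>\<B>' \<Longrightarrow> x \<noteq> {}"
  shows "mso_type k (\<Union>\<B>) {} [] = mso_type k (\<Union>\<B>') {} []"
proof -
  \<comment> \<open>the shift makes the vertices of the second structure larger than those of the first\<close>
  define h where "h = (\<lambda>x :: nat. x + N)"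
  have inj: "inj h" by (simp add: h_def inj_def)
  define \<C> where "\<C> = (`) ((`) h) ` \<B>'"
  have injC: "inj_on ((`) ((`) h)) \<B>'"
    using inj by (simp add: inj_on_def inj_image_eq_iff)
  have finC: "finite \<C>" using B'(1) by (simp add: \<C>_def)
  have sepC: "separated \<C>"
    unfolding separated_def
  proof (intro ballI impI)
    fix X Y assume "X \<in> \<C>" "Y \<in> \<C>" "X \<noteq> Y"
    then obtain X' Y' where XY: "X' \<in> \<B>'" "Y' \<in> \<B>'" "X' \<noteq> Y'" "X = (`) h ` X'" "Y = (`) h ` Y'"
      unfolding \<C>_def by blast
    note s = separatedD[OF B'(2) XY(1-3)]
    show "X \<inter> Y = {} \<and> (\<forall>x\<in>X. \<forall>y\<in>Y. \<not> incident x y)"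
    proof
      show "X \<inter> Y = {}"
        using s(1) inj unfolding XY(4,5) by (auto simp: inj_image_eq_iff)
      show "\<forall>x\<in>X. \<forall>y\<in>Y. \<not> incident x y"
        using s(2) unfolding XY(4,5) by (auto simp: incident_image[OF inj])
    qed
  qed
  have cross: "x \<noteq> y \<and> \<not> incident x y \<and> \<not> incident y x" if X: "X \<in> \<B>" "x \<in> X" and Y: "Y \<in> \<C>" "y \<in> Y" for X Y x y
  proof -
    have x: "x \<noteq> {}" "x \<subseteq> {..<N}" using B(4)[of x] X by auto
    obtain y' where "y' \<in> \<Union>\<B>'" "y = h ` y'" using Y unfolding \<C>_def by blast
    then have y: "y \<noteq> {}" "y \<subseteq> {N..}" using B'(4)[of y'] by (auto simp: h_def)
    have "{..<N} \<inter> {N..} = {}" by auto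
    then have "\<not> x \<subseteq> y" "\<not> y \<subseteq> x" using x y by blast+
    then show ?thesis by (auto simp: incident_def)
  qed
  have sep: "separated (\<B> \<union> \<C>)"
    unfolding separated_def
  proof (intro ballI impI)
    fix X Y assume XY: "X \<in> \<B> \<union> \<C>" "Y \<in> \<B> \<union> \<C>" "X \<noteq> Y"
    consider "X \<in> \<B>" "Y \<in> \<B>" | "X \<in> \<C>" "Y \<in> \<C>" | "X \<in> \<B>" "Y \<in> \<C>" | "X \<in> \<C>" "Y \<in> \<B>"
      using XY by blast
    then show "X \<inter> Y = {} \<and> (\<forall>x\<in>X. \<forall>y\<in>Y. \<not> incident x y)"
    proof cases
      case 1
      note s = separatedD[OF B(2) 1 XY(3)]
      show ?thesis by (intro conjI ballI s)
    next
      case 2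
      note s = separatedD[OF sepC 2 XY(3)]
      show ?thesis by (intro conjI ballI s)
    next
      case 3
      then show ?thesis using cross[of X _ Y] by blast
    next
      case 4
      then show ?thesis using cross[of Y _ X] by blast
    qed
  qed
  have disj: "\<B> \<inter> \<C> = {}"
  proof (rule ccontr)
    assume "\<B> \<inter> \<C> \<noteq> {}"
    then obtain X where X: "X \<in> \<B>" "X \<in> \<C>" by blast
    then obtain x where "x \<in> X" using B(5) by (metis ex_in_conv)
    then show False using cross[of X x X x] X by blast
  qed
  have typeC: "mso_type k ((`) h ` B) {} [] = mso_type k B {} []" for B
    by (rule mso_type_image[OF inj])
  have satC: "saturated k T K \<C>"
  proof -
    have "card {B \<in> \<C>. mso_type k B {} [] = \<tau>} = card {B \<in> \<B>'. mso_type k B {} [] = \<tau>}" for \<tau>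
    proof -
      have "{B \<in> \<C>. mso_type k B {} [] = \<tau>} = (`) ((`) h) ` {B \<in> \<B>'. mso_type k B {} [] = \<tau>}"
        unfolding \<C>_def by (auto simp: typeC)
      then show ?thesis
        by (simp add: card_image inj_on_subset[OF injC])
    qed
    then show ?thesis using B'(3) by (simp add: saturated_def \<C>_def typeC)
  qed
  have "mso_type k (\<Union>\<B>) {} [] = mso_type k (\<Union>(\<B> \<union> \<C>)) {} []"
    by (rule saturated_absorbs[OF K B(1,3) finC sep disj, symmetric])
      (use satC in \<open>simp add: saturated_def\<close>)
  also have "\<dots> = mso_type k (\<Union>(\<C> \<union> \<B>)) {} []" by (simp only: Un_commute)
  also have "\<dots> = mso_type k (\<Union>\<C>) {} []"
    by (rule saturated_absorbs[OF K finC satC B(1)])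
      (use sep disj B(3) in \<open>simp_all add: saturated_def Un_commute Int_commute\<close>)
  also have "\<Union>\<C> = (`) h ` \<Union>\<B>'" by (auto simp: \<C>_def)
  also have "mso_type k ((`) h ` \<Union>\<B>') {} [] = mso_type k (\<Union>\<B>') {} []" by (rule typeC)
  finally show ?thesis .
qed

text \<open>For a suitable \<open>K\<close> this determines which sentences of depth \<open>k\<close> hold after the pruning, and it has
probability tending to one.\<close>

definition typical :: "nat \<Rightarrow> nat \<Rightarrow> nat \<Rightarrow> nat ugraph \<Rightarrow> bool" where
  "typical k K m G \<longleftrightarrow> (\<forall>C\<in>large_components m G. mso_type k (block G C) {} [] \<in> unbounded_types k) \<and>
     (\<forall>\<tau>\<in>unbounded_types k. K \<le> card {C \<in> large_components m G. mso_type k (block G C) {} [] = \<tau>})"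

lemma typical_saturated:
  assumes "simple G" "typical k K m G"
  shows "saturated k (unbounded_types k) K (block G ` large_components m G)"
proof -
  have "card {B \<in> block G ` large_components m G. mso_type k B {} [] = \<tau>} =
      card {C \<in> large_components m G. mso_type k (block G C) {} [] = \<tau>}" for \<tau>
  proof -
    have "{B \<in> block G ` large_components m G. mso_type k B {} [] = \<tau>} =
        block G ` {C \<in> large_components m G. mso_type k (block G C) {} [] = \<tau>}" by auto
    moreover have "inj_on (block G) {C \<in> large_components m G. mso_type k (block G C) {} [] = \<tau>}"
      by (rule inj_on_subset[OF inj_on_block[OF assms(1)]]) auto
    ultimately show ?thesis by (simp add: card_image)
  qed
  then show ?thesis using assms(2) by (simp add: typical_def saturated_def)
qed

lemma typical_types_agree:
  fixes G G' :: "nat ugraph"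
  assumes "absorbing TYPE(nat) k K" "simple G" "finite (verts G)" "typical k K m G"
    and "simple G'" "finite (verts G')" "typical k K m' G'"
  shows "mso_type k (incidence_universe (prune m G)) {} [] =
    mso_type k (incidence_universe (prune m' G')) {} []"
proof -
  obtain N where N: "verts G \<subseteq> {..<N}"
    using assms(3) finite_nat_iff_bounded by blast
  have elems: "x \<noteq> {} \<and> x \<subseteq> verts G" if "simple G" "x \<in> \<Union>(block G ` large_components m G)" for x G m
    using that simple_prune[OF that(1), of m] unfolding universe_prune[OF that(1), symmetric]
    by (auto simp: incidence_universe_def simple_def prune_def induced_subgraph_def)
  have ne: "{} \<notin> block G ` large_components m G" for G :: "nat ugraph" and m
  proof
    assume "{} \<in> block G ` large_components m G"
    then obtain C where "C \<in> large_components m G" "block G C = {}" by auto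
    then show False using block_nonempty[OF large_component_nonempty(1)[of C m G], of G] by simp
  qed
  show ?thesis
    unfolding universe_prune[OF assms(2)] universe_prune[OF assms(5)]
  proof (rule saturated_types_agree[OF assms(1), where N = N and T = "unbounded_types k"])
    show "x \<noteq> {} \<and> x \<subseteq> {..<N}" if "x \<in> \<Union>(block G ` large_components m G)" for x
      using elems[OF assms(2) that] N by blast
    show "x \<noteq> {}" if "x \<in> \<Union>(block G' ` large_components m' G')" for x
      using elems[OF assms(5) that] by blast
  qed (simp_all add: assms typical_saturated blocks_separated finite_large_components ne)
qed

lemma forest_block_type:
  fixes G :: "nat ugraph"
  assumes "simple G" "finite (edges G)" "\<And>xs. \<not> cycle (edges G) xs" "C \<in> large_components m G"
  shows "\<exists>t. m \<le> nodes t \<and> mso_type k (block G C) {} [] = tree_type k t"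
proof -
  obtain v where v: "v \<in> verts G" "C = component G v" "m \<le> card C"
    using assms(4) by (auto simp: large_components_def)
  obtain t where "rooted_tree C {e \<in> edges G. e \<subseteq> C} v t"
    using forest_component_is_tree[of "edges G" "verts G" v] assms v by auto
  from rooted_tree_card[OF this] tree_type_eq[OF this, of k] v(3) show ?thesis
    by (auto simp: block_def induced_subgraph_def)
qed

section \<open>Probabilities in the random graph\<close>

lemma finite_vertex_pairs: "finite (vertex_pairs n)"
  unfolding vertex_pairs_def by (rule finite_subset[of _ "Pow {1..n}"]) auto

lemma gnp_support:
  assumes "G \<in> set_pmf (gnp n p)"
  shows "verts G = {1..n}" "edges G \<subseteq> vertex_pairs n"
  using assms by (auto simp: gnp_def)

lemma gnp_simple:
  assumes "G \<in> set_pmf (gnp n p)"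
  shows "simple G"
  using gnp_support[OF assms] by (auto simp: simple_def vertex_pairs_def)

text \<open>The presence of each pair in \<open>D\<close> is prescribed, and different pairs are independent.\<close>

lemma prob_gnp_edges:
  assumes PD: "P \<subseteq> D" and D: "D \<subseteq> vertex_pairs n" and p: "0 \<le> p" "p \<le> 1"
  shows "measure_pmf.prob (gnp n p) {G. edges G \<inter> D = P} = p ^ card P * (1 - p) ^ card (D - P)"
proof -
  define B where "B e = (if e \<in> D then {e \<in> P} else UNIV)" for e
  have finD: "finite D" using D finite_vertex_pairs finite_subset by blast
  have "(\<lambda>\<omega>. ({1..n}, {e \<in> vertex_pairs n. \<omega> e})) -` {G. edges G \<inter> D = P} = Pi (vertex_pairs n) B"
  proof (intro set_eqI)
    fix \<omega> :: "nat set \<Rightarrow> bool"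
    have "{e \<in> vertex_pairs n. \<omega> e} \<inter> D = P \<longleftrightarrow> (\<forall>e\<in>D. \<omega> e \<longleftrightarrow> e \<in> P)"
      using PD D by blast
    also have "\<dots> \<longleftrightarrow> \<omega> \<in> Pi (vertex_pairs n) B"
      using D by (auto simp: B_def Pi_iff)
    finally show "\<omega> \<in> (\<lambda>\<omega>. ({1..n}, {e \<in> vertex_pairs n. \<omega> e})) -` {G. edges G \<inter> D = P} \<longleftrightarrow>
        \<omega> \<in> Pi (vertex_pairs n) B" by simp
  qed
  then have "measure_pmf.prob (gnp n p) {G. edges G \<inter> D = P} =
      measure_pmf.prob (Pi_pmf (vertex_pairs n) False (\<lambda>_. bernoulli_pmf p)) (Pi (vertex_pairs n) B)"
    unfolding gnp_def measure_map_pmf by simp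
  also have "\<dots> = (\<Prod>e\<in>vertex_pairs n. measure_pmf.prob (bernoulli_pmf p) (B e))"
    by (rule measure_Pi_pmf_Pi[OF finite_vertex_pairs])
  also have "\<dots> = (\<Prod>e\<in>D. measure_pmf.prob (bernoulli_pmf p) (B e))"
    by (rule prod.mono_neutral_right[OF finite_vertex_pairs D]) (auto simp: B_def)
  also have "\<dots> = (\<Prod>e\<in>P \<union> (D - P). measure_pmf.prob (bernoulli_pmf p) (B e))"
    using PD by (simp add: Un_absorb1)
  also have "\<dots> = (\<Prod>e\<in>P. measure_pmf.prob (bernoulli_pmf p) (B e)) *
      (\<Prod>e\<in>D - P. measure_pmf.prob (bernoulli_pmf p) (B e))"
    by (rule prod.union_disjoint) (use finD PD finite_subset in auto)
  also have "(\<Prod>e\<in>P. measure_pmf.prob (bernoulli_pmf p) (B e)) = (\<Prod>e\<in>P. p)"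
    by (rule prod.cong) (use PD p in \<open>auto simp: B_def measure_pmf_single\<close>)
  also have "(\<Prod>e\<in>D - P. measure_pmf.prob (bernoulli_pmf p) (B e)) = (\<Prod>e\<in>D - P. 1 - p)"
    by (rule prod.cong) (use p in \<open>auto simp: B_def measure_pmf_single\<close>)
  finally show ?thesis by simp
qed

fun path_edges :: "'a list \<Rightarrow> 'a set set" where
  "path_edges (x # y # zs) = insert {x, y} (path_edges (y # zs))"
| "path_edges _ = {}"

lemma walk_iff_path_edges: "walk E xs \<longleftrightarrow> path_edges xs \<subseteq> E"
  by (induction xs rule: path_edges.induct) auto

lemma path_edges_subset: "e \<in> path_edges xs \<Longrightarrow> e \<subseteq> set xs"
  by (induction xs rule: path_edges.induct) auto

lemma path_edges_cover: "2 \<le> length xs \<Longrightarrow> set xs \<subseteq> \<Union>(path_edges xs)"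
proof (induction xs rule: path_edges.induct)
  case (1 x y zs)
  then show ?case by (cases zs) auto
qed auto

lemma finite_path_edges: "finite (path_edges xs)"
  by (induction xs rule: path_edges.induct) auto

lemma card_path_edges: "distinct xs \<Longrightarrow> card (path_edges xs) = length xs - 1"
proof (induction xs rule: path_edges.induct)
  case (1 x y zs)
  have "{x, y} \<notin> path_edges (y # zs)" using path_edges_subset[of "{x, y}" "y # zs"] 1 by auto
  then show ?case using 1 by (simp add: finite_path_edges)
qed auto

lemma path_edges_pairs: "distinct xs \<Longrightarrow> e \<in> path_edges xs \<Longrightarrow> card e = 2"
  by (induction xs rule: path_edges.induct) auto

definition cycle_edges :: "'a list \<Rightarrow> 'a set set" where
  "cycle_edges xs = insert {hd xs, last xs} (path_edges xs)"

lemma cycle_edges_props: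
  assumes "3 \<le> length xs" "distinct xs"
  shows "card (cycle_edges xs) = length xs" "\<And>e. e \<in> cycle_edges xs \<Longrightarrow> card e = 2 \<and> e \<subseteq> set xs"
    "finite (cycle_edges xs)" "cycle E xs \<longleftrightarrow> cycle_edges xs \<subseteq> E"
proof -
  obtain x y zs where xs: "xs = x # y # zs"
    using assms(1) by (cases xs rule: path_edges.cases) auto
  have zs: "zs \<noteq> []" using assms(1) xs by auto
  have last: "last xs \<in> set zs" "last xs \<noteq> x" "last xs \<noteq> y" using xs zs assms(2) by auto
  have "{x, last xs} \<noteq> {x, y}" using last by (auto simp: doubleton_eq_iff)
  moreover have "{x, last xs} \<notin> path_edges (y # zs)"
    using path_edges_subset[of "{x, last xs}" "y # zs"] assms(2) xs by auto
  ultimately have new: "{hd xs, last xs} \<notin> path_edges xs" using xs by (simp only: path_edges.simps list.sel) blast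
  show "finite (cycle_edges xs)" by (simp add: cycle_edges_def finite_path_edges)
  show "card (cycle_edges xs) = length xs"
    using assms new by (simp add: cycle_edges_def finite_path_edges card_path_edges)
  show "card e = 2 \<and> e \<subseteq> set xs" if "e \<in> cycle_edges xs" for e
    using that last path_edges_pairs[OF assms(2), of e] path_edges_subset[of e xs] xs zs
    by (auto simp: cycle_edges_def)
  show "cycle E xs \<longleftrightarrow> cycle_edges xs \<subseteq> E"
    using assms by (auto simp: cycle_def cycle_edges_def walk_iff_path_edges)
qed

lemma sum_powers_le:
  fixes c :: real
  assumes "0 \<le> c" "c \<le> 1 / 2"
  shows "(\<Sum>l = 3..n. c ^ l) \<le> 2 * c"
proof -
  \<comment> \<open>the correction term makes the induction work\<close>
  have "(\<Sum>l = 3..n. c ^ l) \<le> 2 * c * (1 - (1 / 2) ^ n)"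
  proof (induction n)
    case (Suc n)
    have "c ^ n \<le> (1 / 2) ^ n" by (rule power_mono) (use assms in auto)
    then have "c * c ^ n \<le> c * (1 / 2) ^ n" using assms by (intro mult_left_mono)
    moreover have "0 \<le> c * c ^ n" using assms by simp
    moreover have "2 * c * (1 - (1 / 2) ^ Suc n) = 2 * c * (1 - (1 / 2) ^ n) + c * (1 / 2) ^ n"
      by (simp add: algebra_simps)
    moreover have "0 \<le> 2 * c * (1 - (1 / 2) ^ Suc n)"
    proof -
      have "(1 / 2) ^ Suc n \<le> (1 :: real)" by (rule power_le_one) auto
      then show ?thesis using assms(1) by (intro mult_nonneg_nonneg) linarith+
    qed
    ultimately show ?case
      using Suc by (cases "3 \<le> Suc n") (simp_all add: sum.cl_ivl_Suc)
  qed simp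
  also have "\<dots> \<le> 2 * c" using assms by (simp add: mult_left_le)
  finally show ?thesis .
qed

text \<open>Union bound: there are at most \<open>n ^ l\<close> lists of \<open>l\<close> distinct vertices, and the \<open>l\<close> edges of the
corresponding cycle are all present with probability \<open>p ^ l\<close>.\<close>

lemma prob_gnp_cycle_le:
  assumes p: "0 \<le> p" "p \<le> 1" and small: "real n * p \<le> 1 / 2"
  shows "measure_pmf.prob (gnp n p) {G. \<exists>xs. cycle (edges G) xs} \<le> 2 * (real n * p)"
proof -
  define L where "L l = {xs. set xs \<subseteq> {1..n} \<and> length xs = l \<and> distinct xs}" for l
  have finL: "finite (L l)" for l
    by (rule finite_subset[OF _ finite_lists_length_eq[of "{1..n}" l]]) (auto simp: L_def)
  have cardL: "card (L l) \<le> n ^ l" for l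
  proof -
    have "card (L l) \<le> card {xs. set xs \<subseteq> {1..n} \<and> length xs = l}"
      by (rule card_mono) (auto simp: L_def finite_lists_length_eq)
    then show ?thesis by (simp add: card_lists_length_eq)
  qed
  let ?A = "\<lambda>xs. {G :: nat ugraph. edges G \<inter> cycle_edges xs = cycle_edges xs}"
  let ?M = "measure_pmf.prob (gnp n p)"
  have sub: "{G. \<exists>xs. cycle (edges G) xs} \<inter> set_pmf (gnp n p) \<subseteq> (\<Union>l\<in>{3..n}. \<Union>xs\<in>L l. ?A xs)"
  proof
    fix G assume G: "G \<in> {G. \<exists>xs. cycle (edges G) xs} \<inter> set_pmf (gnp n p)"
    then obtain xs where xs: "cycle (edges G) xs" by blast
    have len: "3 \<le> length xs" "distinct xs" using xs by (auto simp: cycle_def)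
    have E: "cycle_edges xs \<subseteq> edges G" using xs cycle_edges_props(4)[OF len] by blast
    have "path_edges xs \<subseteq> edges G" using E by (simp add: cycle_edges_def)
    then have "set xs \<subseteq> \<Union>(edges G)"
      using path_edges_cover[of xs] len(1) Union_mono[of "path_edges xs" "edges G"] by simp
    also have "\<dots> \<subseteq> {1..n}" using gnp_support(2)[of G n p] G by (auto simp: vertex_pairs_def)
    finally have "set xs \<subseteq> {1..n}" .
    moreover from this have "length xs \<le> n"
      using card_mono[of "{1..n}" "set xs"] distinct_card[OF len(2)] by simp
    ultimately have "xs \<in> L (length xs)" "length xs \<in> {3..n}" using len by (auto simp: L_def)
    moreover have "G \<in> ?A xs" using E by auto
    ultimately show "G \<in> (\<Union>l\<in>{3..n}. \<Union>xs\<in>L l. ?A xs)" by blast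
  qed
  have A: "?M (?A xs) = p ^ l" if "xs \<in> L l" "3 \<le> l" for xs l
  proof -
    have len: "3 \<le> length xs" "distinct xs" using that by (auto simp: L_def)
    have "cycle_edges xs \<subseteq> vertex_pairs n"
      using cycle_edges_props(2)[OF len] that by (force simp: L_def vertex_pairs_def)
    from prob_gnp_edges[OF order_refl this p] show ?thesis
      using cycle_edges_props(1)[OF len] that by (simp add: L_def)
  qed
  have "?M {G. \<exists>xs. cycle (edges G) xs} = ?M ({G. \<exists>xs. cycle (edges G) xs} \<inter> set_pmf (gnp n p))"
    by (simp add: measure_Int_set_pmf)
  also have "\<dots> \<le> ?M (\<Union>l\<in>{3..n}. \<Union>xs\<in>L l. ?A xs)"
    by (rule measure_pmf.finite_measure_mono[OF sub]) simp
  also have "\<dots> \<le> (\<Sum>l\<in>{3..n}. ?M (\<Union>xs\<in>L l. ?A xs))"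
    by (rule measure_pmf.finite_measure_subadditive_finite) auto
  also have "\<dots> \<le> (\<Sum>l\<in>{3..n}. \<Sum>xs\<in>L l. ?M (?A xs))"
    by (intro sum_mono measure_pmf.finite_measure_subadditive_finite) (auto simp: finL)
  also have "\<dots> = (\<Sum>l\<in>{3..n}. real (card (L l)) * p ^ l)"
    by (intro sum.cong refl) (simp add: A)
  also have "\<dots> \<le> (\<Sum>l\<in>{3..n}. real (n ^ l) * p ^ l)"
    by (intro sum_mono mult_right_mono) (use cardL p in \<open>auto simp del: of_nat_power\<close>)
  also have "\<dots> = (\<Sum>l = 3..n. (real n * p) ^ l)"
    by (simp add: power_mult_distrib)
  also have "\<dots> \<le> 2 * (real n * p)"
    by (rule sum_powers_le) (use p small in auto)
  finally show ?thesis .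
qed

text \<open>Chebyshev's inequality for the number \<open>X\<close> of events that occur. As \<open>\<mu>\<close> is the mean of \<open>X\<close>, the
hypothesis on pairs bounds the second moment of \<open>X\<close> by \<open>\<mu> + \<alpha> * \<mu>\<^sup>2\<close>, hence its variance by
\<open>\<mu> + (\<alpha> - 1) * \<mu>\<^sup>2\<close>.\<close>

lemma second_moment_bound:
  fixes M :: "'a pmf" and A :: "'b \<Rightarrow> 'a set"
  assumes fin: "finite I" and \<alpha>: "1 \<le> \<alpha>"
    and pair: "\<And>i j. i \<in> I \<Longrightarrow> j \<in> I \<Longrightarrow> i \<noteq> j \<Longrightarrow>
      measure_pmf.prob M (A i \<inter> A j) \<le> \<alpha> * (measure_pmf.prob M (A i) * measure_pmf.prob M (A j))"
    and \<mu>: "\<mu> = (\<Sum>i\<in>I. measure_pmf.prob M (A i))" "0 < \<mu>" "2 * real K \<le> \<mu>"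
  shows "measure_pmf.prob M {x. card {i \<in> I. x \<in> A i} < K} \<le> 4 / \<mu> + 4 * (\<alpha> - 1)"
proof -
  let ?P = "measure_pmf.prob M"
  define X where "X x = (\<Sum>i\<in>I. indicat_real (A i) x)" for x
  have X_card: "X x = real (card {i \<in> I. x \<in> A i})" for x
    unfolding X_def indicator_def using fin by (simp add: sum.If_cases Int_def)
  have int: "integrable (measure_pmf M) (indicat_real B)" for B
    by (intro integrable_real_indicator) (simp_all add: measure_pmf.emeasure_eq_measure)
  have sq: "(X x - \<mu>)\<^sup>2 = (\<Sum>i\<in>I. \<Sum>j\<in>I. indicat_real (A i \<inter> A j) x) - 2 * \<mu> * (\<Sum>i\<in>I. indicat_real (A i) x) + \<mu>\<^sup>2" for x
  proof -
    have "X x * X x = (\<Sum>i\<in>I. \<Sum>j\<in>I. indicat_real (A i \<inter> A j) x)"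
      unfolding X_def sum_product by (simp add: indicator_inter_arith)
    then show ?thesis unfolding power2_eq_square by (simp add: X_def algebra_simps)
  qed
  have intsq: "integrable (measure_pmf M) (\<lambda>x. (X x - \<mu>)\<^sup>2)"
    unfolding sq by (intro Bochner_Integration.integrable_add Bochner_Integration.integrable_diff
      Bochner_Integration.integrable_sum integrable_mult_right int) simp
  have "measure_pmf.expectation M (\<lambda>x. (X x - \<mu>)\<^sup>2) =
      (\<Sum>i\<in>I. \<Sum>j\<in>I. ?P (A i \<inter> A j)) - 2 * \<mu> * (\<Sum>i\<in>I. ?P (A i)) + \<mu>\<^sup>2"
    unfolding sq
    by (subst Bochner_Integration.integral_add Bochner_Integration.integral_diff
        Bochner_Integration.integral_sum integral_mult_right,
      (intro Bochner_Integration.integrable_add Bochner_Integration.integrable_diff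
      Bochner_Integration.integrable_sum integrable_mult_right int | simp)+)+
  also have "\<dots> = (\<Sum>i\<in>I. \<Sum>j\<in>I. ?P (A i \<inter> A j)) - \<mu>\<^sup>2"
    by (simp add: \<mu>(1)[symmetric] power2_eq_square)
  also have "(\<Sum>i\<in>I. \<Sum>j\<in>I. ?P (A i \<inter> A j)) \<le>
      (\<Sum>i\<in>I. \<Sum>j\<in>I. (if i = j then ?P (A i) else 0) + \<alpha> * (?P (A i) * ?P (A j)))"
  proof (intro sum_mono)
    fix i j assume ij: "i \<in> I" "j \<in> I"
    show "?P (A i \<inter> A j) \<le> (if i = j then ?P (A i) else 0) + \<alpha> * (?P (A i) * ?P (A j))"
    proof (cases "i = j")
      case True
      then show ?thesis using \<alpha> by simp
    next
      case False
      then show ?thesis using pair[OF ij False] by simp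
    qed
  qed
  also have "\<dots> = \<mu> + \<alpha> * \<mu>\<^sup>2"
  proof -
    have "(\<Sum>i\<in>I. \<Sum>j\<in>I. \<alpha> * (?P (A i) * ?P (A j))) = \<alpha> * \<mu>\<^sup>2"
      unfolding power2_eq_square \<mu>(1) sum_product by (simp add: sum_distrib_left)
    then show ?thesis using fin by (simp add: sum.distrib \<mu>(1))
  qed
  finally have var: "measure_pmf.expectation M (\<lambda>x. (X x - \<mu>)\<^sup>2) \<le> \<mu> + (\<alpha> - 1) * \<mu>\<^sup>2"
    by (simp add: algebra_simps)
  have "{x. card {i \<in> I. x \<in> A i} < K} \<subseteq> {x \<in> space (measure_pmf M). \<mu>\<^sup>2 / 4 \<le> (X x - \<mu>)\<^sup>2}"
  proof
    fix x assume "x \<in> {x. card {i \<in> I. x \<in> A i} < K}"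
    then have "\<mu> / 2 \<le> \<mu> - X x" using \<mu>(3) by (simp add: X_card)
    then have "(\<mu> / 2)\<^sup>2 \<le> (\<mu> - X x)\<^sup>2" using \<mu>(2) by (intro power_mono) auto
    then show "x \<in> {x \<in> space (measure_pmf M). \<mu>\<^sup>2 / 4 \<le> (X x - \<mu>)\<^sup>2}"
      by (simp add: power_divide power2_commute)
  qed
  then have "?P {x. card {i \<in> I. x \<in> A i} < K} \<le> ?P {x \<in> space (measure_pmf M). \<mu>\<^sup>2 / 4 \<le> (X x - \<mu>)\<^sup>2}"
    by (rule measure_pmf.finite_measure_mono) simp
  also have "\<dots> \<le> measure_pmf.expectation M (\<lambda>x. (X x - \<mu>)\<^sup>2) / (\<mu>\<^sup>2 / 4)"
    by (rule integral_Markov_inequality_measure[OF intsq, of "{}"]) (use \<mu>(2) in auto)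
  also have "\<dots> \<le> (\<mu> + (\<alpha> - 1) * \<mu>\<^sup>2) / (\<mu>\<^sup>2 / 4)"
    by (rule divide_right_mono[OF var]) simp
  also have "\<dots> = 4 / \<mu> + 4 * (\<alpha> - 1)"
    using \<mu>(2) by (simp add: field_simps power2_eq_square)
  finally show ?thesis .
qed

section \<open>Many copies of a tree\<close>

text \<open>These are the pairs whose presence decides whether \<open>S\<close> is a component and which graph it induces.\<close>

definition touching :: "nat \<Rightarrow> nat set \<Rightarrow> nat set set" where
  "touching n S = {e \<in> vertex_pairs n. e \<inter> S \<noteq> {}}"

lemma isolated_tree_component:
  assumes "simple G" "S \<subseteq> verts G" "{e \<in> edges G. e \<inter> S \<noteq> {}} = E" "rooted_tree S E r t" "v \<in> S"
  shows "component G v = S" "{e \<in> edges G. e \<subseteq> S} = E"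
proof -
  have simpleS: "simple (S, E)" by (rule rooted_tree_simple[OF assms(4)])
  have ES: "e \<subseteq> S" "e \<noteq> {}" if "e \<in> E" for e using simpleS that by (auto simp: simple_def)
  show "{e \<in> edges G. e \<subseteq> S} = E"
  proof (intro equalityI subsetI)
    fix e assume "e \<in> {e \<in> edges G. e \<subseteq> S}"
    moreover from this have "e \<noteq> {}" using assms(1) by (auto simp: simple_def)
    ultimately show "e \<in> E" unfolding assms(3)[symmetric] by auto
  next
    fix e assume "e \<in> E"
    then show "e \<in> {e \<in> edges G. e \<subseteq> S}" using ES[of e] assms(3) by auto
  qed
  show "component G v = S"
  proof
    have "(v, w) \<in> (adjacency (edges G))\<^sup>* \<Longrightarrow> w \<in> S" for w
    proof (induction rule: rtrancl_induct)
      case (step y z)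
      then have "{y, z} \<in> E" unfolding assms(3)[symmetric] by auto
      then show ?case using ES(1)[of "{y, z}"] by auto
    qed (rule assms(5))
    then show "component G v \<subseteq> S" by (auto simp: component_def)
    show "S \<subseteq> component G v"
    proof
      fix w assume w: "w \<in> S"
      have "(r, v) \<in> (adjacency E)\<^sup>*" "(r, w) \<in> (adjacency E)\<^sup>*"
        using rooted_tree_connected[OF assms(4)] assms(5) w by blast+
      then have "(v, w) \<in> (adjacency E)\<^sup>*"
        using symD[OF adjacency_sym, of r v E] rtrancl_trans[of v r "adjacency E" w] by blast
      moreover have "E \<subseteq> edges G" using assms(3) by auto
      ultimately have "(v, w) \<in> (adjacency (edges G))\<^sup>*" using adjacency_mono[of E "edges G"] by blast
      then show "w \<in> component G v" using w assms(2) by (auto simp: component_def)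
    qed
  qed
qed

lemma finite_touching: "finite (touching n S)"
  by (rule finite_subset[OF _ finite_vertex_pairs]) (auto simp: touching_def)

lemma card_touching_le:
  assumes "finite S"
  shows "card (touching n S) \<le> card S * n"
proof -
  have "touching n S \<subseteq> (\<lambda>(a, b). {a, b}) ` (S \<times> {1..n})"
  proof
    fix e assume "e \<in> touching n S"
    then obtain a where a: "a \<in> e" "a \<in> S" and e: "e \<subseteq> {1..n}" "card e = 2"
      by (auto simp: touching_def vertex_pairs_def)
    then obtain b where "e = {a, b}" by (auto simp: card_2_iff)
    then show "e \<in> (\<lambda>(a, b). {a, b}) ` (S \<times> {1..n})" using a e by auto
  qed
  then have "card (touching n S) \<le> card ((\<lambda>(a, b). {a, b}) ` (S \<times> {1..n}))"
    using assms by (intro card_mono) auto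
  also have "\<dots> \<le> card (S \<times> {1..n})" using assms by (intro card_image_le) auto
  finally show ?thesis by (simp add: card_cartesian_product)
qed

lemma card_touching_both_le:
  assumes "finite S" "finite S'" "S \<inter> S' = {}"
  shows "card (touching n S \<inter> touching n S') \<le> card S * card S'"
proof -
  have "touching n S \<inter> touching n S' \<subseteq> (\<lambda>(a, b). {a, b}) ` (S \<times> S')"
  proof
    fix e assume "e \<in> touching n S \<inter> touching n S'"
    then obtain a b where a: "a \<in> e" "a \<in> S" and b: "b \<in> e" "b \<in> S'" and e: "card e = 2"
      by (auto simp: touching_def vertex_pairs_def)
    have "a \<noteq> b" using a b assms(3) by auto
    then have "e = {a, b}" using a b e by (auto simp: card_2_iff)
    then show "e \<in> (\<lambda>(a, b). {a, b}) ` (S \<times> S')" using a b by auto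
  qed
  then have "card (touching n S \<inter> touching n S') \<le> card ((\<lambda>(a, b). {a, b}) ` (S \<times> S'))"
    using assms by (intro card_mono) auto
  also have "\<dots> \<le> card (S \<times> S')" using assms by (intro card_image_le) auto
  finally show ?thesis by (simp add: card_cartesian_product)
qed

text \<open>For every set \<open>S\<close> of \<open>nodes t\<close> vertices fix one tree on \<open>S\<close> with term \<open>t\<close>; a single placement per set
already gives enough copies in expectation, namely at least \<open>\<beta>\<close>. Two different sets that overlap
cannot both be components. For disjoint sets the two events share only the pairs between the sets,
whose absence is required by both of them; there are \<open>nodes t * nodes t\<close> such pairs, which explains
the factor by which the events fail to be independent.\<close>

lemma prob_few_copies_le:
  fixes p :: real
  assumes p: "0 < p" "p < 1" and f: "f \<le> nodes t"
    and \<beta>: "\<beta> = real (n choose nodes t) * p ^ (nodes t - 1) * (1 - p) ^ (nodes t * n)" "0 < \<beta>" "2 * real K \<le> \<beta>"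
  shows "measure_pmf.prob (gnp n p)
      {G. card {C \<in> large_components f G. mso_type k (block G C) {} [] = tree_type k t} < K}
    \<le> 4 / \<beta> + 4 * (1 / (1 - p) ^ (nodes t * nodes t) - 1)"
proof -
  let ?P = "measure_pmf.prob (gnp n p)"
  define m where "m = nodes t"
  define I where "I = {S. S \<subseteq> {1..n} \<and> card S = m}"
  have finI: "finite I" unfolding I_def by (rule finite_subset[of _ "Pow {1..n}"]) auto
  have finS: "finite S" if "S \<in> I" for S using that finite_subset by (auto simp: I_def)
  have "\<forall>S\<in>I. \<exists>E r. rooted_tree S E r t"
  proof
    fix S assume S: "S \<in> I"
    show "\<exists>E r. rooted_tree S E r t"
      by (rule rooted_tree_exists[OF finS[OF S]]) (use S in \<open>simp add: I_def m_def\<close>)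
  qed
  then obtain E r where tree: "\<And>S. S \<in> I \<Longrightarrow> rooted_tree S (E S) (r S) t" by metis
  define A where "A S = {G :: nat ugraph. edges G \<inter> touching n S = E S}" for S
  have E_simple: "e \<subseteq> S \<and> card e = 2" if "S \<in> I" "e \<in> E S" for S e
    using rooted_tree_simple[OF tree[OF that(1)]] that(2) by (auto simp: simple_def)
  have E_touch: "E S \<subseteq> touching n S" if S: "S \<in> I" for S
  proof
    fix e assume "e \<in> E S"
    then have "e \<subseteq> S" "card e = 2" using E_simple[OF S] by auto
    then show "e \<in> touching n S" using S by (auto simp: touching_def vertex_pairs_def I_def Int_absorb2)
  qed
  have touch: "touching n S \<subseteq> vertex_pairs n" for S by (auto simp: touching_def)
  have cardE: "card (E S) = m - 1" "finite (E S)" if "S \<in> I" for S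
    using rooted_tree_card[OF tree[OF that]] by (auto simp: m_def)
  have prob: "?P (A S) = p ^ (m - 1) * (1 - p) ^ card (touching n S - E S)" if "S \<in> I" for S
    unfolding A_def using prob_gnp_edges[OF E_touch[OF that] touch] p cardE[OF that] by simp
  have comp: "component G v = S" "{e \<in> edges G. e \<subseteq> S} = E S"
    if S: "S \<in> I" and G: "G \<in> set_pmf (gnp n p)" "G \<in> A S" and v: "v \<in> S" for S G v
  proof -
    have "edges G \<inter> touching n S = {e \<in> edges G. e \<inter> S \<noteq> {}}"
      using gnp_support(2)[OF G(1)] by (auto simp: touching_def)
    then have "{e \<in> edges G. e \<inter> S \<noteq> {}} = E S" using G(2) by (simp add: A_def)
    moreover have "S \<subseteq> verts G" using S gnp_support(1)[OF G(1)] by (simp add: I_def)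
    ultimately show "component G v = S" "{e \<in> edges G. e \<subseteq> S} = E S"
      using isolated_tree_component[OF gnp_simple[OF G(1)] _ _ tree[OF S] v] by blast+
  qed
  have ne: "\<exists>v. v \<in> S" if "S \<in> I" for S using rooted_tree_root[OF tree[OF that]] by blast
  define \<alpha> where "\<alpha> = 1 / (1 - p) ^ (m * m)"
  have pow1: "(1 - p) ^ (m * m) \<le> 1" "0 < (1 - p) ^ (m * m)" using p by (auto intro: power_le_one)
  then have \<alpha>: "1 \<le> \<alpha>" by (simp add: \<alpha>_def)
  have pair: "?P (A S \<inter> A S') \<le> \<alpha> * (?P (A S) * ?P (A S'))" if S: "S \<in> I" "S' \<in> I" "S \<noteq> S'" for S S'
  proof (cases "S \<inter> S' = {}")
    case False
    then obtain v where v: "v \<in> S" "v \<in> S'" by blast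
    have "A S \<inter> A S' \<inter> set_pmf (gnp n p) = {}"
    proof (rule ccontr)
      assume "A S \<inter> A S' \<inter> set_pmf (gnp n p) \<noteq> {}"
      then obtain G where G: "G \<in> set_pmf (gnp n p)" "G \<in> A S" "G \<in> A S'" by blast
      then show False using comp(1)[OF S(1) G(1,2) v(1)] comp(1)[OF S(2) G(1,3) v(2)] S(3) by simp
    qed
    then have "?P (A S \<inter> A S') = 0"
      using measure_Int_set_pmf[of "gnp n p" "A S \<inter> A S'"] by simp
    then show ?thesis using \<alpha> by simp
  next
    case True
    let ?D = "touching n S" and ?D' = "touching n S'"
    have d1: "E S \<inter> ?D' = {}" using E_simple[OF S(1)] True by (auto simp: touching_def)
    have d2: "E S' \<inter> ?D = {}" using E_simple[OF S(2)] True by (auto simp: touching_def)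
    have EE: "E S \<inter> E S' = {}" using d1 E_touch[OF S(2)] by blast
    have "?P (A S \<inter> A S') \<le> ?P {G. edges G \<inter> (?D \<union> ?D') = E S \<union> E S'}"
      by (rule measure_pmf.finite_measure_mono) (auto simp: A_def)
    also have "\<dots> = p ^ card (E S \<union> E S') * (1 - p) ^ card (?D \<union> ?D' - (E S \<union> E S'))"
      by (rule prob_gnp_edges) (use E_touch[OF S(1)] E_touch[OF S(2)] touch p in auto)
    also have "card (E S \<union> E S') = (m - 1) + (m - 1)"
      using card_Un_disjoint[OF _ _ EE] cardE S by simp
    also have "?D \<union> ?D' - (E S \<union> E S') = (?D - E S) \<union> (?D' - E S')" using d1 d2 by blast
    finally have le: "?P (A S \<inter> A S') \<le>
        p ^ ((m - 1) + (m - 1)) * (1 - p) ^ card ((?D - E S) \<union> (?D' - E S'))" .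
    have "card (?D - E S) + card (?D' - E S') =
        card ((?D - E S) \<union> (?D' - E S')) + card ((?D - E S) \<inter> (?D' - E S'))"
      by (rule card_Un_Int) (simp_all add: finite_touching)
    moreover have "card ((?D - E S) \<inter> (?D' - E S')) \<le> card (?D \<inter> ?D')"
      by (rule card_mono) (auto simp: finite_touching)
    moreover have "card (?D \<inter> ?D') \<le> m * m"
      using card_touching_both_le[OF finS[OF S(1)] finS[OF S(2)] True] S by (simp add: I_def)
    ultimately have "card (?D - E S) + card (?D' - E S') \<le> card ((?D - E S) \<union> (?D' - E S')) + m * m"
      by linarith
    then have "(1 - p) ^ (card ((?D - E S) \<union> (?D' - E S')) + m * m) \<le>
        (1 - p) ^ (card (?D - E S) + card (?D' - E S'))"
      using p by (intro power_decreasing) auto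
    then have "(1 - p) ^ card ((?D - E S) \<union> (?D' - E S')) \<le>
        \<alpha> * ((1 - p) ^ card (?D - E S) * (1 - p) ^ card (?D' - E S'))"
      using pow1(2) by (simp add: \<alpha>_def power_add field_simps)
    then have "p ^ ((m - 1) + (m - 1)) * (1 - p) ^ card ((?D - E S) \<union> (?D' - E S')) \<le>
        p ^ ((m - 1) + (m - 1)) * (\<alpha> * ((1 - p) ^ card (?D - E S) * (1 - p) ^ card (?D' - E S')))"
      using p by (intro mult_left_mono) auto
    also have "\<dots> = \<alpha> * (?P (A S) * ?P (A S'))"
      unfolding prob[OF S(1)] prob[OF S(2)] by (simp add: power_add ac_simps)
    finally show ?thesis using le by linarith
  qed
  define \<mu> where "\<mu> = (\<Sum>S\<in>I. ?P (A S))"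
  have "card I = n choose m" unfolding I_def using n_subsets[of "{1..n}" m] by simp
  then have "\<beta> = (\<Sum>S\<in>I. p ^ (m - 1) * (1 - p) ^ (m * n))"
    by (simp add: \<beta>(1) m_def)
  also have "\<dots> \<le> \<mu>"
    unfolding \<mu>_def
  proof (intro sum_mono)
    fix S assume S: "S \<in> I"
    have "card (touching n S - E S) \<le> card (touching n S)"
      by (rule card_mono) (auto simp: finite_touching)
    also have "\<dots> \<le> m * n" using card_touching_le[OF finS[OF S]] S by (simp add: I_def)
    finally have "(1 - p) ^ (m * n) \<le> (1 - p) ^ card (touching n S - E S)"
      using p by (intro power_decreasing) auto
    then show "p ^ (m - 1) * (1 - p) ^ (m * n) \<le> ?P (A S)"
      unfolding prob[OF S] using p by (intro mult_left_mono) auto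
  qed
  finally have \<beta>\<mu>: "\<beta> \<le> \<mu>" .
  have sub: "{G. card {C \<in> large_components f G. mso_type k (block G C) {} [] = tree_type k t} < K} \<inter>
      set_pmf (gnp n p) \<subseteq> {G. card {S \<in> I. G \<in> A S} < K}"
  proof
    fix G assume G: "G \<in> {G. card {C \<in> large_components f G. mso_type k (block G C) {} [] = tree_type k t} < K} \<inter>
      set_pmf (gnp n p)"
    have "{S \<in> I. G \<in> A S} \<subseteq> {C \<in> large_components f G. mso_type k (block G C) {} [] = tree_type k t}"
    proof
      fix S assume "S \<in> {S \<in> I. G \<in> A S}"
      then have S: "S \<in> I" "G \<in> A S" by auto
      obtain v where v: "v \<in> S" using ne[OF S(1)] by blast
      have Gs: "G \<in> set_pmf (gnp n p)" using G by blast
      note c = comp[OF S(1) Gs S(2) v]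
      have "v \<in> verts G" using v S(1) gnp_support(1)[OF Gs] by (auto simp: I_def)
      then have "S \<in> large_components f G"
        using c(1) f S(1) by (auto simp: large_components_def I_def m_def)
      moreover have "mso_type k (block G S) {} [] = tree_type k t"
        using tree_type_eq[OF tree[OF S(1)], of k] c(2) by (simp add: block_def induced_subgraph_def)
      ultimately show "S \<in> {C \<in> large_components f G. mso_type k (block G C) {} [] = tree_type k t}" by blast
    qed
    then have "card {S \<in> I. G \<in> A S} \<le> card {C \<in> large_components f G. mso_type k (block G C) {} [] = tree_type k t}"
      using finite_large_components[of G f] gnp_support(1)[of G n p] G by (intro card_mono) auto
    then show "G \<in> {G. card {S \<in> I. G \<in> A S} < K}" using G by auto
  qed
  have "?P {G. card {C \<in> large_components f G. mso_type k (block G C) {} [] = tree_type k t} < K} =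
      ?P ({G. card {C \<in> large_components f G. mso_type k (block G C) {} [] = tree_type k t} < K} \<inter>
      set_pmf (gnp n p))"
    by (simp add: measure_Int_set_pmf)
  also have "\<dots> \<le> ?P {G. card {S \<in> I. G \<in> A S} < K}"
    by (rule measure_pmf.finite_measure_mono[OF sub]) simp
  also have "\<dots> \<le> 4 / \<mu> + 4 * (\<alpha> - 1)"
    by (rule second_moment_bound[OF finI \<alpha> pair \<mu>_def]) (use \<beta> \<beta>\<mu> in auto)
  also have "\<dots> \<le> 4 / \<beta> + 4 * (\<alpha> - 1)"
    using \<beta>(2) \<beta>\<mu> by (intro add_right_mono divide_left_mono) auto
  finally show ?thesis by (simp add: \<alpha>_def m_def)
qed

text \<open>From \<open>n choose m \<ge> (n / m) ^ m\<close> and \<open>1 - p \<ge> exp (- 2 * p)\<close> for \<open>p \<le> 1 / 2\<close>. The powers of \<open>n\<close>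
cancel except for one factor.\<close>

lemma expected_copies_ge:
  fixes c :: real
  assumes m: "1 \<le> m" "m \<le> n" and c: "0 < c" "c \<le> 1 / 2"
  shows "exp (ln (real n) - real m * ln (real m) - real (m - 1) * ln (1 / c) - 2 * real m)
    \<le> real (n choose m) * (c / real n) ^ (m - 1) * (1 - c / real n) ^ (m * n)"
proof -
  define p where "p = c / real n"
  have n: "1 \<le> real n" using m by linarith
  have "p \<le> c / 1" unfolding p_def using c n by (intro divide_left_mono) auto
  then have p: "0 < p" "p \<le> 1 / 2" using c n by (auto simp: p_def)
  have "exp (real m * (ln (real n) - ln (real m))) = (real n / real m) ^ m"
    using m n by (simp add: exp_of_nat_mult exp_diff)
  also have "\<dots> \<le> real (n choose m)" using binomial_ge_n_over_k_pow_k[OF m(2), where ?'a = real] by simp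
  finally have 1: "exp (real m * (ln (real n) - ln (real m))) \<le> real (n choose m)" .
  have 2: "exp (real (m - 1) * (ln c - ln (real n))) = p ^ (m - 1)"
    using c n by (simp add: exp_of_nat_mult exp_diff p_def)
  have "- 2 * p \<le> - p - 2 * p\<^sup>2"
    using p mult_left_mono[of p "1 / 2" "2 * p"] by (simp add: power2_eq_square)
  also have "\<dots> \<le> ln (1 - p)" by (rule ln_one_minus_pos_lower_bound) (use p in auto)
  finally have "exp (- 2 * p) \<le> exp (ln (1 - p))" by simp
  then have "exp (- 2 * p) \<le> 1 - p" using p by simp
  then have pow: "exp (- 2 * p) ^ (m * n) \<le> (1 - p) ^ (m * n)" by (rule power_mono) simp
  have "real (m * n) * (- 2 * p) = - 2 * c * real m" using n by (simp add: p_def)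
  then have "exp (- 2 * c * real m) = exp (- 2 * p) ^ (m * n)"
    by (simp only: exp_of_nat_mult[symmetric])
  then have 3: "exp (- 2 * c * real m) \<le> (1 - p) ^ (m * n)" using pow by (simp only:)
  have mm: "real (m - 1) = real m - 1" using m by simp
  have "exp (ln (real n) - real m * ln (real m) - real (m - 1) * ln (1 / c) - 2 * real m) \<le>
      exp (real m * (ln (real n) - ln (real m)) + real (m - 1) * (ln c - ln (real n)) + (- 2 * c * real m))"
  proof -
    have "2 * c * real m \<le> 2 * real m" using c m by (simp add: mult_le_cancel_right1)
    then show ?thesis unfolding mm using c by (simp add: ln_div algebra_simps)
  qed
  also have "\<dots> = exp (real m * (ln (real n) - ln (real m))) * exp (real (m - 1) * (ln c - ln (real n))) *
      exp (- 2 * c * real m)"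
    by (simp only: exp_add)
  also have "\<dots> \<le> real (n choose m) * p ^ (m - 1) * (1 - p) ^ (m * n)"
    unfolding 2 using 1 3 p by (intro mult_mono) auto
  finally show ?thesis by (simp add: p_def)
qed

text \<open>From Bernoulli's inequality.\<close>

lemma inverse_power_minus_one_le:
  fixes p :: real
  assumes "0 \<le> p" "p < 1" "real N * p \<le> 1 / 2"
  shows "1 / (1 - p) ^ N - 1 \<le> 2 * (real N * p)"
proof -
  define d where "d = real N * p"
  have "1 - d \<le> (1 - p) ^ N"
    using Bernoulli_inequality[of "- p" N] assms by (simp add: d_def)
  moreover have d: "0 \<le> d" "d \<le> 1 / 2" using assms by (auto simp: d_def)
  ultimately have "1 / (1 - p) ^ N \<le> 1 / (1 - d)" by (intro divide_left_mono mult_pos_pos) auto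
  also have "\<dots> \<le> 1 + 2 * d"
  proof -
    have "d * d \<le> d * (1 / 2)" using d by (intro mult_left_mono) auto
    then show ?thesis using d by (simp add: pos_divide_le_eq algebra_simps)
  qed
  finally show ?thesis by (simp add: d_def)
qed

text \<open>Pumping provides a tree of the required type with at least \<open>f n\<close> and at most \<open>f n + b\<close> vertices, and
the growth condition on \<open>f\<close> makes the mean number of its copies at least the square root of \<open>n\<close>.\<close>

lemma few_copies_tendsto_0:
  fixes c :: "nat \<Rightarrow> real" and f :: "nat \<Rightarrow> nat"
  assumes c: "\<And>n. n \<ge> 1 \<Longrightarrow> c n > 0" "c \<longlonglongrightarrow> 0"
    and f: "filterlim f at_top sequentially"
    and small: "(\<lambda>n. real (f n) * (ln (real (f n)) + ln (1 / c n))) \<in> o(\<lambda>n. ln (real n))"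
    and \<tau>: "\<tau> \<in> unbounded_types k"
  shows "(\<lambda>n. measure_pmf.prob (gnp n (c n / real n))
     {G. card {C \<in> large_components (f n) G. mso_type k (block G C) {} [] = \<tau>} < K}) \<longlonglongrightarrow> 0"
proof -
  obtain b where "\<forall>m. \<exists>t. tree_type k t = \<tau> \<and> m \<le> nodes t \<and> nodes t \<le> m + b"
    using unbounded_type_dense[OF \<tau>] by blast
  then have "\<forall>n. \<exists>t. tree_type k t = \<tau> \<and> f n \<le> nodes t \<and> nodes t \<le> f n + b" by blast
  then obtain t where t: "\<And>n. tree_type k (t n) = \<tau>" "\<And>n. f n \<le> nodes (t n)" "\<And>n. nodes (t n) \<le> f n + b"
    by metis
  define B where "B n = 4 * exp (- (ln (real n) / 2)) + 8 * ((ln (real n))\<^sup>2 / real n)" for n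
  \<comment> \<open>\<open>b \<le> f n\<close> bounds the size of the chosen tree by \<open>2 * f n\<close>\<close>
  have ev1: "eventually (\<lambda>n. max b 1 \<le> f n) sequentially"
    using f unfolding filterlim_at_top by blast
  have ev2: "eventually (\<lambda>n. 1 \<le> ln (real (f n))) sequentially"
  proof -
    have "filterlim (\<lambda>n. ln (real (f n))) at_top sequentially"
      by (rule filterlim_compose[OF ln_at_top filterlim_compose[OF filterlim_real_sequentially f]])
    then show ?thesis by (simp add: filterlim_at_top)
  qed
  have ev3: "eventually (\<lambda>n. c n < 1 / 2) sequentially"
    using order_tendstoD(2)[OF c(2), of "1 / 2"] by simp
  \<comment> \<open>the exponent in \<open>expected_copies_ge\<close> falls short of \<open>ln n\<close> by at most eight times the left-hand
      side, so the constant \<open>1 / 16\<close> leaves half of \<open>ln n\<close>\<close>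
  have ev4: "eventually (\<lambda>n. norm (real (f n) * (ln (real (f n)) + ln (1 / c n))) \<le> 1 / 16 * norm (ln (real n))) sequentially"
    by (rule landau_o.smallD[OF small]) simp
  have ev5: "eventually (\<lambda>n. 2 * real K \<le> exp (ln (real n) / 2)) sequentially"
  proof -
    have "filterlim (\<lambda>n. exp (ln (real n) / 2)) at_top sequentially" by real_asymp
    then show ?thesis by (simp add: filterlim_at_top)
  qed
  have ev6: "eventually (\<lambda>n. (ln (real n))\<^sup>2 / real n \<le> 1 / 2) sequentially" by real_asymp
  have "eventually (\<lambda>n. measure_pmf.prob (gnp n (c n / real n))
     {G. card {C \<in> large_components (f n) G. mso_type k (block G C) {} [] = \<tau>} < K} \<le> B n) sequentially"
    using ev1 ev2 ev3 ev4 ev5 ev6 eventually_ge_at_top[of 2]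
  proof eventually_elim
    case (elim n)
    define m where "m = nodes (t n)"
    define F where "F = real (f n)"
    define L where "L = F * (ln F + ln (1 / c n))"
    have n: "2 \<le> real n" using elim(7) by simp
    have c': "0 < c n" "c n \<le> 1 / 2" using c(1)[of n] elim(3,7) by auto
    have F: "1 \<le> F" "1 \<le> ln F" using elim(1,2) by (auto simp: F_def)
    have lc: "0 \<le> ln (1 / c n)" using c' by (simp add: ln_div)
    have lnn: "0 \<le> ln (real n)" using n by simp
    have L: "L \<le> ln (real n) / 16" using elim(4) lnn unfolding L_def F_def by simp
    have FL: "F * ln F \<le> L" "F * ln (1 / c n) \<le> L"
      unfolding L_def using F lc by (simp_all add: distrib_left)
    have FL': "L = F * ln F + F * ln (1 / c n)" "0 \<le> F * ln (1 / c n)"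
      unfolding L_def using F lc by (simp_all add: distrib_left)
    have FF: "F \<le> F * ln F" using F by simp
    have m: "1 \<le> m" "f n \<le> m" "real m \<le> 2 * F"
      using t(2)[of n] t(3)[of n] elim(1) by (auto simp: m_def F_def)
    have mln: "real m \<le> ln (real n)" using m(3) FF FL(1) L lnn by linarith
    also have "\<dots> \<le> real n" using n by (intro ln_bound) auto
    finally have mn: "m \<le> n" by simp
    define \<beta> where "\<beta> = real (n choose m) * (c n / real n) ^ (m - 1) * (1 - c n / real n) ^ (m * n)"
    have "real m * ln (real m) \<le> 4 * (F * ln F)"
    proof -
      have "ln (real m) \<le> ln (2 * F)" using m F by (intro ln_mono) auto
      also have "\<dots> = ln 2 + ln F" using F by (simp add: ln_mult)
      also have "\<dots> \<le> 2 * ln F" using F ln_2_less_1 by linarith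
      finally have "real m * ln (real m) \<le> (2 * F) * (2 * ln F)"
        using m F by (intro mult_mono) auto
      then show ?thesis by simp
    qed
    moreover have "real (m - 1) * ln (1 / c n) \<le> (2 * F) * ln (1 / c n)"
      using m lc by (intro mult_right_mono) auto
    ultimately have "ln (real n) / 2 \<le>
        ln (real n) - real m * ln (real m) - real (m - 1) * ln (1 / c n) - 2 * real m"
      using FF FL FL' L m(3) by linarith
    then have "exp (ln (real n) / 2) \<le>
        exp (ln (real n) - real m * ln (real m) - real (m - 1) * ln (1 / c n) - 2 * real m)" by simp
    also have "\<dots> \<le> \<beta>" unfolding \<beta>_def by (rule expected_copies_ge[OF m(1) mn c'])
    finally have \<beta>: "exp (ln (real n) / 2) \<le> \<beta>" .
    have \<beta>0: "0 < \<beta>" by (rule less_le_trans[OF exp_gt_zero \<beta>])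
    have p: "0 < c n / real n" "c n / real n < 1" using c' n by (auto simp: field_simps)
    have mm: "real (m * m) * (c n / real n) \<le> (ln (real n))\<^sup>2 / real n"
    proof -
      have "real (m * m) * c n \<le> (ln (real n))\<^sup>2 * 1"
        unfolding power2_eq_square of_nat_mult using mln c' lnn by (intro mult_mono) auto
      then show ?thesis using n by (simp add: divide_right_mono)
    qed
    have "1 / (1 - c n / real n) ^ (m * m) - 1 \<le> 2 * (real (m * m) * (c n / real n))"
      by (rule inverse_power_minus_one_le[OF less_imp_le[OF p(1)] p(2) order_trans[OF mm elim(6)]])
    with mm have \<alpha>: "1 / (1 - c n / real n) ^ (m * m) - 1 \<le> 2 * ((ln (real n))\<^sup>2 / real n)" by linarith
    have arith: "P \<le> x + 4 * y \<Longrightarrow> x \<le> w \<Longrightarrow> y \<le> 2 * z \<Longrightarrow> P \<le> w + 8 * z" for P x y w z :: real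
      by linarith
    have "measure_pmf.prob (gnp n (c n / real n))
       {G. card {C \<in> large_components (f n) G. mso_type k (block G C) {} [] = \<tau>} < K} \<le>
        4 / \<beta> + 4 * (1 / (1 - c n / real n) ^ (m * m) - 1)"
      unfolding t(1)[of n, symmetric] m_def
      by (rule prob_few_copies_le[OF p t(2) _ \<beta>0]) (use \<beta> elim(5) in \<open>auto simp: \<beta>_def m_def\<close>)
    moreover have "4 / \<beta> \<le> 4 * exp (- (ln (real n) / 2))"
      using \<beta> \<beta>0 by (simp add: exp_minus field_simps)
    ultimately show ?case unfolding B_def using \<alpha> by (rule arith)
  qed
  moreover have "B \<longlonglongrightarrow> 0" unfolding B_def by real_asymp
  ultimately show ?thesis
    by (rule tendsto_sandwich[OF always_eventually[OF allI[OF measure_nonneg]] _ tendsto_const])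
qed

section \<open>The zero-one law\<close>

text \<open>If \<open>f n\<close> is large and the graph is a forest, then all large components are trees with a type in
\<open>unbounded_types k\<close>. Then only the finitely many events that one of these types occurs fewer than \<open>K\<close>
times can make the graph atypical.\<close>

lemma atypical_tendsto_0:
  fixes c :: "nat \<Rightarrow> real" and f :: "nat \<Rightarrow> nat"
  assumes c: "\<And>n. n \<ge> 1 \<Longrightarrow> c n > 0" "c \<longlonglongrightarrow> 0"
    and f: "filterlim f at_top sequentially"
    and small: "(\<lambda>n. real (f n) * (ln (real (f n)) + ln (1 / c n))) \<in> o(\<lambda>n. ln (real n))"
  shows "(\<lambda>n. measure_pmf.prob (gnp n (c n / real n)) {G. \<not> typical k K (f n) G}) \<longlonglongrightarrow> 0"
proof -
  obtain M where M: "\<And>t. M \<le> nodes t \<Longrightarrow> tree_type k t \<in> unbounded_types k"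
    using bounded_types_bound by blast
  let ?few = "\<lambda>n \<tau>. {G. card {C \<in> large_components (f n) G. mso_type k (block G C) {} [] = \<tau>} < K}"
  define B where "B n = 2 * c n +
    (\<Sum>\<tau>\<in>unbounded_types k. measure_pmf.prob (gnp n (c n / real n)) (?few n \<tau>))" for n
  have "eventually (\<lambda>n. M \<le> f n) sequentially"
    using f unfolding filterlim_at_top by blast
  moreover have "eventually (\<lambda>n. c n < 1 / 2) sequentially"
    using order_tendstoD(2)[OF c(2), of "1 / 2"] by simp
  ultimately have "eventually (\<lambda>n. measure_pmf.prob (gnp n (c n / real n)) {G. \<not> typical k K (f n) G} \<le> B n) sequentially"
    using eventually_ge_at_top[of 1]
  proof eventually_elim
    case (elim n)
    let ?p = "c n / real n" let ?P = "measure_pmf.prob (gnp n ?p)"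
    have c': "0 < c n" "c n < 1 / 2" and n: "1 \<le> real n" using c(1)[of n] elim by auto
    have np: "real n * ?p = c n" using n by simp
    have p: "0 \<le> ?p" "?p \<le> 1" using c' n by (auto simp: field_simps)
    have sub: "{G. \<not> typical k K (f n) G} \<inter> set_pmf (gnp n ?p) \<subseteq>
        {G. \<exists>xs. cycle (edges G) xs} \<union> (\<Union>\<tau>\<in>unbounded_types k. ?few n \<tau>)"
    proof
      fix G assume "G \<in> {G. \<not> typical k K (f n) G} \<inter> set_pmf (gnp n ?p)"
      then have G: "G \<in> set_pmf (gnp n ?p)" and bad: "\<not> typical k K (f n) G" by auto
      show "G \<in> {G. \<exists>xs. cycle (edges G) xs} \<union> (\<Union>\<tau>\<in>unbounded_types k. ?few n \<tau>)"
      proof (cases "\<exists>xs. cycle (edges G) xs")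
        case False
        have fin: "finite (edges G)"
          by (rule finite_subset[OF gnp_support(2)[OF G] finite_vertex_pairs])
        have "mso_type k (block G C) {} [] \<in> unbounded_types k" if C: "C \<in> large_components (f n) G" for C
        proof -
          obtain t where "f n \<le> nodes t" "mso_type k (block G C) {} [] = tree_type k t"
            using forest_block_type[OF gnp_simple[OF G] fin _ C, of k] False by blast
          then show ?thesis using M[of t] elim(1) by simp
        qed
        with bad show ?thesis unfolding typical_def by (auto simp: not_le)
      qed simp
    qed
    have "?P {G. \<not> typical k K (f n) G} = ?P ({G. \<not> typical k K (f n) G} \<inter> set_pmf (gnp n ?p))"
      by (simp add: measure_Int_set_pmf)
    also have "\<dots> \<le> ?P ({G. \<exists>xs. cycle (edges G) xs} \<union> (\<Union>\<tau>\<in>unbounded_types k. ?few n \<tau>))"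
      by (rule measure_pmf.finite_measure_mono[OF sub]) simp
    also have "\<dots> \<le> ?P {G. \<exists>xs. cycle (edges G) xs} + ?P (\<Union>\<tau>\<in>unbounded_types k. ?few n \<tau>)"
      by (rule measure_Un_le) auto
    also have "\<dots> \<le> 2 * c n + (\<Sum>\<tau>\<in>unbounded_types k. ?P (?few n \<tau>))"
    proof (rule add_mono)
      show "?P {G. \<exists>xs. cycle (edges G) xs} \<le> 2 * c n"
        using prob_gnp_cycle_le[OF p, of n] c' unfolding np by simp
      show "?P (\<Union>\<tau>\<in>unbounded_types k. ?few n \<tau>) \<le> (\<Sum>\<tau>\<in>unbounded_types k. ?P (?few n \<tau>))"
        by (rule measure_pmf.finite_measure_subadditive_finite) (auto simp: finite_unbounded_types)
    qed
    finally show ?case by (simp add: B_def)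
  qed
  moreover have "B \<longlonglongrightarrow> 0"
  proof -
    have "B \<longlonglongrightarrow> 2 * 0 + (\<Sum>\<tau>\<in>unbounded_types k. 0)"
      unfolding B_def
      by (intro tendsto_add tendsto_mult tendsto_const tendsto_sum c(2) few_copies_tendsto_0[OF c f small])
    then show ?thesis by simp
  qed
  ultimately show ?thesis
    by (rule tendsto_sandwich[OF always_eventually[OF allI[OF measure_nonneg]] _ tendsto_const])
qed

text \<open>If \<open>R\<close> has the same truth value at all outcomes, over all \<open>n\<close>, that satisfy a property \<open>Q\<close> of
probability tending to one, then that truth value decides between the two limits.\<close>

lemma zero_or_one_of_agreement:
  fixes M :: "nat \<Rightarrow> 'a pmf"
  assumes lim: "(\<lambda>n. measure_pmf.prob (M n) {x. \<not> Q n x}) \<longlonglongrightarrow> 0"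
    and agree: "\<And>n n' x x'. x \<in> set_pmf (M n) \<Longrightarrow> x' \<in> set_pmf (M n') \<Longrightarrow> Q n x \<Longrightarrow> Q n' x' \<Longrightarrow>
      R n x \<longleftrightarrow> R n' x'"
  shows "(\<lambda>n. measure_pmf.prob (M n) {x. R n x}) \<longlonglongrightarrow> 0 \<or> (\<lambda>n. measure_pmf.prob (M n) {x. R n x}) \<longlonglongrightarrow> 1"
proof (cases "\<exists>n x. x \<in> set_pmf (M n) \<and> Q n x \<and> R n x")
  case True
  then obtain n0 x0 where x0: "x0 \<in> set_pmf (M n0)" "Q n0 x0" "R n0 x0" by blast
  have "measure_pmf.prob (M n) {x. \<not> R n x} \<le> measure_pmf.prob (M n) {x. \<not> Q n x}" for n
  proof -
    have "measure_pmf.prob (M n) {x. \<not> R n x} = measure_pmf.prob (M n) ({x. \<not> R n x} \<inter> set_pmf (M n))"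
      by (simp add: measure_Int_set_pmf)
    also have "\<dots> \<le> measure_pmf.prob (M n) {x. \<not> Q n x}"
      by (rule measure_pmf.finite_measure_mono) (use agree[OF _ x0(1) _ x0(2)] x0(3) in auto)
    finally show ?thesis .
  qed
  then have "(\<lambda>n. measure_pmf.prob (M n) {x. \<not> R n x}) \<longlonglongrightarrow> 0"
    by (intro tendsto_sandwich[OF always_eventually[OF allI[OF measure_nonneg]] always_eventually[OF allI] tendsto_const lim])
  then have "(\<lambda>n. 1 - measure_pmf.prob (M n) {x. \<not> R n x}) \<longlonglongrightarrow> 1 - 0"
    by (intro tendsto_diff tendsto_const)
  moreover have "1 - measure_pmf.prob (M n) {x. \<not> R n x} = measure_pmf.prob (M n) {x. R n x}" for n
    using measure_pmf.prob_compl[of "{x. \<not> R n x}" "M n"] by (simp add: Compl_eq_Diff_UNIV[symmetric] Collect_neg_eq[symmetric])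
  ultimately show ?thesis by simp
next
  case False
  have "measure_pmf.prob (M n) {x. R n x} \<le> measure_pmf.prob (M n) {x. \<not> Q n x}" for n
  proof -
    have "measure_pmf.prob (M n) {x. R n x} = measure_pmf.prob (M n) ({x. R n x} \<inter> set_pmf (M n))"
      by (simp add: measure_Int_set_pmf)
    also have "\<dots> \<le> measure_pmf.prob (M n) {x. \<not> Q n x}"
      by (rule measure_pmf.finite_measure_mono) (use False in auto)
    finally show ?thesis .
  qed
  then have "(\<lambda>n. measure_pmf.prob (M n) {x. R n x}) \<longlonglongrightarrow> 0"
    by (intro tendsto_sandwich[OF always_eventually[OF allI[OF measure_nonneg]] always_eventually[OF allI] tendsto_const lim])
  then show ?thesis by simp
qed

theorem theorem1p1:
  fixes c :: "nat \<Rightarrow> real" and f :: "nat \<Rightarrow> nat" and p :: "nat \<Rightarrow> real"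
    and H :: "nat \<Rightarrow> nat ugraph pmf"
  assumes "\<And>n. n \<ge> 1 \<Longrightarrow> c n > 0"
    and "c \<longlonglongrightarrow> 0"
    and "\<And>n. p n = c n / real n"
    and "\<And>n. n \<ge> 1 \<Longrightarrow> f n \<ge> 1"
    and "filterlim f at_top sequentially"
    and "(\<lambda>n. real (f n) * (ln (real (f n)) + ln (1 / c n))) \<in> o(\<lambda>n. ln (real n))"
    and "\<And>n. H n = map_pmf (prune (f n)) (gnp n (p n))"
  shows "zero_one_law mso2_sentences mso2_models H
    \<and> zero_one_law mso1_sentences mso2_models H
    \<and> zero_one_law fo_sentences fo_models H"
proof (intro conjI)
  have prob_H: "measure_pmf.prob (H n) {G. Q G} = measure_pmf.prob (gnp n (c n / real n)) {G. Q (prune (f n) G)}"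
    for n Q by (simp add: assms(3,7) vimage_def)
  show mso2: "zero_one_law mso2_sentences mso2_models H"
    unfolding zero_one_law_def prob_H
  proof
    fix \<phi> assume \<phi>: "\<phi> \<in> mso2_sentences"
    define k where "k = quantifier_depth \<phi>"
    obtain K where K: "absorbing TYPE(nat) k K" using absorbing_exists by blast
    let ?M = "\<lambda>n. gnp n (c n / real n)"
    show "(\<lambda>n. measure_pmf.prob (?M n) {G. mso2_models (prune (f n) G) \<phi>}) \<longlonglongrightarrow> 0 \<or>
        (\<lambda>n. measure_pmf.prob (?M n) {G. mso2_models (prune (f n) G) \<phi>}) \<longlonglongrightarrow> 1"
    proof (rule zero_or_one_of_agreement[where M = ?M and Q = "\<lambda>n. typical k K (f n)"])
      show "(\<lambda>n. measure_pmf.prob (?M n) {G. \<not> typical k K (f n) G}) \<longlonglongrightarrow> 0"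
        by (rule atypical_tendsto_0[OF assms(1,2,5,6)])
      show "mso2_models (prune (f n) G) \<phi> \<longleftrightarrow> mso2_models (prune (f n') G') \<phi>"
        if G: "G \<in> set_pmf (?M n)" "G' \<in> set_pmf (?M n')" and typical: "typical k K (f n) G" "typical k K (f n') G'"
        for n n' G G'
      proof (rule mso2_models_determined_by_type[OF \<phi>, folded k_def])
        show "simple (prune (f n) G)" "simple (prune (f n') G')"
          using G gnp_simple simple_prune by blast+
        show "mso_type k (incidence_universe (prune (f n) G)) {} [] =
            mso_type k (incidence_universe (prune (f n') G')) {} []"
          by (rule typical_types_agree[OF K gnp_simple[OF G(1)] _ typical(1) gnp_simple[OF G(2)] _ typical(2)])
            (simp_all add: gnp_support(1)[OF G(1)] gnp_support(1)[OF G(2)])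
      qed
    qed
  qed
  show "zero_one_law mso1_sentences mso2_models H"
    using mso2 by (auto simp: zero_one_law_def mso1_sentences_def)
  show "zero_one_law fo_sentences fo_models H"
    unfolding zero_one_law_def
  proof
    fix \<phi> assume \<phi>: "\<phi> \<in> fo_sentences"
    have "measure_pmf.prob (H n) {G. fo_models G \<phi>} = measure_pmf.prob (H n) {G. mso2_models G (mso2_of_fo \<phi>)}" for n
    proof (rule measure_pmf.finite_measure_eq_AE)
      show "AE G in measure_pmf (H n). G \<in> {G. fo_models G \<phi>} \<longleftrightarrow> G \<in> {G. mso2_models G (mso2_of_fo \<phi>)}"
        unfolding AE_measure_pmf_iff
      proof
        fix G assume "G \<in> set_pmf (H n)"
        then obtain G' where G': "G' \<in> set_pmf (gnp n (p n))" "G = prune (f n) G'"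
          unfolding assms(7) set_map_pmf by blast
        have "simple G" unfolding G'(2) by (rule simple_prune[OF gnp_simple[OF G'(1)]])
        then show "G \<in> {G. fo_models G \<phi>} \<longleftrightarrow> G \<in> {G. mso2_models G (mso2_of_fo \<phi>)}"
          by (simp add: fo_models_iff_mso2_models)
      qed
    qed simp_all
    then show "(\<lambda>n. measure_pmf.prob (H n) {G. fo_models G \<phi>}) \<longlonglongrightarrow> 0 \<or>
        (\<lambda>n. measure_pmf.prob (H n) {G. fo_models G \<phi>}) \<longlonglongrightarrow> 1"
      using mso2 mso2_of_fo_sentences[OF \<phi>] by (simp add: zero_one_law_def)
  qed
qed

end
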